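(* Let $n\ge 2$, $m\ge 0$, let $(\overline{M}^{n+m+1}=I\times F^{n+m},\ \overline{g}=-\beta\,dt^2+g_t)$ be an orthogonally splitted spacetime and let $\Sigma^n$ be a spacelike submanifold in $\overline{M}$. Assume that the following conditions hold: (i) $\mathrm{tr}\,\xi\geq 0$ and $(\partial_t\beta)_{|\Sigma}\leq 0$ (resp. $\mathrm{tr}\,\xi\leq 0$ and $(\partial_t\beta)_{|\Sigma}\geq 0$); (ii) the mean curvature vector of $\Sigma$ satisfies $\overline{g}(\partial_t,\overrightarrow{H})\leq 0$ (resp. $\overline{g}(\partial_t,\overrightarrow{H})\geq 0$). Then $\tau$ cannot achieve a strict local minimum (resp. maximum) on $\Sigma$.
   Context: Orthogonally splitted spacetime: $\overline{M}^{n+m+1}=I\times F^{n+m}$ with $I\subset\mathbb{R}$ an open interval, $F$ an $(n+m)$-dimensional smooth manifold, and Lorentzian metric $\overline{g}=-\beta\,\pi_{\mathbb{R}}^*(dt^2)+\pi_F^*(g_t)$ (written $-\beta dt^2+g_t$), where $\pi_{\mathbb{R}},\pi_F$ are the projections onto $I$ and $F$, $\beta\in C^\infty(\overline{M})$ is positive and $\{g_t\}_{t\in I}$ is a smooth one-parameter family of Riemannian metrics on $F$. Submanifolds are connected immersed submanifolds; $\Sigma^n$ is spacelike if the induced metric $g$ is Riemannian. Second fundamental form (sign convention): $II(X,Y)=-(\overline{\nabla}_XY)^\perp$, with $\overline{\nabla}$ the Levi-Civita connection of $\overline{M}$; mean curvature vector field: $\overrightarrow{H}=\sum_{i=1}^n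 II(E_i,E_i)$ for a local orthonormal frame $\{E_i\}$ of $\Sigma$. Along $\Sigma$, $\xi(V,W)=(\mathcal{L}_{\partial_t}g_t)(d\pi_F(V),d\pi_F(W))$ for $V,W$ tangent to $\Sigma$, where $\mathcal{L}_{\partial_t}g_t$ is the Lie derivative (i.e. the derivative of $g_t$ in $t$), and $\mathrm{tr}\,\xi=\sum_{i=1}^n\xi(E_i,E_i)$ is its trace with respect to $g$. The notation $(\partial_t\beta)_{|\Sigma}$ is the restriction of $\partial_t\beta$ to $\Sigma$. $\tau:=\pi_{\mathbb{R}|\Sigma}:\Sigma\to\mathbb{R}$. *)

theory Defs
  imports "HOL-Analysis.Analysis"
begin

section \<open>Smooth functions on open subsets of Euclidean spaces\<close>

text \<open>Only used for open \<open>S\<close>. Directional derivatives in all fixed directions span the full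
  iterated derivatives since the domain is finite-dimensional in all uses.\<close>

primrec Ck_on :: "nat \<Rightarrow> ('a::real_normed_vector \<Rightarrow> 'b::real_normed_vector) \<Rightarrow> 'a set \<Rightarrow> bool" where
  "Ck_on 0 f S \<longleftrightarrow> continuous_on S f"
| "Ck_on (Suc k) f S \<longleftrightarrow>
     (\<forall>x\<in>S. f differentiable (at x)) \<and> (\<forall>v. Ck_on k (\<lambda>x. frechet_derivative f (at x) v) S)"

definition smooth_on :: "('a::real_normed_vector \<Rightarrow> 'b::real_normed_vector) \<Rightarrow> 'a set \<Rightarrow> bool" where
  "smooth_on f S \<longleftrightarrow> (\<forall>k. Ck_on k f S)"


section \<open>Smooth manifolds\<close>

text \<open>A chart is a pair \<open>(U, \<phi>)\<close> of a domain and a coordinate map. A manifold is a topological space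
  with a smooth atlas (not necessarily maximal) and, at every point, a preferred chart of the atlas.
  The preferred chart serves to represent tangent vectors: a tangent vector at \<open>p\<close> is the vector of
  its components in \<open>chart_at M p\<close>, so that every tangent space is a copy of the model space
  \<open>'e\<close>. No notion below depends on the choice of the preferred charts beyond this identification.\<close>

type_synonym ('p, 'e) chart = "'p set \<times> ('p \<Rightarrow> 'e)"

record ('p, 'e) manifold =
  mtop :: "'p topology"
  atlas :: "('p, 'e) chart set"
  chart_at :: "'p \<Rightarrow> ('p, 'e) chart"

abbreviation points :: "('p, 'e) manifold \<Rightarrow> 'p set" where
  "points M \<equiv> topspace (mtop M)"

abbreviation cdom :: "('p, 'e) chart \<Rightarrow> 'p set" where
  "cdom c \<equiv> fst c"

abbreviation coords :: "('p, 'e) chart \<Rightarrow> 'p \<Rightarrow> 'e" where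
  "coords c \<equiv> snd c"

definition param :: "('p, 'e) chart \<Rightarrow> 'e \<Rightarrow> 'p" where
  "param c = inv_into (cdom c) (coords c)"

definition transition :: "('p, 'e) chart \<Rightarrow> ('p, 'e) chart \<Rightarrow> 'e \<Rightarrow> 'e" where
  "transition c d = coords d \<circ> param c"

definition is_chart :: "'p topology \<Rightarrow> ('p, 'e::euclidean_space) chart \<Rightarrow> bool" where
  "is_chart X c \<longleftrightarrow> openin X (cdom c) \<and> open (coords c ` cdom c) \<and>
     homeomorphic_map (subtopology X (cdom c)) (top_of_set (coords c ` cdom c)) (coords c)"

definition smooth_manifold :: "('p, 'e::euclidean_space) manifold \<Rightarrow> bool" where
  "smooth_manifold M \<longleftrightarrow>
     Hausdorff_space (mtop M) \<and> second_countable (mtop M) \<and>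
     (\<forall>c\<in>atlas M. is_chart (mtop M) c) \<and>
     (\<forall>c\<in>atlas M. \<forall>d\<in>atlas M. smooth_on (transition c d) (coords c ` (cdom c \<inter> cdom d))) \<and>
     (\<forall>p\<in>points M. chart_at M p \<in> atlas M \<and> p \<in> cdom (chart_at M p))"

definition interval_manifold :: "real set \<Rightarrow> (real, real) manifold" where
  "interval_manifold I =
     \<lparr>mtop = top_of_set I, atlas = {(I, \<lambda>t. t)}, chart_at = (\<lambda>_. (I, \<lambda>t. t))\<rparr>"

definition prod_chart :: "('p, 'e) chart \<Rightarrow> ('q, 'f) chart \<Rightarrow> ('p \<times> 'q, 'e \<times> 'f) chart" where
  "prod_chart c d = (cdom c \<times> cdom d, map_prod (coords c) (coords d))"

text \<open>The preferred charts of a product are the products of the preferred charts. Hence the tangent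
  space of the product is the product of the tangent spaces, and the differentials of the two
  projections are \<open>fst\<close> and \<open>snd\<close> (lemmas \<open>tmap_fst\<close> and \<open>tmap_snd\<close> below).\<close>

definition prod_manifold :: "('p, 'e) manifold \<Rightarrow> ('q, 'f) manifold \<Rightarrow> ('p \<times> 'q, 'e \<times> 'f) manifold"
  where
  "prod_manifold M N =
     \<lparr>mtop = prod_topology (mtop M) (mtop N),
      atlas = {prod_chart c d | c d. c \<in> atlas M \<and> d \<in> atlas N},
      chart_at = (\<lambda>(p, q). prod_chart (chart_at M p) (chart_at N q))\<rparr>"

definition smooth_map ::
  "('p, 'e::euclidean_space) manifold \<Rightarrow> ('q, 'f::euclidean_space) manifold \<Rightarrow> ('p \<Rightarrow> 'q) \<Rightarrow> bool" where
  "smooth_map M N f \<longleftrightarrow>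
     continuous_map (mtop M) (mtop N) f \<and>
     (\<forall>c\<in>atlas M. \<forall>d\<in>atlas N.
        smooth_on (coords d \<circ> f \<circ> param c) (coords c ` {p \<in> cdom c. f p \<in> cdom d}))"

definition smooth_fun_on ::
  "('p, 'e::euclidean_space) manifold \<Rightarrow> 'p set \<Rightarrow> ('p \<Rightarrow> real) \<Rightarrow> bool" where
  "smooth_fun_on M W f \<longleftrightarrow> (\<forall>c\<in>atlas M. smooth_on (f \<circ> param c) (coords c ` (cdom c \<inter> W)))"


section \<open>Tangent vectors and vector fields\<close>

definition tmap ::
  "('p, 'e::euclidean_space) manifold \<Rightarrow> ('q, 'f::euclidean_space) manifold \<Rightarrow> ('p \<Rightarrow> 'q) \<Rightarrow> 'p \<Rightarrow> 'e \<Rightarrow> 'f"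
  where
  "tmap M N f p =
     frechet_derivative (coords (chart_at N (f p)) \<circ> f \<circ> param (chart_at M p))
       (at (coords (chart_at M p) p))"

definition vderiv ::
  "('p, 'e::euclidean_space) manifold \<Rightarrow> ('p \<Rightarrow> 'b::real_normed_vector) \<Rightarrow> 'p \<Rightarrow> 'e \<Rightarrow> 'b" where
  "vderiv M f p = frechet_derivative (f \<circ> param (chart_at M p)) (at (coords (chart_at M p) p))"

text \<open>Components in the chart \<open>c\<close> of a tangent vector at \<open>p\<close>, and conversely the tangent vector at
  \<open>p\<close> with components \<open>u\<close> in the chart \<open>c\<close>; as a function of \<open>p\<close> the latter is the coordinate
  vector field \<open>\<Sum>i. u\<^sub>i \<partial>\<^sub>i\<close> on the domain of \<open>c\<close>.\<close>
definition chart_components :: "('p, 'e::euclidean_space) manifold \<Rightarrow> ('p, 'e) chart \<Rightarrow> 'p \<Rightarrow> 'e \<Rightarrow> 'e" where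
  "chart_components M c p =
     frechet_derivative (transition (chart_at M p) c) (at (coords (chart_at M p) p))"

definition coord_field :: "('p, 'e::euclidean_space) manifold \<Rightarrow> ('p, 'e) chart \<Rightarrow> 'e \<Rightarrow> 'p \<Rightarrow> 'e" where
  "coord_field M c u p = frechet_derivative (transition c (chart_at M p)) (at (coords c p)) u"

definition smooth_vector_field_on ::
  "('p, 'e::euclidean_space) manifold \<Rightarrow> 'p set \<Rightarrow> ('p \<Rightarrow> 'e) \<Rightarrow> bool" where
  "smooth_vector_field_on M W X \<longleftrightarrow>
     (\<forall>c\<in>atlas M. smooth_on (\<lambda>y. chart_components M c (param c y) (X (param c y))) (coords c ` (cdom c \<inter> W)))"

text \<open>In coordinates \<open>[X, Y]\<^sup>k = X(Y\<^sup>k) - Y(X\<^sup>k)\<close>, here in the preferred chart at the point.\<close>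
definition lie_bracket ::
  "('p, 'e::euclidean_space) manifold \<Rightarrow> ('p \<Rightarrow> 'e) \<Rightarrow> ('p \<Rightarrow> 'e) \<Rightarrow> 'p \<Rightarrow> 'e" where
  "lie_bracket M X Y p =
     (let c = chart_at M p in
        vderiv M (\<lambda>q. chart_components M c q (Y q)) p (X p) - vderiv M (\<lambda>q. chart_components M c q (X q)) p (Y p))"


section \<open>Metrics and connections\<close>

type_synonym ('p, 'e) tensor2 = "'p \<Rightarrow> 'e \<Rightarrow> 'e \<Rightarrow> real"

definition smooth_tensor2 ::
  "('p, 'e::euclidean_space) manifold \<Rightarrow> ('p, 'e) tensor2 \<Rightarrow> bool" where
  "smooth_tensor2 M h \<longleftrightarrow>
     (\<forall>p\<in>points M. bilinear (h p)) \<and>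
     (\<forall>c\<in>atlas M. \<forall>u w.
        smooth_on (\<lambda>y. h (param c y) (coord_field M c u (param c y)) (coord_field M c w (param c y)))
          (coords c ` cdom c))"

definition riemannian_metric ::
  "('p, 'e::euclidean_space) manifold \<Rightarrow> ('p, 'e) tensor2 \<Rightarrow> bool" where
  "riemannian_metric M h \<longleftrightarrow>
     smooth_tensor2 M h \<and>
     (\<forall>p\<in>points M. (\<forall>u w. h p u w = h p w u) \<and> (\<forall>u. u \<noteq> 0 \<longrightarrow> h p u u > 0))"

text \<open>Connections act on vector fields that need only be smooth on some open set \<open>W\<close>; the values
  outside \<open>W\<close> are irrelevant.\<close>
definition affine_connection ::
  "('p, 'e::euclidean_space) manifold \<Rightarrow> (('p \<Rightarrow> 'e) \<Rightarrow> ('p \<Rightarrow> 'e) \<Rightarrow> 'p \<Rightarrow> 'e) \<Rightarrow> bool" where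
  "affine_connection M nabla \<longleftrightarrow>
     (\<forall>W X Y. openin (mtop M) W \<and> smooth_vector_field_on M W X \<and> smooth_vector_field_on M W Y \<longrightarrow>
        smooth_vector_field_on M W (nabla X Y) \<and>
        (\<forall>X' Y'. (\<forall>p\<in>W. X' p = X p \<and> Y' p = Y p) \<longrightarrow> (\<forall>p\<in>W. nabla X' Y' p = nabla X Y p)) \<and>
        (\<forall>X'. smooth_vector_field_on M W X' \<longrightarrow>
           (\<forall>p\<in>W. nabla (\<lambda>q. X q + X' q) Y p = nabla X Y p + nabla X' Y p)) \<and>
        (\<forall>Y'. smooth_vector_field_on M W Y' \<longrightarrow>
           (\<forall>p\<in>W. nabla X (\<lambda>q. Y q + Y' q) p = nabla X Y p + nabla X Y' p)) \<and>
        (\<forall>f. smooth_fun_on M W f \<longrightarrow>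
           (\<forall>p\<in>W. nabla (\<lambda>q. f q *\<^sub>R X q) Y p = f p *\<^sub>R nabla X Y p \<and>
                   nabla X (\<lambda>q. f q *\<^sub>R Y q) p = vderiv M f p (X p) *\<^sub>R Y p + f p *\<^sub>R nabla X Y p)))"

definition levi_civita_connection ::
  "('p, 'e::euclidean_space) manifold \<Rightarrow> ('p, 'e) tensor2 \<Rightarrow>
     (('p \<Rightarrow> 'e) \<Rightarrow> ('p \<Rightarrow> 'e) \<Rightarrow> 'p \<Rightarrow> 'e) \<Rightarrow> bool" where
  "levi_civita_connection M h nabla \<longleftrightarrow>
     affine_connection M nabla \<and>
     (\<forall>W X Y. openin (mtop M) W \<and> smooth_vector_field_on M W X \<and> smooth_vector_field_on M W Y \<longrightarrow>
        (\<forall>p\<in>W. nabla X Y p - nabla Y X p = lie_bracket M X Y p) \<and>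
        (\<forall>Z. smooth_vector_field_on M W Z \<longrightarrow>
           (\<forall>p\<in>W. vderiv M (\<lambda>q. h q (Y q) (Z q)) p (X p) =
              h p (nabla X Y p) (Z p) + h p (Y p) (nabla X Z p))))"


section \<open>Orthogonally splitted spacetimes\<close>

abbreviation spacetime :: "real set \<Rightarrow> ('x, 'f) manifold \<Rightarrow> (real \<times> 'x, real \<times> 'f) manifold" where
  "spacetime I F \<equiv> prod_manifold (interval_manifold I) F"

definition split_metric ::
  "(real \<times> 'x \<Rightarrow> real) \<Rightarrow> (real \<Rightarrow> ('x, 'f) tensor2) \<Rightarrow> (real \<times> 'x, real \<times> 'f) tensor2" where
  "split_metric \<beta> g p V W = - \<beta> p * (fst V * fst W) + g (fst p) (snd p) (snd V) (snd W)"

text \<open>Smoothness of the family \<open>g\<^sub>t\<close> is joint smoothness in \<open>t\<close> and the point of \<open>F\<close>.\<close>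
definition orthogonally_splitted ::
  "real set \<Rightarrow> ('x, 'f::euclidean_space) manifold \<Rightarrow> (real \<times> 'x \<Rightarrow> real) \<Rightarrow>
     (real \<Rightarrow> ('x, 'f) tensor2) \<Rightarrow> bool" where
  "orthogonally_splitted I F \<beta> g \<longleftrightarrow>
     open I \<and> is_interval I \<and> I \<noteq> {} \<and> smooth_manifold F \<and>
     smooth_fun_on (spacetime I F) (points (spacetime I F)) \<beta> \<and>
     (\<forall>p\<in>points (spacetime I F). \<beta> p > 0) \<and>
     (\<forall>t\<in>I. riemannian_metric F (g t)) \<and>
     smooth_tensor2 (spacetime I F) (\<lambda>p V W. g (fst p) (snd p) (snd V) (snd W))"

definition dt_field :: "real \<times> 'f::euclidean_space" where
  "dt_field = (1, 0)"

definition dt_beta :: "(real \<times> 'x \<Rightarrow> real) \<Rightarrow> real \<times> 'x \<Rightarrow> real" where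
  "dt_beta \<beta> p = deriv (\<lambda>s. \<beta> (s, snd p)) (fst p)"

text \<open>The tangent space of \<open>F\<close> at \<open>snd p\<close> and its identification with \<open>'f\<close> do not depend on \<open>t\<close>,
  so the Lie derivative of \<open>g\<^sub>t\<close> along \<open>\<partial>\<^sub>t\<close> is the derivative in \<open>t\<close> for fixed arguments.\<close>
definition lie_dt :: "(real \<Rightarrow> ('x, 'f) tensor2) \<Rightarrow> real \<times> 'x \<Rightarrow> 'f \<Rightarrow> 'f \<Rightarrow> real" where
  "lie_dt g p u w = deriv (\<lambda>s. g s (snd p) u w) (fst p)"


section \<open>Spacelike submanifolds\<close>

text \<open>An immersed submanifold is a manifold \<open>S\<close> with an immersion \<open>\<iota>\<close>, not assumed injective.\<close>

definition induced_metric ::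
  "('s, 'e::euclidean_space) manifold \<Rightarrow> ('p, 'd::euclidean_space) manifold \<Rightarrow> ('p, 'd) tensor2 \<Rightarrow>
     ('s \<Rightarrow> 'p) \<Rightarrow> ('s, 'e) tensor2" where
  "induced_metric S M h \<iota> p u w = h (\<iota> p) (tmap S M \<iota> p u) (tmap S M \<iota> p w)"

definition immersed_submanifold ::
  "('s, 'e::euclidean_space) manifold \<Rightarrow> ('p, 'd::euclidean_space) manifold \<Rightarrow> ('s \<Rightarrow> 'p) \<Rightarrow> bool" where
  "immersed_submanifold S M \<iota> \<longleftrightarrow>
     smooth_manifold S \<and> connected_space (mtop S) \<and> smooth_map S M \<iota> \<and>
     (\<forall>p\<in>points S. inj (tmap S M \<iota> p))"

definition spacelike_submanifold ::
  "('s, 'e::euclidean_space) manifold \<Rightarrow> ('p, 'd::euclidean_space) manifold \<Rightarrow> ('p, 'd) tensor2 \<Rightarrow>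
     ('s \<Rightarrow> 'p) \<Rightarrow> bool" where
  "spacelike_submanifold S M h \<iota> \<longleftrightarrow>
     immersed_submanifold S M \<iota> \<and> riemannian_metric S (induced_metric S M h \<iota>)"

text \<open>Covariant derivative at \<open>p\<close>, in the direction \<open>v\<close>, of a vector field \<open>Y\<close> along \<open>\<iota>\<close>. With the
  components \<open>Y\<^sup>k\<close> of \<open>Y\<close> in a chart of \<open>M\<close> around \<open>\<iota> p\<close>, it is
  \<open>\<Sum>k. v(Y\<^sup>k) \<partial>\<^sub>k + \<Sum>k. Y\<^sup>k(p) \<nabla>\<^bsub>d\<iota> v\<^esub> \<partial>\<^sub>k\<close>, which agrees with the covariant derivative
  of a local extension of \<open>Y\<close>. For \<open>c = chart_at M (\<iota> p)\<close>, tangent vectors at \<open>\<iota> p\<close> coincide with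
  their components in \<open>c\<close>.\<close>
definition cov_deriv_along ::
  "('s, 'e::euclidean_space) manifold \<Rightarrow> ('p, 'd::euclidean_space) manifold \<Rightarrow>
     (('p \<Rightarrow> 'd) \<Rightarrow> ('p \<Rightarrow> 'd) \<Rightarrow> 'p \<Rightarrow> 'd) \<Rightarrow> ('s \<Rightarrow> 'p) \<Rightarrow> 's \<Rightarrow> 'e \<Rightarrow> ('s \<Rightarrow> 'd) \<Rightarrow> 'd" where
  "cov_deriv_along S M nabla \<iota> p v Y =
     (let c = chart_at M (\<iota> p) in
        vderiv S (\<lambda>q. chart_components M c (\<iota> q) (Y q)) p v +
        nabla (coord_field M c (tmap S M \<iota> p v)) (coord_field M c (Y p)) (\<iota> p))"

definition normal_part ::
  "('s, 'e::euclidean_space) manifold \<Rightarrow> ('p, 'd::euclidean_space) manifold \<Rightarrow> ('p, 'd) tensor2 \<Rightarrow>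
     ('s \<Rightarrow> 'p) \<Rightarrow> 's \<Rightarrow> 'd \<Rightarrow> 'd" where
  "normal_part S M h \<iota> p z =
     (THE w. z - w \<in> range (tmap S M \<iota> p) \<and> (\<forall>u. h (\<iota> p) w (tmap S M \<iota> p u) = 0))"

text \<open>\<open>II(X, Y)\<close> for vector fields \<open>X\<close>, \<open>Y\<close> on \<open>S\<close>, and its value on tangent vectors at \<open>p\<close>, obtained
  by extending them to coordinate vector fields (by tensoriality, lemma \<open>second_fundamental_form_eq_at\<close>
  below, any other local extension gives the same).\<close>
definition second_fundamental_form ::
  "('s, 'e::euclidean_space) manifold \<Rightarrow> ('p, 'd::euclidean_space) manifold \<Rightarrow> ('p, 'd) tensor2 \<Rightarrow>
     (('p \<Rightarrow> 'd) \<Rightarrow> ('p \<Rightarrow> 'd) \<Rightarrow> 'p \<Rightarrow> 'd) \<Rightarrow> ('s \<Rightarrow> 'p) \<Rightarrow> ('s \<Rightarrow> 'e) \<Rightarrow> ('s \<Rightarrow> 'e) \<Rightarrow> 's \<Rightarrow> 'd" where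
  "second_fundamental_form S M h nabla \<iota> X Y p =
     - normal_part S M h \<iota> p (cov_deriv_along S M nabla \<iota> p (X p) (\<lambda>q. tmap S M \<iota> q (Y q)))"

definition second_fundamental_form_at ::
  "('s, 'e::euclidean_space) manifold \<Rightarrow> ('p, 'd::euclidean_space) manifold \<Rightarrow> ('p, 'd) tensor2 \<Rightarrow>
     (('p \<Rightarrow> 'd) \<Rightarrow> ('p \<Rightarrow> 'd) \<Rightarrow> 'p \<Rightarrow> 'd) \<Rightarrow> ('s \<Rightarrow> 'p) \<Rightarrow> 's \<Rightarrow> 'e \<Rightarrow> 'e \<Rightarrow> 'd" where
  "second_fundamental_form_at S M h nabla \<iota> p u w =
     second_fundamental_form S M h nabla \<iota>
       (coord_field S (chart_at S p) u) (coord_field S (chart_at S p) w) p"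

definition orthonormal_frame :: "('e::euclidean_space \<Rightarrow> 'e \<Rightarrow> real) \<Rightarrow> ('e \<Rightarrow> 'e) \<Rightarrow> bool" where
  "orthonormal_frame h E \<longleftrightarrow> (\<forall>i\<in>Basis. \<forall>j\<in>Basis. h (E i) (E j) = (if i = j then 1 else 0))"

text \<open>Frames are indexed by the standard basis of the model space; the trace of a bilinear map
  does not depend on the orthonormal frame.\<close>
definition metric_trace ::
  "('e::euclidean_space \<Rightarrow> 'e \<Rightarrow> real) \<Rightarrow> ('e \<Rightarrow> 'e \<Rightarrow> 'b::comm_monoid_add) \<Rightarrow> 'b" where
  "metric_trace h B = (let E = (SOME E. orthonormal_frame h E) in \<Sum>i\<in>Basis. B (E i) (E i))"

definition mean_curvature_vector ::
  "('s, 'e::euclidean_space) manifold \<Rightarrow> ('p, 'd::euclidean_space) manifold \<Rightarrow> ('p, 'd) tensor2 \<Rightarrow>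
     (('p \<Rightarrow> 'd) \<Rightarrow> ('p \<Rightarrow> 'd) \<Rightarrow> 'p \<Rightarrow> 'd) \<Rightarrow> ('s \<Rightarrow> 'p) \<Rightarrow> 's \<Rightarrow> 'd" where
  "mean_curvature_vector S M h nabla \<iota> p =
     metric_trace (induced_metric S M h \<iota> p) (second_fundamental_form_at S M h nabla \<iota> p)"

definition xi ::
  "('s, 'e::euclidean_space) manifold \<Rightarrow> real set \<Rightarrow> ('x, 'f::euclidean_space) manifold \<Rightarrow>
     (real \<Rightarrow> ('x, 'f) tensor2) \<Rightarrow> ('s \<Rightarrow> real \<times> 'x) \<Rightarrow> 's \<Rightarrow> 'e \<Rightarrow> 'e \<Rightarrow> real" where
  "xi S I F g \<iota> p v w =
     lie_dt g (\<iota> p) (snd (tmap S (spacetime I F) \<iota> p v)) (snd (tmap S (spacetime I F) \<iota> p w))"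


section \<open>Strict local extrema\<close>

definition strict_local_min :: "'p topology \<Rightarrow> ('p \<Rightarrow> real) \<Rightarrow> 'p \<Rightarrow> bool" where
  "strict_local_min X f p \<longleftrightarrow>
     (\<exists>U. openin X U \<and> p \<in> U \<and> (\<forall>q\<in>U. q \<noteq> p \<longrightarrow> f p < f q))"

definition strict_local_max :: "'p topology \<Rightarrow> ('p \<Rightarrow> real) \<Rightarrow> 'p \<Rightarrow> bool" where
  "strict_local_max X f p \<longleftrightarrow>
     (\<exists>U. openin X U \<and> p \<in> U \<and> (\<forall>q\<in>U. q \<noteq> p \<longrightarrow> f q < f p))"


section \<open>Consistency of the tangent space identifications, tensoriality of \<open>II\<close>\<close>

lemma chart_inj: assumes "is_chart X c" shows "inj_on (coords c) (cdom c)"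
proof -
  have "cdom c \<subseteq> topspace X" using assms openin_subset unfolding is_chart_def by blast
  then show ?thesis using assms homeomorphic_imp_injective_map[of "subtopology X (cdom c)" _ "coords c"]
    unfolding is_chart_def by (auto simp: inf_absorb2)
qed

lemma param_coords: "is_chart X c \<Longrightarrow> p \<in> cdom c \<Longrightarrow> param c (coords c p) = p"
  unfolding param_def using chart_inj by (metis inv_into_f_f)

lemma chart_open_image:
  assumes "is_chart X c" "openin X W" "W \<subseteq> cdom c"
  shows "open (coords c ` W)"
proof -
  have "cdom c \<subseteq> topspace X" using assms openin_subset unfolding is_chart_def by blast
  have o: "open_map (subtopology X (cdom c)) (top_of_set (coords c ` cdom c)) (coords c)"
    using assms homeomorphic_eq_everything_map unfolding is_chart_def by blast
  have "openin (subtopology X (cdom c)) W"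
    using assms by (simp add: is_chart_def openin_open_subtopology)
  then have "openin (top_of_set (coords c ` cdom c)) (coords c ` W)"
    using o unfolding open_map_def by blast
  then show ?thesis using assms(1) unfolding is_chart_def
    using openin_open_trans by blast
qed

lemma smooth_on_differentiable: "smooth_on f U \<Longrightarrow> x \<in> U \<Longrightarrow> f differentiable (at x)"
  unfolding smooth_on_def by (drule spec[of _ "Suc 0"]) simp

lemma smooth_on_frechet: "smooth_on f U \<Longrightarrow> smooth_on (\<lambda>x. frechet_derivative f (at x) v) U"
  unfolding smooth_on_def
proof
  fix k assume "\<forall>k. Ck_on k f U"
  then have "Ck_on (Suc k) f U" by (rule spec)
  then show "Ck_on k (\<lambda>x. frechet_derivative f (at x) v) U" by simp
qed

lemma frechet_cong_open:
  assumes "open U" "x \<in> U" "\<And>y. y \<in> U \<Longrightarrow> f y = g y"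
  shows "frechet_derivative f (at x) = frechet_derivative g (at x)"
proof -
  have "(f has_derivative D) (at x) \<longleftrightarrow> (g has_derivative D) (at x)" for D
    using assms has_derivative_transform_within_open by metis
  then show ?thesis unfolding frechet_derivative_def by presburger
qed

lemma manifold_chartD:
  assumes "smooth_manifold M" "p \<in> points M"
  shows "chart_at M p \<in> atlas M" "is_chart (mtop M) (chart_at M p)" "p \<in> cdom (chart_at M p)"
  using assms unfolding smooth_manifold_def by auto

lemma param_prod_chart:
  assumes "is_chart X c" "is_chart Y d" "y \<in> coords c ` cdom c" "z \<in> coords d ` cdom d"
  shows "param (prod_chart c d) (y, z) = (param c y, param d z)"
proof -
  obtain p q where pq: "p \<in> cdom c" "q \<in> cdom d" "y = coords c p" "z = coords d q"
    using assms by blast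
  have "inj_on (map_prod (coords c) (coords d)) (cdom c \<times> cdom d)"
    using chart_inj[OF assms(1)] chart_inj[OF assms(2)] by (rule map_prod_inj_on)
  then have "param (prod_chart c d) (map_prod (coords c) (coords d) (p, q)) = (p, q)"
    using pq unfolding param_def prod_chart_def by (simp add: inv_into_f_f del: map_prod_simp)
  then show ?thesis using pq assms(1,2) by (simp add: param_coords)
qed

lemma coords_param: "y \<in> coords c ` cdom c \<Longrightarrow> coords c (param c y) = y"
  unfolding param_def by (rule f_inv_into_f)

lemma tmap_fst:
  assumes "smooth_manifold M" "smooth_manifold N" "p \<in> points M" "q \<in> points N"
  shows "tmap (prod_manifold M N) M fst (p, q) = fst"
proof -
  let ?c = "chart_at M p" and ?d = "chart_at N q"
  note c = manifold_chartD[OF assms(1,3)] and d = manifold_chartD[OF assms(2,4)]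
  have "frechet_derivative (coords ?c \<circ> fst \<circ> param (prod_chart ?c ?d)) (at (coords ?c p, coords ?d q))
      = frechet_derivative fst (at (coords ?c p, coords ?d q))"
  proof (rule frechet_cong_open[of "(coords ?c ` cdom ?c) \<times> (coords ?d ` cdom ?d)"])
    show "open ((coords ?c ` cdom ?c) \<times> (coords ?d ` cdom ?d))"
      using c(2) d(2) unfolding is_chart_def by (intro open_Times) auto
  qed (use c d in \<open>auto simp: param_prod_chart param_coords\<close>)
  also have "\<dots> = fst" by (metis bounded_linear_fst bounded_linear_imp_has_derivative frechet_derivative_at)
  finally show ?thesis unfolding tmap_def by (simp add: prod_manifold_def prod_chart_def)
qed

lemma tmap_snd:
  assumes "smooth_manifold M" "smooth_manifold N" "p \<in> points M" "q \<in> points N"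
  shows "tmap (prod_manifold M N) N snd (p, q) = snd"
proof -
  let ?c = "chart_at M p" and ?d = "chart_at N q"
  note c = manifold_chartD[OF assms(1,3)] and d = manifold_chartD[OF assms(2,4)]
  have "frechet_derivative (coords ?d \<circ> snd \<circ> param (prod_chart ?c ?d)) (at (coords ?c p, coords ?d q))
      = frechet_derivative snd (at (coords ?c p, coords ?d q))"
  proof (rule frechet_cong_open[of "(coords ?c ` cdom ?c) \<times> (coords ?d ` cdom ?d)"])
    show "open ((coords ?c ` cdom ?c) \<times> (coords ?d ` cdom ?d))"
      using c(2) d(2) unfolding is_chart_def by (intro open_Times) auto
  qed (use c d in \<open>auto simp: param_prod_chart param_coords\<close>)
  also have "\<dots> = snd" by (metis bounded_linear_snd bounded_linear_imp_has_derivative frechet_derivative_at)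
  finally show ?thesis unfolding tmap_def by (simp add: prod_manifold_def prod_chart_def)
qed

lemma transition_differentiable:
  assumes "smooth_manifold M" "c \<in> atlas M" "d \<in> atlas M" "p \<in> cdom c" "p \<in> cdom d"
  shows "transition c d differentiable (at (coords c p))"
  by (rule smooth_on_differentiable[of _ "coords c ` (cdom c \<inter> cdom d)"])
    (use assms in \<open>simp_all add: smooth_manifold_def\<close>)

lemma components_self:
  assumes "smooth_manifold M" "p \<in> points M" 
  shows "chart_components M (chart_at M p) p = id" "coord_field M (chart_at M p) u p = u"
proof -
  let ?c = "chart_at M p"
  note c = manifold_chartD[OF assms]
  have "frechet_derivative (transition ?c ?c) (at (coords ?c p)) = frechet_derivative id (at (coords ?c p))"
    by (rule frechet_cong_open[of "coords ?c ` cdom ?c"])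
      (use c in \<open>auto simp: transition_def coords_param is_chart_def\<close>)
  then have *: "frechet_derivative (transition ?c ?c) (at (coords ?c p)) = id"
    by (simp add: frechet_derivative_id)
  show "chart_components M (chart_at M p) p = id" "coord_field M (chart_at M p) u p = u"
    unfolding chart_components_def coord_field_def * by simp_all
qed

lemma components_coord_field:
  assumes "smooth_manifold M" "c \<in> atlas M" "p \<in> points M" "p \<in> cdom c"
  shows "chart_components M c p (coord_field M c u p) = u"
proof -
  let ?d = "chart_at M p"
  note d = manifold_chartD[OF assms(1,3)]
  have c: "is_chart (mtop M) c" using assms unfolding smooth_manifold_def by blast
  let ?U = "coords c ` (cdom c \<inter> cdom ?d)"
  have U: "open ?U" by (rule chart_open_image[OF c]) (use c d in \<open>auto simp: is_chart_def\<close>)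
  have tcd: "transition c ?d (coords c p) = coords ?d p"
    using c assms by (simp add: transition_def param_coords)
  have "frechet_derivative (transition ?d c) (at (coords ?d p)) \<circ>
      frechet_derivative (transition c ?d) (at (coords c p)) =
      frechet_derivative (transition ?d c \<circ> transition c ?d) (at (coords c p))"
    by (subst frechet_derivative_compose) (simp_all add: tcd transition_differentiable[OF assms(1)] assms(2,4) d)
  also have "\<dots> = frechet_derivative id (at (coords c p))"
    by (rule frechet_cong_open[OF U]) (use assms d c in \<open>auto simp: transition_def param_coords\<close>)
  finally have "frechet_derivative (transition ?d c) (at (coords ?d p)) \<circ>
     frechet_derivative (transition c ?d) (at (coords c p)) = id"
    by (simp add: frechet_derivative_id)
  then show ?thesis unfolding chart_components_def coord_field_def by (metis comp_apply id_apply)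
qed

lemma components_tmap:
  assumes "smooth_manifold S" "smooth_manifold M" "smooth_map S M f"
    "s \<in> atlas S" "c \<in> atlas M" "q \<in> cdom s" "f q \<in> cdom c"
  shows "chart_components M c (f q) (tmap S M f q v) =
    frechet_derivative (coords c \<circ> f \<circ> param s) (at (coords s q)) (chart_components S s q v)"
proof -
  have s: "is_chart (mtop S) s" and c: "is_chart (mtop M) c"
    using assms unfolding smooth_manifold_def by auto
  have qS: "q \<in> points S" using s assms(6) openin_subset unfolding is_chart_def by blast
  have fq: "f q \<in> points M" using c assms(7) openin_subset unfolding is_chart_def by blast
  let ?s = "chart_at S q" and ?c = "chart_at M (f q)"
  note s' = manifold_chartD[OF assms(1) qS] and c' = manifold_chartD[OF assms(2) fq]
  let ?V = "{r \<in> topspace (mtop S). f r \<in> cdom ?c \<inter> cdom c} \<inter> (cdom ?s \<inter> cdom s)"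
  have fdiff: "coords d \<circ> f \<circ> param a differentiable (at (coords a q))"
    if "a \<in> atlas S" "d \<in> atlas M" "q \<in> cdom a" "f q \<in> cdom d" for a d
    by (rule smooth_on_differentiable[of _ "coords a ` {r \<in> cdom a. f r \<in> cdom d}"])
      (use that assms(3) in \<open>simp_all add: smooth_map_def\<close>)
  have "openin (mtop S) ?V"
    by (intro openin_Int openin_continuous_map_preimage[of _ "mtop M"])
      (use assms s s' c c' in \<open>auto simp: smooth_map_def is_chart_def\<close>)
  then have oV: "open (coords ?s ` ?V)" using chart_open_image[OF s'(2)] by blast
  have mem: "coords ?s q \<in> coords ?s ` ?V" using qS assms s' c' by auto
  have ps: "param ?s (coords ?s q) = q" using s' by (simp add: param_coords)
  have "chart_components M c (f q) (tmap S M f q v) =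
     frechet_derivative (transition ?c c \<circ> (coords ?c \<circ> f \<circ> param ?s)) (at (coords ?s q)) v"
    unfolding chart_components_def tmap_def
    by (subst frechet_derivative_compose)
      (use assms s' c' ps transition_differentiable[OF assms(2) c'(1) assms(5)] fdiff in auto)
  also have "frechet_derivative (transition ?c c \<circ> (coords ?c \<circ> f \<circ> param ?s)) (at (coords ?s q)) =
    frechet_derivative ((coords c \<circ> f \<circ> param s) \<circ> transition ?s s) (at (coords ?s q))"
    by (rule frechet_cong_open[OF oV mem])
      (use s s' c c' in \<open>auto simp: transition_def param_coords\<close>)
  also have "\<dots> v = frechet_derivative (coords c \<circ> f \<circ> param s) (at (coords s q)) (chart_components S s q v)"
    unfolding chart_components_def
    by (subst frechet_derivative_compose)
      (use assms s' c' ps transition_differentiable[OF assms(1) s'(1) assms(4)] fdiff in \<open>auto simp: transition_def\<close>)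
  finally show ?thesis .
qed

lemma second_fundamental_form_eq_at:
  assumes S: "smooth_manifold S" and M: "smooth_manifold M" and \<iota>: "smooth_map S M \<iota>"
    and W: "openin (mtop S) W" "p \<in> W" and Y: "smooth_vector_field_on S W Y"
  shows "second_fundamental_form S M h nabla \<iota> X Y p =
         second_fundamental_form_at S M h nabla \<iota> p (X p) (Y p)"
proof -
  have pS: "p \<in> points S" using W openin_subset by blast
  have ipM: "\<iota> p \<in> points M" using pS \<iota> unfolding smooth_map_def continuous_map_def by auto
  define s c where "s = chart_at S p" and "c = chart_at M (\<iota> p)"
  note s = manifold_chartD[OF S pS, folded s_def] and c = manifold_chartD[OF M ipM, folded c_def]
  define f where "f = coords c \<circ> \<iota> \<circ> param s"
  define O' where "O' = {r \<in> topspace (mtop S). \<iota> r \<in> cdom c} \<inter> (cdom s \<inter> W)"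
  define y0 where "y0 = coords s p"
  have "openin (mtop S) O'" unfolding O'_def
    by (intro openin_Int openin_continuous_map_preimage[of _ "mtop M"])
      (use \<iota> s c W in \<open>auto simp: smooth_map_def is_chart_def\<close>)
  then have oO: "open (coords s ` O')" using chart_open_image[OF s(2)] unfolding O'_def by blast
  have y0: "y0 \<in> coords s ` O'" using pS s c W unfolding O'_def y0_def by auto
  have py0: "param s y0 = p" unfolding y0_def using s by (simp add: param_coords)
  have fs: "smooth_on f (coords s ` {r \<in> cdom s. \<iota> r \<in> cdom c})"
    using \<iota> s c unfolding smooth_map_def f_def by blast
  have fd: "f differentiable (at y)" if "y \<in> coords s ` O'" for y
    by (rule smooth_on_differentiable[OF fs]) (use that in \<open>auto simp: O'_def\<close>)
  have lin: "linear (frechet_derivative f (at y))" if "y \<in> coords s ` O'" for y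
    using fd[OF that] by (rule linear_frechet_derivative)
  have tm: "tmap S M \<iota> p = frechet_derivative f (at y0)"
    unfolding tmap_def f_def y0_def s_def c_def ..
  define b where "b = (\<lambda>y. chart_components S s (param s y) (Y (param s y)))"
  have bs: "smooth_on b (coords s ` (cdom s \<inter> W))"
    using Y s unfolding smooth_vector_field_on_def b_def by blast
  have bd: "b differentiable (at y0)"
    by (rule smooth_on_differentiable[OF bs]) (use y0 in \<open>auto simp: O'_def\<close>)
  have b0: "b y0 = Y p" unfolding b_def py0 using components_self[OF S pS] s_def by simp
  have expand: "frechet_derivative f (at y) w = (\<Sum>i\<in>Basis. (w \<bullet> i) *\<^sub>R frechet_derivative f (at y) i)"
    if "y \<in> coords s ` O'" for y w
  proof -
    have "frechet_derivative f (at y) w = frechet_derivative f (at y) (\<Sum>i\<in>Basis. (w \<bullet> i) *\<^sub>R i)"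
      by (simp add: euclidean_representation)
    also have "\<dots> = (\<Sum>i\<in>Basis. (w \<bullet> i) *\<^sub>R frechet_derivative f (at y) i)"
      by (simp only: linear_sum[OF lin[OF that]] linear_cmul[OF lin[OF that]])
    finally show ?thesis .
  qed
  have rep: "((\<lambda>q. chart_components M c (\<iota> q) (tmap S M \<iota> q (Z q))) \<circ> param s) y =
      (\<Sum>i\<in>Basis. (chart_components S s (param s y) (Z (param s y)) \<bullet> i) *\<^sub>R frechet_derivative f (at y) i)"
    if y: "y \<in> coords s ` O'" for y Z
  proof -
    obtain q where q: "q \<in> O'" "y = coords s q" using y by blast
    have "param s y = q" using q s unfolding O'_def by (simp add: param_coords)
    moreover have "chart_components M c (\<iota> q) (tmap S M \<iota> q (Z q)) =
        frechet_derivative f (at y) (chart_components S s q (Z q))"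
      unfolding f_def q(2) by (rule components_tmap[OF S M \<iota> s(1) c(1)]) (use q in \<open>auto simp: O'_def\<close>)
    ultimately show ?thesis
      by (simp only: comp_apply expand[OF y, of "chart_components S s q (Z q)"])
  qed
  define D where "D i = frechet_derivative (\<lambda>y. frechet_derivative f (at y) i) (at y0)" for i
  have Dd: "((\<lambda>y. frechet_derivative f (at y) i) has_derivative D i) (at y0)" for i
    unfolding D_def frechet_derivative_works[symmetric]
    by (rule smooth_on_differentiable[OF smooth_on_frechet[OF fs]]) (use y0 in \<open>auto simp: O'_def\<close>)
  define B where "B = frechet_derivative b (at y0)"
  have Bd: "(b has_derivative B) (at y0)" using bd unfolding B_def frechet_derivative_works .
  have dY: "vderiv S (\<lambda>q. chart_components M c (\<iota> q) (tmap S M \<iota> q (Y q))) p v =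
     (\<Sum>i\<in>Basis. (Y p \<bullet> i) *\<^sub>R D i v) + tmap S M \<iota> p (B v)" for v
  proof -
    have "((\<lambda>y. \<Sum>i\<in>Basis. (b y \<bullet> i) *\<^sub>R frechet_derivative f (at y) i) has_derivative
       (\<lambda>v. \<Sum>i\<in>Basis. (b y0 \<bullet> i) *\<^sub>R D i v + (B v \<bullet> i) *\<^sub>R frechet_derivative f (at y0) i)) (at y0)"
      by (intro has_derivative_sum has_derivative_scaleR Dd has_derivative_inner_left Bd)
    then have "frechet_derivative (\<lambda>y. \<Sum>i\<in>Basis. (b y \<bullet> i) *\<^sub>R frechet_derivative f (at y) i) (at y0) =
       (\<lambda>v. \<Sum>i\<in>Basis. (b y0 \<bullet> i) *\<^sub>R D i v + (B v \<bullet> i) *\<^sub>R frechet_derivative f (at y0) i)"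
      by (rule frechet_derivative_at[symmetric])
    moreover have "frechet_derivative ((\<lambda>q. chart_components M c (\<iota> q) (tmap S M \<iota> q (Y q))) \<circ> param s) (at y0)
      = frechet_derivative (\<lambda>y. \<Sum>i\<in>Basis. (b y \<bullet> i) *\<^sub>R frechet_derivative f (at y) i) (at y0)"
      by (rule frechet_cong_open[OF oO y0]) (simp only: rep b_def)
    ultimately show ?thesis
      by (simp only: vderiv_def tm expand[OF y0, of "B v"] s_def[symmetric] y0_def[symmetric] b0
          sum.distrib)
  qed
  have dw: "vderiv S (\<lambda>q. chart_components M c (\<iota> q) (tmap S M \<iota> q (coord_field S s w q))) p v =
     (\<Sum>i\<in>Basis. (w \<bullet> i) *\<^sub>R D i v)" for v w
  proof -
    have "((\<lambda>y. \<Sum>i\<in>Basis. (w \<bullet> i) *\<^sub>R frechet_derivative f (at y) i) has_derivative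
       (\<lambda>v. \<Sum>i\<in>Basis. (w \<bullet> i) *\<^sub>R D i v)) (at y0)"
      by (intro has_derivative_sum has_derivative_scaleR_right Dd)
    then have "frechet_derivative (\<lambda>y. \<Sum>i\<in>Basis. (w \<bullet> i) *\<^sub>R frechet_derivative f (at y) i) (at y0) =
       (\<lambda>v. \<Sum>i\<in>Basis. (w \<bullet> i) *\<^sub>R D i v)"
      by (rule frechet_derivative_at[symmetric])
    moreover have "frechet_derivative ((\<lambda>q. chart_components M c (\<iota> q) (tmap S M \<iota> q (coord_field S s w q))) \<circ> param s) (at y0)
      = frechet_derivative (\<lambda>y. \<Sum>i\<in>Basis. (w \<bullet> i) *\<^sub>R frechet_derivative f (at y) i) (at y0)"
    proof (rule frechet_cong_open[OF oO y0])
      fix y assume y: "y \<in> coords s ` O'"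
      then obtain q where q: "q \<in> O'" "y = coords s q" by blast
      have "param s y = q" using q s unfolding O'_def by (simp add: param_coords)
      moreover have "chart_components S s q (coord_field S s w q) = w"
        by (rule components_coord_field[OF S s(1)]) (use q in \<open>auto simp: O'_def\<close>)
      ultimately show "((\<lambda>q. chart_components M c (\<iota> q) (tmap S M \<iota> q (coord_field S s w q))) \<circ> param s) y =
          (\<Sum>i\<in>Basis. (w \<bullet> i) *\<^sub>R frechet_derivative f (at y) i)"
        by (simp only: rep[OF y, of "coord_field S s w"])
    qed
    ultimately show ?thesis
      by (simp only: vderiv_def s_def[symmetric] y0_def[symmetric])
  qed
  have cf: "coord_field S s u p = u" for u using components_self[OF S pS] s_def by simp
  have cov: "cov_deriv_along S M nabla \<iota> p v (\<lambda>q. tmap S M \<iota> q (Y q)) =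
    cov_deriv_along S M nabla \<iota> p v (\<lambda>q. tmap S M \<iota> q (coord_field S s (Y p) q)) + tmap S M \<iota> p (B v)" for v
    unfolding cov_deriv_along_def c_def[symmetric] Let_def dY dw cf by (simp add: add_ac)
  have np: "normal_part S M h \<iota> p (z + tmap S M \<iota> p w) = normal_part S M h \<iota> p z" for z w
  proof -
    have "subspace (range (tmap S M \<iota> p))"
      unfolding tm by (intro linear_subspace_image lin[OF y0]) simp
    then have "z + tmap S M \<iota> p w - r \<in> range (tmap S M \<iota> p) \<longleftrightarrow> z - r \<in> range (tmap S M \<iota> p)" for r
      using subspace_add[of _ "z - r" "tmap S M \<iota> p w"]
        subspace_diff[of _ "z + tmap S M \<iota> p w - r" "tmap S M \<iota> p w"]
      by (auto simp: algebra_simps)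
    then show ?thesis unfolding normal_part_def by simp
  qed
  show ?thesis
    unfolding second_fundamental_form_at_def second_fundamental_form_def s_def[symmetric] cf cov np ..
qed

end

theory Submission
  imports Defs
begin

text \<open>
  On \<open>\<Sigma>\<close> the gradient of \<open>\<tau>\<close> is \<open>-\<beta>\<^sup>-\<^sup>1 \<partial>\<^sub>t\<^sup>\<top>\<close>, where \<open>\<partial>\<^sub>t\<^sup>\<top>\<close> is the tangential part of \<open>\<partial>\<^sub>t\<close>.
  The divergence along \<open>\<Sigma>\<close> of \<open>\<partial>\<^sub>t\<close> itself is half the trace of the Lie derivative of the metric
  along \<open>\<partial>\<^sub>t\<close>, and the normal part of \<open>\<partial>\<^sub>t\<close> contributes its product with the mean curvature
  vector. With the sign convention for \<open>H\<close> in force this gives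
  \<open>div (\<beta> grad \<tau>) = g(\<partial>\<^sub>t, H) - (tr \<xi>) / 2 + (\<partial>\<^sub>t \<beta>) |d\<tau>|\<^sup>2 / 2\<close>.
  Under the first set of hypotheses the right-hand side is nonpositive, so \<open>\<tau>\<close> is a supersolution
  of a linear elliptic equation without term of order zero, and the weak maximum principle
  excludes a strict local minimum. The second set makes \<open>-\<tau>\<close> such a supersolution.

  The identity is derived at a point \<open>q\<close> in a chart of \<open>\<Sigma>\<close> that need not be the preferred chart
  at \<open>q\<close> (lemma \<open>laplacian_of_height\<close>). Only then do the left-hand sides for all \<open>q\<close> near a given
  point become one differential inequality on an open set of the model space. In such a chart
  the second order part of \<open>div (\<beta> grad \<tau>)\<close> is \<open>\<beta> \<Sum>\<^sub>i D\<^sup>2\<tau>(e\<^sub>i, e\<^sub>i)\<close> for an orthonormal frame \<open>e\<close>,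
  and the first order part involves the derivatives of the metric coefficients, that is, the
  Christoffel symbols of \<open>\<Sigma>\<close>. Two applications of Koszul's formula produce it:
  in the spacetime with the field \<open>\<partial>\<^sub>t\<close> (lemma \<open>dt_component_cov_coord\<close>), and along the
  immersion to express tangential components by the induced metric (lemma \<open>koszul_along\<close>).
  The latter rests on the symmetry of second derivatives.

  The maximum principle (lemma \<open>no_strict_local_min_of_elliptic_inequality\<close>) asks only that the
  first order terms be bounded by \<open>C \<Sum>\<^sub>j |d\<tau>(e\<^sub>j)| |e\<^sub>j|\<close>. Such a \<open>C\<close> exists near every point since
  the metric coefficients are smooth, and since orthonormal vectors have bounded coordinates
  (lemma \<open>laplacian_first_order_bound\<close>).
\<close>

section \<open>Calculus of smooth functions\<close>

lemma Ck_on_cong: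
  assumes "open S" "\<And>x. x \<in> S \<Longrightarrow> f x = g x"
  shows "Ck_on k f S \<longleftrightarrow> Ck_on k g S"
  using assms(2)
proof (induction k arbitrary: f g)
  case 0
  then show ?case by (simp cong: continuous_on_cong)
next
  case (Suc k)
  have "frechet_derivative f (at x) = frechet_derivative g (at x)" if "x \<in> S" for x
    by (rule frechet_cong_open[OF assms(1) that Suc.prems])
  then have "Ck_on k (\<lambda>x. frechet_derivative f (at x) v) S \<longleftrightarrow> Ck_on k (\<lambda>x. frechet_derivative g (at x) v) S" for v
    by (intro Suc.IH) simp
  moreover have "f differentiable (at x) \<longleftrightarrow> g differentiable (at x)" if "x \<in> S" for x
    unfolding differentiable_def
    using has_derivative_transform_within_open[OF _ assms(1) that] Suc.prems by metis
  ultimately show ?case by simp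
qed

lemma Ck_on_mono: "Ck_on k f S \<Longrightarrow> T \<subseteq> S \<Longrightarrow> Ck_on k f T"
  by (induction k arbitrary: f) (auto intro: continuous_on_subset)

lemma Ck_on_Suc_imp: "Ck_on (Suc k) f S \<Longrightarrow> Ck_on k f S"
proof (induction k arbitrary: f)
  case 0
  then show ?case
    by (auto intro!: continuous_at_imp_continuous_on differentiable_imp_continuous_within)
next
  case (Suc k)
  then show ?case by (metis Ck_on.simps(2))
qed

lemma Ck_on_const: "Ck_on k (\<lambda>x. c) S"
  by (induction k arbitrary: c) simp_all

lemma Ck_on_bounded_linear:
  assumes L: "bounded_linear L" and "open S" and f: "Ck_on k f S"
  shows "Ck_on k (\<lambda>x. L (f x)) S"
  using f
proof (induction k arbitrary: f)
  case 0
  then show ?case by (simp add: continuous_on_compose2 linear_continuous_on[OF L] bounded_linear.continuous_on[OF L])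
next
  case (Suc k)
  have D: "((\<lambda>x. L (f x)) has_derivative (\<lambda>v. L (frechet_derivative f (at x) v))) (at x)" if "x \<in> S" for x
    by (rule bounded_linear.has_derivative[OF L]) (use Suc.prems that in \<open>simp add: frechet_derivative_works\<close>)
  have "frechet_derivative (\<lambda>x. L (f x)) (at x) v = L (frechet_derivative f (at x) v)" if "x \<in> S" for x v
    using frechet_derivative_at[OF D[OF that]] by metis
  then have "Ck_on k (\<lambda>x. frechet_derivative (\<lambda>x. L (f x)) (at x) v) S \<longleftrightarrow>
     Ck_on k (\<lambda>x. L (frechet_derivative f (at x) v)) S" for v
    by (intro Ck_on_cong assms) simp
  then show ?case using Suc D by (auto simp: differentiable_def)
qed

lemma Ck_on_add:
  assumes S: "open S" and "Ck_on k f S" "Ck_on k g S"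
  shows "Ck_on k (\<lambda>x. f x + g x) S"
  using assms(2,3)
proof (induction k arbitrary: f g)
  case 0
  then show ?case by (simp add: continuous_on_add)
next
  case (Suc k)
  have D: "((\<lambda>x. f x + g x) has_derivative
      (\<lambda>v. frechet_derivative f (at x) v + frechet_derivative g (at x) v)) (at x)" if "x \<in> S" for x
    by (rule has_derivative_add) (use Suc.prems that in \<open>simp_all add: frechet_derivative_works\<close>)
  have "frechet_derivative (\<lambda>x. f x + g x) (at x) v =
     frechet_derivative f (at x) v + frechet_derivative g (at x) v" if "x \<in> S" for x v
    using frechet_derivative_at[OF D[OF that]] by metis
  then have "Ck_on k (\<lambda>x. frechet_derivative (\<lambda>x. f x + g x) (at x) v) S \<longleftrightarrow>
     Ck_on k (\<lambda>x. frechet_derivative f (at x) v + frechet_derivative g (at x) v) S" for v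
    by (intro Ck_on_cong S) simp
  then show ?case using Suc by (simp add: differentiableI[OF D])
qed

lemma Ck_on_scaleR:
  assumes S: "open S" and "Ck_on k f S" "Ck_on k g S"
  shows "Ck_on k (\<lambda>x. f x *\<^sub>R g x) S"
  using assms(2,3)
proof (induction k arbitrary: f g)
  case 0
  then show ?case by (simp add: continuous_on_scaleR)
next
  case (Suc k)
  have D: "((\<lambda>x. f x *\<^sub>R g x) has_derivative
      (\<lambda>v. f x *\<^sub>R frechet_derivative g (at x) v + frechet_derivative f (at x) v *\<^sub>R g x)) (at x)" if "x \<in> S" for x
    by (rule has_derivative_scaleR) (use Suc.prems that in \<open>simp_all add: frechet_derivative_works\<close>)
  have "frechet_derivative (\<lambda>x. f x *\<^sub>R g x) (at x) v =
     f x *\<^sub>R frechet_derivative g (at x) v + frechet_derivative f (at x) v *\<^sub>R g x" if "x \<in> S" for x v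
    using frechet_derivative_at[OF D[OF that]] by metis
  then have "Ck_on k (\<lambda>x. frechet_derivative (\<lambda>x. f x *\<^sub>R g x) (at x) v) S \<longleftrightarrow>
     Ck_on k (\<lambda>x. f x *\<^sub>R frechet_derivative g (at x) v + frechet_derivative f (at x) v *\<^sub>R g x) S" for v
    by (intro Ck_on_cong S) simp
  moreover have "Ck_on k f S" "Ck_on k g S" using Suc.prems Ck_on_Suc_imp by blast+
  ultimately show ?case using Suc by (simp add: differentiableI[OF D] Ck_on_add[OF S])
qed

lemma Ck_on_sum:
  assumes S: "open S" and "\<And>i. i \<in> A \<Longrightarrow> Ck_on k (f i) S"
  shows "Ck_on k (\<lambda>x. \<Sum>i\<in>A. f i x) S"
  using assms(2) by (induction A rule: infinite_finite_induct) (auto intro: Ck_on_const Ck_on_add S)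

text \<open>The chain rule makes \<open>D(g \<circ> f) v\<close> a sum of products of components of \<open>Df v\<close> with partial
  derivatives of \<open>g\<close> composed with \<open>f\<close>, so that both factors lose one order of differentiability
  at a time. The sum over a basis is why the middle space has to be finite-dimensional.\<close>

lemma Ck_on_compose:
  fixes f :: "'a::real_normed_vector \<Rightarrow> 'b::euclidean_space"
  assumes S: "open S" and T: "open T" and "f ` S \<subseteq> T" and "Ck_on k f S" "Ck_on k g T"
  shows "Ck_on k (g \<circ> f) S"
  using assms(4,5)
proof (induction k arbitrary: g)
  case 0
  then show ?case using assms(3) continuous_on_compose[of S f g] continuous_on_subset[of T g "f ` S"] by simp
next
  case (Suc k)
  let ?D = "\<lambda>x v. \<Sum>b\<in>Basis. (frechet_derivative f (at x) v \<bullet> b) *\<^sub>R frechet_derivative g (at (f x)) b"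
  have df: "f differentiable at x" and dg: "g differentiable at (f x)" if "x \<in> S" for x
    using Suc.prems that assms(3) by auto
  have "frechet_derivative (g \<circ> f) (at x) v = ?D x v" if "x \<in> S" for x v
  proof -
    have lin: "linear (frechet_derivative g (at (f x)))"
      using dg[OF that] by (rule linear_frechet_derivative)
    have "frechet_derivative (g \<circ> f) (at x) v = frechet_derivative g (at (f x)) (frechet_derivative f (at x) v)"
      using frechet_derivative_compose[OF df dg] that by simp
    also have "\<dots> = frechet_derivative g (at (f x)) (\<Sum>b\<in>Basis. (frechet_derivative f (at x) v \<bullet> b) *\<^sub>R b)"
      by (simp add: euclidean_representation)
    also have "\<dots> = ?D x v" by (simp only: linear_sum[OF lin] linear_cmul[OF lin])
    finally show ?thesis .
  qed
  then have "Ck_on k (\<lambda>x. frechet_derivative (g \<circ> f) (at x) v) S \<longleftrightarrow> Ck_on k (\<lambda>x. ?D x v) S" for v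
    by (intro Ck_on_cong S) simp
  moreover have "Ck_on k (\<lambda>x. ?D x v) S" for v
  proof (intro Ck_on_sum Ck_on_scaleR S)
    show "Ck_on k (\<lambda>x. frechet_derivative f (at x) v \<bullet> b) S" for b
      using Suc.prems by (intro Ck_on_bounded_linear[OF bounded_linear_inner_left S]) simp
    show "Ck_on k (\<lambda>x. frechet_derivative g (at (f x)) b) S" for b
      using Suc.IH[of "\<lambda>y. frechet_derivative g (at y) b"] Suc.prems(2) Ck_on_Suc_imp[OF Suc.prems(1)]
      by (simp add: o_def)
  qed
  ultimately show ?case using differentiable_chain_at[OF df dg] by (simp del: comp_apply add: o_def[symmetric])
qed

lemma smooth_on_compose:
  fixes f :: "'a::real_normed_vector \<Rightarrow> 'b::euclidean_space"
  assumes "open S" "open T" "f ` S \<subseteq> T" "smooth_on f S" "smooth_on g T"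
  shows "smooth_on (g \<circ> f) S"
  using assms Ck_on_compose unfolding smooth_on_def by blast

lemma smooth_on_cong:
  assumes "open S" "\<And>x. x \<in> S \<Longrightarrow> f x = g x"
  shows "smooth_on f S \<longleftrightarrow> smooth_on g S"
  using Ck_on_cong[OF assms(1), of f g] assms(2) unfolding smooth_on_def by simp

lemma smooth_on_subset: "smooth_on f S \<Longrightarrow> T \<subseteq> S \<Longrightarrow> smooth_on f T"
  using Ck_on_mono unfolding smooth_on_def by blast

lemma smooth_on_linear:
  assumes L: "bounded_linear L" and S: "open S"
  shows "smooth_on L S"
  unfolding smooth_on_def
proof
  fix k
  have "Ck_on k (\<lambda>x::'a. x) S" by (cases k) (simp_all add: Ck_on_const)
  then show "Ck_on k L S" using Ck_on_bounded_linear[OF L S] by blast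
qed

text \<open>The two components are composed with the projections, embedded in the product as
  \<open>(x, 0)\<close> and \<open>(0, y)\<close>, and added.\<close>

lemma smooth_on_map_prod:
  fixes f :: "'a::euclidean_space \<Rightarrow> 'c::euclidean_space" and g :: "'b::euclidean_space \<Rightarrow> 'd::euclidean_space"
  assumes "open U" "open V" "smooth_on f U" "smooth_on g V"
  shows "smooth_on (map_prod f g) (U \<times> V)"
proof -
  have o: "open (U \<times> V)" using assms by (simp add: open_Times)
  have "fst ` (U \<times> V) \<subseteq> U" "snd ` (U \<times> V) \<subseteq> V" by auto
  then have "smooth_on (f \<circ> fst) (U \<times> V)" "smooth_on (g \<circ> snd) (U \<times> V)"
    using smooth_on_compose[OF o assms(1) _ smooth_on_linear[OF bounded_linear_fst o] assms(3)]
      smooth_on_compose[OF o assms(2) _ smooth_on_linear[OF bounded_linear_snd o] assms(4)] by blast+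
  then have fg: "Ck_on k (f \<circ> fst) (U \<times> V)" "Ck_on k (g \<circ> snd) (U \<times> V)" for k
    unfolding smooth_on_def by blast+
  have "bounded_linear (\<lambda>x::'c. (x, 0::'d))" "bounded_linear (\<lambda>x::'d. (0::'c, x))"
    by (rule bounded_linear_Pair bounded_linear_ident bounded_linear_zero)+
  then have "Ck_on k (\<lambda>z. ((f \<circ> fst) z, 0::'d)) (U \<times> V)" "Ck_on k (\<lambda>z. (0::'c, (g \<circ> snd) z)) (U \<times> V)" for k
    using Ck_on_bounded_linear[OF _ o fg(1)] Ck_on_bounded_linear[OF _ o fg(2)] by blast+
  from Ck_on_add[OF o this] show ?thesis
    unfolding smooth_on_def by (simp add: map_prod_def case_prod_unfold)
qed

section \<open>Product manifolds\<close>

lemma second_countable_prod_topology: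
  assumes "second_countable X" "second_countable Y"
  shows "second_countable (prod_topology X Y)"
proof -
  obtain A where A: "countable A" "\<forall>V\<in>A. openin X V"
     "\<And>U x. openin X U \<Longrightarrow> x \<in> U \<Longrightarrow> \<exists>V\<in>A. x \<in> V \<and> V \<subseteq> U"
    using assms(1) unfolding second_countable_def by metis
  obtain B where B: "countable B" "\<forall>V\<in>B. openin Y V"
     "\<And>U x. openin Y U \<Longrightarrow> x \<in> U \<Longrightarrow> \<exists>V\<in>B. x \<in> V \<and> V \<subseteq> U"
    using assms(2) unfolding second_countable_def by metis
  show ?thesis unfolding second_countable_def
  proof (intro exI[of _ "(\<lambda>(V,W). V \<times> W) ` (A \<times> B)"] conjI ballI allI impI)
    show "countable ((\<lambda>(V,W). V \<times> W) ` (A \<times> B))" using A B by simp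
    show "openin (prod_topology X Y) V" if "V \<in> (\<lambda>(V,W). V \<times> W) ` (A \<times> B)" for V
      using that A(2) B(2) by (auto simp: openin_prod_Times_iff)
    fix U z assume "openin (prod_topology X Y) U \<and> z \<in> U"
    then obtain V W where VW: "openin X V" "openin Y W" "fst z \<in> V" "snd z \<in> W" "V \<times> W \<subseteq> U"
      unfolding openin_prod_topology_alt by (metis prod.collapse)
    obtain V' W' where "V' \<in> A" "fst z \<in> V'" "V' \<subseteq> V" "W' \<in> B" "snd z \<in> W'" "W' \<subseteq> W"
      using A(3)[OF VW(1,3)] B(3)[OF VW(2,4)] by auto
    then show "\<exists>V\<in>(\<lambda>(V,W). V \<times> W) ` (A \<times> B). z \<in> V \<and> V \<subseteq> U"
      using VW(5) by (intro bexI[of _ "V' \<times> W'"]) (auto simp: mem_Times_iff)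
  qed
qed

lemma is_chart_prod:
  assumes c: "is_chart X c" and d: "is_chart Y d"
  shows "is_chart (prod_topology X Y) (prod_chart c d)"
proof -
  have im: "map_prod (coords c) (coords d) ` (cdom c \<times> cdom d) = coords c ` cdom c \<times> coords d ` cdom d"
    by (rule map_prod_surj_on) simp_all
  obtain c' d' where "homeomorphic_maps (subtopology X (cdom c)) (top_of_set (coords c ` cdom c)) (coords c) c'"
    "homeomorphic_maps (subtopology Y (cdom d)) (top_of_set (coords d ` cdom d)) (coords d) d'"
    using assms unfolding is_chart_def homeomorphic_map_maps by blast
  then have "homeomorphic_maps (prod_topology (subtopology X (cdom c)) (subtopology Y (cdom d)))
      (prod_topology (top_of_set (coords c ` cdom c)) (top_of_set (coords d ` cdom d)))
      (\<lambda>(x, y). (coords c x, coords d y)) (\<lambda>(x, y). (c' x, d' y))"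
    unfolding homeomorphic_maps_prod by blast
  then have "homeomorphic_map (subtopology (prod_topology X Y) (cdom c \<times> cdom d))
      (top_of_set (coords c ` cdom c \<times> coords d ` cdom d)) (map_prod (coords c) (coords d))"
    unfolding homeomorphic_map_maps map_prod_def by (auto simp: subtopology_Times)
  then show ?thesis
    using assms unfolding is_chart_def prod_chart_def
    by (simp add: im open_Times openin_prod_Times_iff)
qed

lemma transition_prod_chart:
  assumes c: "is_chart X c" and d: "is_chart Y d"
    and "y \<in> coords c ` cdom c" "z \<in> coords d ` cdom d"
  shows "transition (prod_chart c d) (prod_chart c' d') (y, z) = map_prod (transition c c') (transition d d') (y, z)"
  unfolding transition_def using param_prod_chart[OF assms] by (simp add: prod_chart_def)

lemma smooth_manifold_prod:
  fixes M :: "('p, 'e::euclidean_space) manifold" and N :: "('q, 'f::euclidean_space) manifold"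
  assumes M: "smooth_manifold M" and N: "smooth_manifold N"
  shows "smooth_manifold (prod_manifold M N)"
  unfolding smooth_manifold_def
proof (intro conjI ballI)
  let ?P = "prod_manifold M N"
  show "Hausdorff_space (mtop ?P)" "second_countable (mtop ?P)"
    using M N by (simp_all add: prod_manifold_def smooth_manifold_def Hausdorff_space_prod_topology
        second_countable_prod_topology)
  fix r assume "r \<in> points ?P"
  then have "fst r \<in> points M" "snd r \<in> points N" by (auto simp: prod_manifold_def)
  note * = manifold_chartD[OF M this(1)] manifold_chartD[OF N this(2)]
  have eq: "chart_at ?P r = prod_chart (chart_at M (fst r)) (chart_at N (snd r))"
    by (simp add: prod_manifold_def case_prod_unfold)
  have "prod_chart c d \<in> atlas ?P" if "c \<in> atlas M" "d \<in> atlas N" for c d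
    using that by (simp add: prod_manifold_def del: split_paired_Ex) blast
  then show "chart_at ?P r \<in> atlas ?P" unfolding eq using * by blast
  show "r \<in> cdom (chart_at ?P r)"
    unfolding eq using * by (simp add: prod_chart_def mem_Times_iff)
next
  let ?P = "prod_manifold M N"
  fix c assume "c \<in> atlas ?P"
  then obtain c1 c2 where c: "c = prod_chart c1 c2" "c1 \<in> atlas M" "c2 \<in> atlas N"
    by (auto simp: prod_manifold_def)
  then have ch: "is_chart (mtop M) c1" "is_chart (mtop N) c2"
    using M N unfolding smooth_manifold_def by auto
  then show "is_chart (mtop ?P) c"
    unfolding c by (simp add: prod_manifold_def is_chart_prod)
  fix d assume "d \<in> atlas ?P"
  then obtain d1 d2 where d: "d = prod_chart d1 d2" "d1 \<in> atlas M" "d2 \<in> atlas N"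
    by (auto simp: prod_manifold_def)
  then have dh: "is_chart (mtop M) d1" "is_chart (mtop N) d2"
    using M N unfolding smooth_manifold_def by auto
  let ?U = "coords c1 ` (cdom c1 \<inter> cdom d1)" and ?V = "coords c2 ` (cdom c2 \<inter> cdom d2)"
  have im: "coords c ` (cdom c \<inter> cdom d) = ?U \<times> ?V"
    unfolding c d prod_chart_def by (simp add: Times_Int_Times map_prod_surj_on)
  have o: "open ?U" "open ?V"
    using ch dh by (auto intro!: chart_open_image simp: is_chart_def)
  have s: "smooth_on (transition c1 d1) ?U" "smooth_on (transition c2 d2) ?V"
    using M N c d unfolding smooth_manifold_def by auto
  have "smooth_on (map_prod (transition c1 d1) (transition c2 d2)) (?U \<times> ?V)"
    by (rule smooth_on_map_prod[OF o s])
  moreover have "transition c d z = map_prod (transition c1 d1) (transition c2 d2) z" if "z \<in> ?U \<times> ?V" for z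
    using transition_prod_chart[OF ch, of "fst z" "snd z" d1 d2] that unfolding c d by (auto simp: mem_Times_iff)
  ultimately show "smooth_on (transition c d) (coords c ` (cdom c \<inter> cdom d))"
    unfolding im by (subst smooth_on_cong) (auto intro: open_Times o)
qed

lemma smooth_manifold_interval:
  assumes "open I"
  shows "smooth_manifold (interval_manifold I)"
proof -
  have "second_countable (euclidean :: real topology)"
  proof -
    obtain B :: "real set set" where "countable B" "\<And>C. C \<in> B \<Longrightarrow> open C"
      "\<And>S. open S \<Longrightarrow> \<exists>U. U \<subseteq> B \<and> S = \<Union>U"
      using univ_second_countable by blast
    then show ?thesis unfolding second_countable_def
      by (intro exI[of _ B]) (simp, metis Union_iff Union_upper subsetD)
  qed
  moreover have "param (I, \<lambda>t. t) x = x" if "x \<in> I" for x :: real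
    using that unfolding param_def by (simp add: inv_into_f_eq)
  then have "smooth_on (transition (I, \<lambda>t. t) (I, \<lambda>t. t)) I"
    by (subst smooth_on_cong[of _ _ "\<lambda>x. x"])
      (use assms in \<open>auto simp: transition_def intro: smooth_on_linear bounded_linear_ident\<close>)
  ultimately show ?thesis
    using assms homeomorphic_map_id[of "top_of_set I" "top_of_set I"] unfolding smooth_manifold_def interval_manifold_def is_chart_def
    by (auto simp: Hausdorff_space_subtopology second_countable_subtopology id_def subtopology_subtopology)
qed

lemma smooth_manifold_spacetime:
  assumes "orthogonally_splitted I F \<beta> g"
  shows "smooth_manifold (spacetime I F)"
  using assms unfolding orthogonally_splitted_def
  by (intro smooth_manifold_prod smooth_manifold_interval) auto

section \<open>Coordinate vector fields\<close>

lemma chart_of_atlas: "smooth_manifold M \<Longrightarrow> c \<in> atlas M \<Longrightarrow> is_chart (mtop M) c"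
  unfolding smooth_manifold_def by blast

lemma cdom_subset_points: "smooth_manifold M \<Longrightarrow> c \<in> atlas M \<Longrightarrow> cdom c \<subseteq> points M"
  using chart_of_atlas openin_subset unfolding is_chart_def by blast

lemma chart_overlap_open:
  assumes "smooth_manifold M" "c \<in> atlas M" "openin (mtop M) W"
  shows "open (coords c ` (cdom c \<inter> W))"
  using chart_open_image[OF chart_of_atlas[OF assms(1,2)], of "cdom c \<inter> W"] assms chart_of_atlas
  unfolding is_chart_def by blast

lemma linear_coord_field:
  assumes "smooth_manifold M" "c \<in> atlas M" "p \<in> cdom c"
  shows "linear (\<lambda>u. coord_field M c u p)"
  unfolding coord_field_def
  using linear_frechet_derivative[OF transition_differentiable[OF assms(1,2) _ assms(3)]]
    manifold_chartD[OF assms(1)] cdom_subset_points[OF assms(1,2)] assms(3) by (simp add: subsetD)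

text \<open>Both sides differentiate the transition map from \<open>c\<close> to \<open>d\<close>; the left-hand side factors it through
  the preferred chart at \<open>p\<close>.\<close>

lemma coord_field_change_chart:
  assumes M: "smooth_manifold M" "c \<in> atlas M" "d \<in> atlas M" "p \<in> cdom c" "p \<in> cdom d"
  shows "chart_components M d p (coord_field M c u p) = frechet_derivative (transition c d) (at (coords c p)) u"
proof -
  have pM: "p \<in> points M" using cdom_subset_points[OF M(1,2)] M(4) by blast
  let ?e = "chart_at M p"
  note e = manifold_chartD[OF M(1) pM]
  note ch = chart_of_atlas[OF M(1,2)]
  have t: "transition c ?e (coords c p) = coords ?e p"
    using ch M by (simp add: transition_def param_coords)
  have o: "open (coords c ` (cdom c \<inter> (cdom ?e \<inter> cdom d)))"
    by (rule chart_overlap_open[OF M(1,2)]) (use e chart_of_atlas[OF M(1,3)] in \<open>auto simp: is_chart_def\<close>)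
  have "frechet_derivative (transition ?e d) (at (coords ?e p)) \<circ> frechet_derivative (transition c ?e) (at (coords c p))
     = frechet_derivative (transition ?e d \<circ> transition c ?e) (at (coords c p))"
    by (subst frechet_derivative_compose) (simp_all add: t transition_differentiable[OF M(1)] M e)
  also have "\<dots> = frechet_derivative (transition c d) (at (coords c p))"
    by (rule frechet_cong_open[OF o]) (use M e ch in \<open>auto simp: transition_def param_coords\<close>)
  finally show ?thesis unfolding chart_components_def coord_field_def by (metis comp_apply)
qed

text \<open>The reverse composition is the identity by \<open>components_coord_field\<close>, and an injective linear
  endomorphism of a finite-dimensional space is bijective.\<close>

lemma coord_field_components:
  assumes M: "smooth_manifold M" "c \<in> atlas M" "p \<in> cdom c"
  shows "coord_field M c (chart_components M c p v) p = v"
proof -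
  have pM: "p \<in> points M" using cdom_subset_points[OF M(1,2)] M(3) by blast
  have inj: "inj (\<lambda>u. coord_field M c u p)"
    by (rule inj_on_inverseI[of _ "chart_components M c p"])
      (simp add: components_coord_field[OF M(1,2) pM M(3)])
  then have "surj (\<lambda>u. coord_field M c u p)"
    using linear_injective_imp_surjective[OF linear_coord_field[OF M]] by blast
  then obtain u where "v = coord_field M c u p" by blast
  then show ?thesis using components_coord_field[OF M(1,2) pM M(3)] by simp
qed

text \<open>In another chart \<open>d\<close> the components at \<open>y\<close> are a derivative of the transition from \<open>c\<close> to \<open>d\<close>,
  evaluated at the \<open>c\<close>-coordinates of the point: a composition of smooth maps. Coordinate fields
  are the vector fields to which the axioms of the Levi-Civita connection are applied below.\<close>

lemma smooth_coord_field:
  assumes M: "smooth_manifold M" and c: "c \<in> atlas M"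
  shows "smooth_vector_field_on M (cdom c) (coord_field M c u)"
  unfolding smooth_vector_field_on_def
proof
  fix d assume d: "d \<in> atlas M"
  note chc = chart_of_atlas[OF M c] and chd = chart_of_atlas[OF M d]
  let ?U = "coords d ` (cdom d \<inter> cdom c)" and ?V = "coords c ` (cdom c \<inter> cdom d)"
  let ?D = "\<lambda>x. frechet_derivative (transition c d) (at x) u"
  have o: "open ?U" "open ?V"
    using chc chd by (auto intro!: chart_overlap_open[OF M] c d simp: is_chart_def)
  have "smooth_on (?D \<circ> transition d c) ?U"
  proof (rule smooth_on_compose[OF o])
    show "transition d c ` ?U \<subseteq> ?V" using chd by (auto simp: transition_def param_coords)
    show "smooth_on (transition d c) ?U" "smooth_on ?D ?V"
      using M c d by (auto simp: smooth_manifold_def intro: smooth_on_frechet)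
  qed
  moreover have "(?D \<circ> transition d c) y = chart_components M d (param d y) (coord_field M c u (param d y))"
    if y: "y \<in> ?U" for y
    using that chd by (auto simp: param_coords transition_def coord_field_change_chart[OF M c d])
  ultimately show "smooth_on (\<lambda>y. chart_components M d (param d y) (coord_field M c u (param d y))) ?U"
    using smooth_on_cong[OF o(1)] by (smt (verit))
qed

text \<open>Derivatives of functions can be taken in any chart, while \<open>vderiv\<close> itself refers to the preferred
  chart, which varies from point to point.\<close>

lemma vderiv_coord_field:
  assumes M: "smooth_manifold M" "s \<in> atlas M" "q \<in> cdom s"
    and F: "(F \<circ> param s) differentiable (at (coords s q))"
  shows "vderiv M F q (coord_field M s u q) = frechet_derivative (F \<circ> param s) (at (coords s q)) u"
proof -
  have image_point: "q \<in> points M" using cdom_subset_points[OF M(1,2)] M(3) by blast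
  let ?e = "chart_at M q"
  note e = manifold_chartD[OF M(1) image_point]
  have t: "transition ?e s (coords ?e q) = coords s q"
    using e M by (simp add: transition_def param_coords)
  have o: "open (coords ?e ` (cdom ?e \<inter> cdom s))"
    by (rule chart_overlap_open[OF M(1) e(1)]) (use chart_of_atlas[OF M(1,2)] in \<open>auto simp: is_chart_def\<close>)
  have "frechet_derivative (F \<circ> param ?e) (at (coords ?e q)) =
      frechet_derivative ((F \<circ> param s) \<circ> transition ?e s) (at (coords ?e q))"
    by (rule frechet_cong_open[OF o])
      (use M e chart_of_atlas[OF M(1,2)] in \<open>auto simp: transition_def param_coords\<close>)
  also have "\<dots> = frechet_derivative (F \<circ> param s) (at (coords s q)) \<circ> chart_components M s q"
    unfolding chart_components_def
    by (subst frechet_derivative_compose) (simp_all add: t F transition_differentiable[OF M(1)] M e)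
  finally show ?thesis
    unfolding vderiv_def by (simp add: components_coord_field[OF M(1,2) image_point M(3)])
qed

lemma lie_bracket_coord_fields:
  assumes M: "smooth_manifold M" and p: "p \<in> points M"
  shows "lie_bracket M (coord_field M (chart_at M p) u) (coord_field M (chart_at M p) w) p = 0"
proof -
  let ?c = "chart_at M p"
  note c = manifold_chartD[OF M p]
  have o: "open (coords ?c ` cdom ?c)" using c unfolding is_chart_def by blast
  have "frechet_derivative ((\<lambda>q. chart_components M ?c q (coord_field M ?c u q)) \<circ> param ?c) (at (coords ?c p)) =
    frechet_derivative (\<lambda>_. u) (at (coords ?c p))" for u
    by (rule frechet_cong_open[OF o])
      (use c cdom_subset_points[OF M c(1)] in \<open>auto simp: param_coords components_coord_field[OF M c(1)] subsetD\<close>)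
  then show ?thesis unfolding lie_bracket_def Let_def vderiv_def by simp
qed

lemma coord_field_prod:
  assumes M: "smooth_manifold M" "c \<in> atlas M" "p \<in> cdom c" and N: "smooth_manifold N" "d \<in> atlas N" "q \<in> cdom d"
  shows "coord_field (prod_manifold M N) (prod_chart c d) u (p, q) = (coord_field M c (fst u) p, coord_field N d (snd u) q)"
proof -
  let ?c = "chart_at M p" and ?d = "chart_at N q"
  have pq: "p \<in> points M" "q \<in> points N"
    using cdom_subset_points[OF M(1,2)] cdom_subset_points[OF N(1,2)] M N by blast+
  note e = manifold_chartD[OF M(1) pq(1)] manifold_chartD[OF N(1) pq(2)]
  note ch = chart_of_atlas[OF M(1,2)] chart_of_atlas[OF N(1,2)]
  have o: "open (coords c ` cdom c \<times> coords d ` cdom d)" using ch by (simp add: is_chart_def open_Times)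
  have "frechet_derivative (transition (prod_chart c d) (prod_chart ?c ?d)) (at (coords c p, coords d q)) =
    frechet_derivative (\<lambda>z. (transition c ?c (fst z), transition d ?d (snd z))) (at (coords c p, coords d q))"
    by (rule frechet_cong_open[OF o])
      (use M N transition_prod_chart[OF ch, of _ _ ?c ?d] in \<open>auto simp del: map_prod_simp simp: map_prod_def\<close>)
  also have "\<dots> = (\<lambda>u. (frechet_derivative (transition c ?c) (at (coords c p)) (fst u),
       frechet_derivative (transition d ?d) (at (coords d q)) (snd u)))"
  proof (rule frechet_derivative_at[symmetric], rule has_derivative_Pair)
    have 1: "(transition c ?c has_derivative frechet_derivative (transition c ?c) (at (coords c p))) (at (coords c p))"
      using transition_differentiable[OF M(1,2) e(1) M(3) e(3)] frechet_derivative_works by blast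
    show "((\<lambda>z. transition c ?c (fst z)) has_derivative
      (\<lambda>u. frechet_derivative (transition c ?c) (at (coords c p)) (fst u))) (at (coords c p, coords d q))"
      using has_derivative_compose[OF has_derivative_fst[OF has_derivative_ident]] 1 by (metis fst_conv)
    have 2: "(transition d ?d has_derivative frechet_derivative (transition d ?d) (at (coords d q))) (at (coords d q))"
      using transition_differentiable[OF N(1,2) e(4) N(3) e(6)] frechet_derivative_works by blast
    show "((\<lambda>z. transition d ?d (snd z)) has_derivative
      (\<lambda>u. frechet_derivative (transition d ?d) (at (coords d q)) (snd u))) (at (coords c p, coords d q))"
      using has_derivative_compose[OF has_derivative_snd[OF has_derivative_ident]] 2 by (metis snd_conv)
  qed
  finally show ?thesis
    unfolding coord_field_def by (simp add: prod_manifold_def prod_chart_def)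
qed

lemma coord_field_interval:
  assumes "open I" "t \<in> I"
  shows "coord_field (interval_manifold I) (I, \<lambda>t. t) u t = u"
  using components_self(2)[OF smooth_manifold_interval[OF assms(1)], of t u] assms(2)
  by (simp add: interval_manifold_def)

section \<open>Second derivatives and a maximum principle\<close>

lemma has_real_derivative_along_line:
  fixes f :: "'a::real_normed_vector \<Rightarrow> real"
  assumes "f differentiable (at (x + t *\<^sub>R v))"
  shows "((\<lambda>t. f (x + t *\<^sub>R v)) has_real_derivative frechet_derivative f (at (x + t *\<^sub>R v)) v) (at t)"
proof -
  have "((\<lambda>t. x + t *\<^sub>R v) has_derivative (\<lambda>h. h *\<^sub>R v)) (at t)"
    by (auto intro!: derivative_eq_intros)
  from has_derivative_compose[OF this assms[unfolded frechet_derivative_works]]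
  have "((\<lambda>t. f (x + t *\<^sub>R v)) has_derivative (\<lambda>h. frechet_derivative f (at (x + t *\<^sub>R v)) (h *\<^sub>R v))) (at t)" .
  moreover have "frechet_derivative f (at (x + t *\<^sub>R v)) (h *\<^sub>R v) = frechet_derivative f (at (x + t *\<^sub>R v)) v * h" for h
    using linear_cmul[OF linear_frechet_derivative[OF assms]] by simp
  ultimately show ?thesis unfolding has_field_derivative_def by simp
qed

text \<open>The mean value theorem in direction \<open>u\<close> for the difference in direction \<open>w\<close>, and then in direction
  \<open>w\<close> for the derivative in direction \<open>u\<close>.\<close>

lemma second_difference:
  fixes f :: "'a::real_normed_vector \<Rightarrow> real"
  assumes t: "t > 0" and B: "\<And>a b. 0 \<le> a \<Longrightarrow> a \<le> t \<Longrightarrow> 0 \<le> b \<Longrightarrow> b \<le> t \<Longrightarrow> x + a *\<^sub>R u + b *\<^sub>R w \<in> B"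
    and f: "\<And>z. z \<in> B \<Longrightarrow> f differentiable (at z)"
    and f2: "\<And>z. z \<in> B \<Longrightarrow> (\<lambda>z. frechet_derivative f (at z) u) differentiable (at z)"
  shows "\<exists>z\<in>B. f (x + t *\<^sub>R u + t *\<^sub>R w) - f (x + t *\<^sub>R u) - f (x + t *\<^sub>R w) + f x =
     t * t * frechet_derivative (\<lambda>z. frechet_derivative f (at z) u) (at z) w"
proof -
  let ?D = "\<lambda>z. frechet_derivative f (at z) u"
  have "\<exists>a. 0 < a \<and> a < t \<and>
     (f ((x + t *\<^sub>R w) + t *\<^sub>R u) - f (x + t *\<^sub>R u)) - (f ((x + t *\<^sub>R w) + 0 *\<^sub>R u) - f (x + 0 *\<^sub>R u)) =
     (t - 0) * (?D ((x + t *\<^sub>R w) + a *\<^sub>R u) - ?D (x + a *\<^sub>R u))"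
  proof (rule MVT2[OF t])
    fix a assume a: "0 \<le> a" "a \<le> t"
    have "x + t *\<^sub>R w + a *\<^sub>R u \<in> B" "x + a *\<^sub>R u \<in> B"
      using B[OF a, of t] B[OF a, of 0] t by (simp_all add: algebra_simps)
    then show "((\<lambda>a. f ((x + t *\<^sub>R w) + a *\<^sub>R u) - f (x + a *\<^sub>R u)) has_real_derivative
        ?D ((x + t *\<^sub>R w) + a *\<^sub>R u) - ?D (x + a *\<^sub>R u)) (at a)"
      by (intro DERIV_diff has_real_derivative_along_line f)
  qed
  then obtain a where a: "0 < a" "a < t"
    "f (x + t *\<^sub>R u + t *\<^sub>R w) - f (x + t *\<^sub>R u) - f (x + t *\<^sub>R w) + f x =
     t * (?D ((x + a *\<^sub>R u) + t *\<^sub>R w) - ?D (x + a *\<^sub>R u))" by (auto simp: algebra_simps)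
  have "\<exists>b. 0 < b \<and> b < t \<and> ?D ((x + a *\<^sub>R u) + t *\<^sub>R w) - ?D ((x + a *\<^sub>R u) + 0 *\<^sub>R w) =
     (t - 0) * frechet_derivative ?D (at ((x + a *\<^sub>R u) + b *\<^sub>R w)) w"
    by (rule MVT2[OF t]) (use a B in \<open>auto intro!: has_real_derivative_along_line f2\<close>)
  then obtain b where "0 < b" "b < t" "?D ((x + a *\<^sub>R u) + t *\<^sub>R w) - ?D (x + a *\<^sub>R u) =
     t * frechet_derivative ?D (at ((x + a *\<^sub>R u) + b *\<^sub>R w)) w" by auto
  then show ?thesis using a B[of a b] by (intro bexI[of _ "x + a *\<^sub>R u + b *\<^sub>R w"]) simp_all
qed

text \<open>The second difference is symmetric in \<open>u\<close> and \<open>w\<close>, and \<open>second_difference\<close> represents it by either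
  of the mixed derivatives at points close to \<open>x\<close>. If one mixed derivative were smaller at \<open>x\<close>, a
  constant \<open>m\<close> would separate the two on a neighbourhood.\<close>

lemma symmetric_second_derivative_real:
  fixes f :: "'a::real_normed_vector \<Rightarrow> real"
  assumes U: "open U" "x \<in> U" and f: "smooth_on f U"
  shows "frechet_derivative (\<lambda>z. frechet_derivative f (at z) u) (at x) w =
         frechet_derivative (\<lambda>z. frechet_derivative f (at z) w) (at x) u"
proof -
  define D where "D u w z = frechet_derivative (\<lambda>z. frechet_derivative f (at z) u) (at z) w" for u w z
  have fd: "f differentiable (at z)" if "z \<in> U" for z
    using smooth_on_differentiable[OF f that] .
  have f2: "(\<lambda>z. frechet_derivative f (at z) u) differentiable (at z)" if "z \<in> U" for z u
    using smooth_on_differentiable[OF smooth_on_frechet[OF f] that] .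
  have cont: "continuous_on U (D u w)" for u w
  proof -
    have "smooth_on (D u w) U" unfolding D_def by (intro smooth_on_frechet f)
    then show ?thesis unfolding smooth_on_def by (metis Ck_on.simps(1))
  qed
  have "\<not> D u w x < D w u x" for u w
  proof
    assume less: "D u w x < D w u x"
    define m where "m = (D u w x + D w u x) / 2"
    have m: "D u w x < m" "m < D w u x" using less unfolding m_def by auto
    let ?B = "U \<inter> (D u w -` {..<m} \<inter> D w u -` {m<..})"
    have "open (U \<inter> D u w -` {..<m})" "open (U \<inter> D w u -` {m<..})"
      by (auto intro!: continuous_open_preimage cont U)
    from open_Int[OF this]
    have "open ((U \<inter> D u w -` {..<m}) \<inter> (U \<inter> D w u -` {m<..}))" .
    moreover have "(U \<inter> D u w -` {..<m}) \<inter> (U \<inter> D w u -` {m<..}) = ?B" by blast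
    ultimately have "open ?B" by simp
    moreover have "x \<in> ?B" using U m by auto
    ultimately obtain r where r: "r > 0" "ball x r \<subseteq> ?B" using open_contains_ball by blast
    \<comment> \<open>the parallelogram spanned by \<open>t u\<close> and \<open>t w\<close> stays in the ball\<close>
    define t where "t = r / (2 * (norm u + norm w + 1))"
    have den: "norm u + norm w + 1 > 0" by (simp add: add_nonneg_pos)
    have t: "t > 0" using r den unfolding t_def by simp
    have mem: "x + a *\<^sub>R u + b *\<^sub>R w \<in> ?B" if "0 \<le> a" "a \<le> t" "0 \<le> b" "b \<le> t" for a b
    proof -
      have "norm (a *\<^sub>R u + b *\<^sub>R w) \<le> a * norm u + b * norm w"
        using norm_triangle_ineq[of "a *\<^sub>R u" "b *\<^sub>R w"] that by simp
      also have "\<dots> \<le> t * norm u + t * norm w"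
        using that by (intro add_mono mult_right_mono) auto
      also have "\<dots> < t * (2 * (norm u + norm w + 1))"
        using t den by (simp add: algebra_simps add_strict_increasing)
      also have "\<dots> = r" using den unfolding t_def by simp
      finally have "x + (a *\<^sub>R u + b *\<^sub>R w) \<in> ball x r"
        by (simp only: mem_ball dist_norm norm_minus_commute[of x]) simp
      then show ?thesis using r(2) by (auto simp: add.assoc)
    qed
    obtain z where z: "z \<in> ?B" "f (x + t *\<^sub>R u + t *\<^sub>R w) - f (x + t *\<^sub>R u) - f (x + t *\<^sub>R w) + f x = t * t * D u w z"
      using second_difference[OF t mem, of f] fd f2 unfolding D_def by blast
    have mem': "x + a *\<^sub>R w + b *\<^sub>R u \<in> ?B" if "0 \<le> a" "a \<le> t" "0 \<le> b" "b \<le> t" for a b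
      using mem[of b a] that by (simp add: ac_simps)
    obtain z' where z': "z' \<in> ?B" "f (x + t *\<^sub>R w + t *\<^sub>R u) - f (x + t *\<^sub>R w) - f (x + t *\<^sub>R u) + f x = t * t * D w u z'"
      using second_difference[OF t mem', of f] fd f2 unfolding D_def by blast
    have "t * t * D u w z = t * t * D w u z'"
      using z(2) z'(2) by (simp only: add.assoc add.commute[of "t *\<^sub>R w" "t *\<^sub>R u"])
    then have "D u w z = D w u z'" using t by simp
    then show False using z(1) z'(1) by auto
  qed
  from this[of u w] this[of w u] show ?thesis unfolding D_def by auto
qed

lemma symmetric_second_derivative:
  fixes f :: "'a::real_normed_vector \<Rightarrow> 'b::euclidean_space"
  assumes U: "open U" "x \<in> U" and f: "smooth_on f U"
  shows "frechet_derivative (\<lambda>z. frechet_derivative f (at z) u) (at x) w =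
         frechet_derivative (\<lambda>z. frechet_derivative f (at z) w) (at x) u"
proof (rule euclidean_eqI)
  fix b :: 'b
  have inner: "frechet_derivative (\<lambda>z. h z \<bullet> b) (at z) v = frechet_derivative h (at z) v \<bullet> b"
    if "h differentiable (at z)" for h :: "'a \<Rightarrow> 'b" and z v
    using frechet_derivative_at[OF has_derivative_inner_left[OF that[unfolded frechet_derivative_works]]]
    by metis
  have *: "frechet_derivative (\<lambda>z. frechet_derivative f (at z) u) (at x) w \<bullet> b =
    frechet_derivative (\<lambda>z. frechet_derivative (\<lambda>z. f z \<bullet> b) (at z) u) (at x) w" for u w
  proof -
    have "frechet_derivative (\<lambda>z. frechet_derivative (\<lambda>z. f z \<bullet> b) (at z) u) (at x) =
       frechet_derivative (\<lambda>z. frechet_derivative f (at z) u \<bullet> b) (at x)"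
      by (rule frechet_cong_open[OF U]) (simp add: inner smooth_on_differentiable[OF f])
    then show ?thesis
      by (simp add: inner smooth_on_differentiable[OF smooth_on_frechet[OF f] U(2)])
  qed
  have "smooth_on (\<lambda>z. f z \<bullet> b) U"
    using f Ck_on_bounded_linear[OF bounded_linear_inner_left U(1)] unfolding smooth_on_def by blast
  then show "frechet_derivative (\<lambda>z. frechet_derivative f (at z) u) (at x) w \<bullet> b =
    frechet_derivative (\<lambda>z. frechet_derivative f (at z) w) (at x) u \<bullet> b"
    unfolding * by (rule symmetric_second_derivative_real[OF U])
qed

text \<open>If the second derivative in direction \<open>v\<close> were negative, the first derivative would be negative
  just after \<open>y\<close> on the line in direction \<open>v\<close>, and \<open>f\<close> would decrease there.\<close>

lemma second_derivative_test:
  fixes f :: "'a::real_normed_vector \<Rightarrow> real"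
  assumes B: "open B" "y \<in> B" and min: "\<And>z. z \<in> B \<Longrightarrow> f y \<le> f z"
    and f: "\<And>z. z \<in> B \<Longrightarrow> f differentiable (at z)"
    and f2: "(\<lambda>z. frechet_derivative f (at z) v) differentiable (at y)"
  shows "frechet_derivative f (at y) v = 0"
    and "frechet_derivative (\<lambda>z. frechet_derivative f (at z) v) (at y) v \<ge> 0"
proof -
  have "frechet_derivative f (at y) = (\<lambda>v. 0)"
    using differential_zero_maxmin[OF B(2,1)] f[OF B(2)] min by (metis frechet_derivative_works)
  then show 0: "frechet_derivative f (at y) v = 0" for v by simp
  show "frechet_derivative (\<lambda>z. frechet_derivative f (at z) v) (at y) v \<ge> 0" (is "?L \<ge> 0")
  proof (rule ccontr)
    assume neg: "\<not> ?L \<ge> 0"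
    let ?p' = "\<lambda>t. frechet_derivative f (at (y + t *\<^sub>R v)) v"
    have "(?p' has_real_derivative ?L) (at 0)"
      using has_real_derivative_along_line[of "\<lambda>z. frechet_derivative f (at z) v" y 0 v] f2 by simp
    then obtain d where d: "d > 0" "\<And>h. 0 < h \<Longrightarrow> h < d \<Longrightarrow> ?p' h < 0"
      using DERIV_neg_dec_right[of ?p' ?L 0] neg 0 by auto
    have "open ((\<lambda>t. y + t *\<^sub>R v) -` B)"
      by (intro open_vimage B continuous_intros)
    moreover have "0 \<in> (\<lambda>t. y + t *\<^sub>R v) -` B" using B by simp
    ultimately obtain \<delta> where "\<delta> > 0" "ball 0 \<delta> \<subseteq> (\<lambda>t. y + t *\<^sub>R v) -` B"
      using open_contains_ball by blast
    then have \<delta>: "\<delta> > 0" "\<And>t. \<bar>t\<bar> < \<delta> \<Longrightarrow> y + t *\<^sub>R v \<in> B"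
      by (auto simp: subset_iff dist_real_def)
    define t where "t = min d \<delta> / 2"
    have t: "0 < t" "t < d" "t < \<delta>" using d(1) \<delta>(1) unfolding t_def by auto
    have "\<exists>z. 0 < z \<and> z < t \<and> f (y + t *\<^sub>R v) - f (y + 0 *\<^sub>R v) = (t - 0) * ?p' z"
      by (rule MVT2[OF t(1)]) (use \<delta> t in \<open>auto intro!: has_real_derivative_along_line f\<close>)
    then obtain z where z: "0 < z" "z < t" "f (y + t *\<^sub>R v) - f y = t * ?p' z" by auto
    have "t * ?p' z < 0" using d(2)[of z] z t by (simp add: mult_pos_neg)
    moreover have "f y \<le> f (y + t *\<^sub>R v)" using min \<delta>(2)[of t] t by simp
    ultimately show False using z(3) by simp
  qed
qed

text \<open>Weak maximum principle. On a ball of radius \<open>r\<close> around a strict minimum \<open>y0\<close>, the function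
  \<open>T - \<epsilon> |y - y0|\<^sup>2\<close> with small \<open>\<epsilon>\<close> is still larger on the boundary than at \<open>y0\<close>, so it has an interior
  minimum \<open>y\<close>. There \<open>DT v = 2 \<epsilon> (y - y0) \<bullet> v\<close> and \<open>D\<^sup>2T(v, v) \<ge> 2 \<epsilon> |v|\<^sup>2\<close>, so the inequality gives
  \<open>2 \<epsilon> \<Sum> |e\<^sub>i|\<^sup>2 \<le> C * 2 \<epsilon> r \<Sum> |e\<^sub>i|\<^sup>2\<close>, which fails once \<open>C r < 1\<close>. The weights \<open>|e\<^sub>i|\<close> on the
  first order terms make both sides scale alike in \<open>e\<close>.\<close>

lemma no_strict_local_min_of_elliptic_inequality:
  fixes T :: "'a::euclidean_space \<Rightarrow> real"
  assumes U: "open U" "y0 \<in> U" and min: "\<And>y. y \<in> U \<Longrightarrow> y \<noteq> y0 \<Longrightarrow> T y0 < T y"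
    and T: "\<And>y. y \<in> U \<Longrightarrow> T differentiable (at y)"
    and T2: "\<And>y v. y \<in> U \<Longrightarrow> (\<lambda>z. frechet_derivative T (at z) v) differentiable (at y)"
    and J: "finite J"
    and ineq: "\<And>y. y \<in> U \<Longrightarrow> \<exists>e. (\<exists>i\<in>J. e i \<noteq> 0) \<and>
       (\<Sum>i\<in>J. frechet_derivative (\<lambda>z. frechet_derivative T (at z) (e i)) (at y) (e i)) \<le>
       C * (\<Sum>i\<in>J. \<bar>frechet_derivative T (at y) (e i)\<bar> * norm (e i))"
  shows False
proof -
  obtain r1 where r1: "r1 > 0" "cball y0 r1 \<subseteq> U" using U open_contains_cball by blast
  \<comment> \<open>small enough for \<open>|C| r < 1\<close>\<close>
  define r where "r = min r1 (1 / (\<bar>C\<bar> + 1))"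
  have r: "r > 0" "cball y0 r \<subseteq> U" "r * (\<bar>C\<bar> + 1) \<le> 1"
  proof -
    show "r > 0" "cball y0 r \<subseteq> U" using r1 unfolding r_def by auto
    have "r * (\<bar>C\<bar> + 1) \<le> 1 / (\<bar>C\<bar> + 1) * (\<bar>C\<bar> + 1)" unfolding r_def by (intro mult_right_mono) auto
    also have "\<dots> = 1" by (simp add: add_nonneg_pos less_imp_neq[symmetric])
    finally show "r * (\<bar>C\<bar> + 1) \<le> 1" .
  qed
  have "continuous_on U T"
    using T by (intro continuous_at_imp_continuous_on ballI differentiable_imp_continuous_within) auto
  then have cT: "continuous_on (cball y0 r) T" using r(2) continuous_on_subset by blast
  have "sphere y0 r \<noteq> {}" using r(1) by simp
  then obtain z where z: "z \<in> sphere y0 r" "\<And>y. y \<in> sphere y0 r \<Longrightarrow> T z \<le> T y"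
    using continuous_attains_inf[OF compact_sphere, of y0 r T] continuous_on_subset[OF cT sphere_cball] by blast
  have zU: "z \<in> U" "z \<noteq> y0" using z(1) r by (auto simp: subset_iff)
  \<comment> \<open>half of the gap between the minimum on the sphere and \<open>T y0\<close>, relative to \<open>r\<^sup>2\<close>\<close>
  define \<epsilon> where "\<epsilon> = (T z - T y0) / (2 * r\<^sup>2)"
  have \<epsilon>: "\<epsilon> > 0" "\<epsilon> * r\<^sup>2 < T z - T y0"
    using min[OF zU] r(1) unfolding \<epsilon>_def by (simp_all add: field_simps)
  define \<psi> where "\<psi> y = T y - \<epsilon> * ((y - y0) \<bullet> (y - y0))" for y
  have "continuous_on (cball y0 r) \<psi>" unfolding \<psi>_def by (intro continuous_intros cT)
  then obtain y where y: "y \<in> cball y0 r" "\<And>x. x \<in> cball y0 r \<Longrightarrow> \<psi> y \<le> \<psi> x"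
    using continuous_attains_inf[OF compact_cball, of y0 r \<psi>] r(1) by auto
  have "y \<notin> sphere y0 r"
  proof
    assume s: "y \<in> sphere y0 r"
    have "(y - y0) \<bullet> (y - y0) = r\<^sup>2"
      using s by (simp add: dot_square_norm dist_norm norm_minus_commute)
    then have "\<psi> y > \<psi> y0" using z(2)[OF s] \<epsilon> unfolding \<psi>_def by simp
    moreover have "\<psi> y \<le> \<psi> y0" using y(2) r(1) by simp
    ultimately show False by simp
  qed
  then have yb: "y \<in> ball y0 r" using y(1) by auto
  have yU: "y \<in> U" using y(1) r(2) by blast
  have bU: "ball y0 r \<subseteq> U" using r(2) ball_subset_cball by blast
  have d\<psi>: "(\<psi> has_derivative (\<lambda>v. frechet_derivative T (at x) v - \<epsilon> * (2 * ((x - y0) \<bullet> v)))) (at x)" if "x \<in> U" for x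
    unfolding \<psi>_def
    by (rule has_derivative_eq_rhs, (rule derivative_intros T[OF that, unfolded frechet_derivative_works])+)
      (simp add: inner_commute)
  have e\<psi>: "frechet_derivative \<psi> (at x) v = frechet_derivative T (at x) v - \<epsilon> * (2 * ((x - y0) \<bullet> v))" if "x \<in> U" for x v
    using frechet_derivative_at[OF d\<psi>[OF that]] by metis
  have d2: "((\<lambda>x. frechet_derivative T (at x) v - \<epsilon> * (2 * ((x - y0) \<bullet> v))) has_derivative
     (\<lambda>w. frechet_derivative (\<lambda>z. frechet_derivative T (at z) v) (at y) w - \<epsilon> * (2 * (w \<bullet> v)))) (at y)" for v
    by (rule has_derivative_eq_rhs, (rule derivative_intros T2[OF yU, unfolded frechet_derivative_works])+) simp
  have d2\<psi>: "((\<lambda>x. frechet_derivative \<psi> (at x) v) has_derivative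
     (\<lambda>w. frechet_derivative (\<lambda>z. frechet_derivative T (at z) v) (at y) w - \<epsilon> * (2 * (w \<bullet> v)))) (at y)" for v
    by (rule has_derivative_transform_within_open[OF d2 U(1) yU]) (simp add: e\<psi>)
  have min\<psi>: "\<And>z. z \<in> ball y0 r \<Longrightarrow> \<psi> y \<le> \<psi> z" using y(2) by auto
  have diff\<psi>: "\<And>z. z \<in> ball y0 r \<Longrightarrow> \<psi> differentiable (at z)" using d\<psi> bU differentiableI by blast
  note test = second_derivative_test[OF open_ball yb min\<psi> diff\<psi> differentiableI[OF d2\<psi>]]
  have first: "frechet_derivative T (at y) v = \<epsilon> * (2 * ((y - y0) \<bullet> v))" for v
    using test(1)[of v] e\<psi>[OF yU] by simp
  have second: "frechet_derivative (\<lambda>z. frechet_derivative T (at z) v) (at y) v \<ge> \<epsilon> * (2 * (v \<bullet> v))" for v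
    using test(2)[of v] unfolding frechet_derivative_at[OF d2\<psi>, symmetric] by simp
  obtain e where e: "\<exists>i\<in>J. e i \<noteq> 0" "(\<Sum>i\<in>J. frechet_derivative (\<lambda>z. frechet_derivative T (at z) (e i)) (at y) (e i)) \<le>
       C * (\<Sum>i\<in>J. \<bar>frechet_derivative T (at y) (e i)\<bar> * norm (e i))"
    using ineq[OF yU] by blast
  let ?N = "\<Sum>i\<in>J. (norm (e i))\<^sup>2"
  have N: "?N > 0" using e(1) J by (auto intro!: sum_pos2)
  have "2 * \<epsilon> * ?N = (\<Sum>i\<in>J. \<epsilon> * (2 * (e i \<bullet> e i)))"
    by (simp add: sum_distrib_left dot_square_norm mult_ac)
  also have "\<dots> \<le> C * (\<Sum>i\<in>J. \<bar>frechet_derivative T (at y) (e i)\<bar> * norm (e i))"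
    using sum_mono[of J, OF second] e(2) by (rule order_trans)
  also have "\<dots> \<le> \<bar>C\<bar> * (\<Sum>i\<in>J. 2 * \<epsilon> * r * (norm (e i))\<^sup>2)"
  proof (rule mult_mono[OF abs_ge_self])
    show "(\<Sum>i\<in>J. \<bar>frechet_derivative T (at y) (e i)\<bar> * norm (e i)) \<le> (\<Sum>i\<in>J. 2 * \<epsilon> * r * (norm (e i))\<^sup>2)"
    proof (rule sum_mono)
      fix i
      have "\<bar>(y - y0) \<bullet> e i\<bar> \<le> norm (y - y0) * norm (e i)" by (rule Cauchy_Schwarz_ineq2)
      also have "\<dots> \<le> r * norm (e i)"
        using yb by (intro mult_right_mono) (auto simp: dist_norm norm_minus_commute)
      finally have "\<bar>frechet_derivative T (at y) (e i)\<bar> \<le> 2 * \<epsilon> * (r * norm (e i))"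
        unfolding first using \<epsilon>(1) by (simp add: abs_mult)
      from mult_right_mono[OF this, of "norm (e i)"]
      show "\<bar>frechet_derivative T (at y) (e i)\<bar> * norm (e i) \<le> 2 * \<epsilon> * r * (norm (e i))\<^sup>2"
        by (simp add: power2_eq_square mult_ac)
    qed
  qed (auto intro!: sum_nonneg)
  also have "\<dots> = (2 * \<epsilon> * ?N) * (r * \<bar>C\<bar>)" by (simp add: sum_distrib_left mult_ac)
  finally have "(2 * \<epsilon> * ?N) * 1 \<le> (2 * \<epsilon> * ?N) * (r * \<bar>C\<bar>)" by simp
  moreover have "2 * \<epsilon> * ?N > 0" using \<epsilon>(1) N by simp
  ultimately have "1 \<le> r * \<bar>C\<bar>" by (simp only: mult_le_cancel_left_pos)
  moreover have "r * (\<bar>C\<bar> + 1) = r * \<bar>C\<bar> + r" by (simp add: algebra_simps)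
  ultimately show False using r(1,3) by simp
qed

section \<open>Bilinear forms: orthonormal frames, derivatives and local bounds\<close>

lemma bilinear_expand:
  fixes h :: "'a::euclidean_space \<Rightarrow> 'a \<Rightarrow> real"
  assumes "bilinear h"
  shows "h a b = (\<Sum>i\<in>Basis. \<Sum>j\<in>Basis. (a \<bullet> i) * (b \<bullet> j) * h i j)"
proof -
  have "h a b = h (\<Sum>i\<in>Basis. (a \<bullet> i) *\<^sub>R i) (\<Sum>j\<in>Basis. (b \<bullet> j) *\<^sub>R j)"
    by (simp add: euclidean_representation)
  also have "\<dots> = (\<Sum>(i, j)\<in>Basis \<times> Basis. h ((a \<bullet> i) *\<^sub>R i) ((b \<bullet> j) *\<^sub>R j))"
    by (rule bilinear_sum[OF assms])
  finally show ?thesis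
    by (simp add: sum.cartesian_product bilinear_lmul[OF assms] bilinear_rmul[OF assms] mult_ac case_prod_unfold)
qed

lemma frechet_derivative_bilinear_field:
  fixes H :: "'d::real_normed_vector \<Rightarrow> 'a::euclidean_space \<Rightarrow> 'a \<Rightarrow> real"
  assumes U: "open U" "x \<in> U" and bil: "\<And>x. x \<in> U \<Longrightarrow> bilinear (H x)"
    and H: "\<And>a b. (\<lambda>x. H x a b) differentiable (at x)"
  shows "frechet_derivative (\<lambda>x. H x a b) (at x) v =
    (\<Sum>i\<in>Basis. \<Sum>j\<in>Basis. (a \<bullet> i) * (b \<bullet> j) * frechet_derivative (\<lambda>x. H x i j) (at x) v)"
proof -
  have "frechet_derivative (\<lambda>x. H x a b) (at x) =
      frechet_derivative (\<lambda>x. \<Sum>i\<in>Basis. \<Sum>j\<in>Basis. (a \<bullet> i) * (b \<bullet> j) * H x i j) (at x)"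
    by (rule frechet_cong_open[OF U]) (rule bilinear_expand[OF bil])
  also have "\<dots> = (\<lambda>v. \<Sum>i\<in>Basis. \<Sum>j\<in>Basis. (a \<bullet> i) * (b \<bullet> j) * frechet_derivative (\<lambda>x. H x i j) (at x) v)"
    by (rule frechet_derivative_at[symmetric])
      (intro has_derivative_sum has_derivative_mult_right H[unfolded frechet_derivative_works])
  finally show ?thesis by simp
qed

text \<open>Product rule for a bilinear form that depends on a point \<open>f y\<close> and is applied to vectors that depend
  on \<open>y\<close>. The derivative of the form itself is taken with the arguments frozen at \<open>A y\<close> and \<open>B y\<close>.\<close>

lemma has_derivative_bilinear_field:
  fixes H :: "'d::real_normed_vector \<Rightarrow> 'a::euclidean_space \<Rightarrow> 'a \<Rightarrow> real"
    and f :: "'e::real_normed_vector \<Rightarrow> 'd"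
  assumes U: "open U" "f y \<in> U" and bil: "\<And>x. x \<in> U \<Longrightarrow> bilinear (H x)"
    and H: "\<And>a b. (\<lambda>x. H x a b) differentiable (at (f y))"
    and f: "(f has_derivative f') (at y)" and A: "(A has_derivative A') (at y)" and B: "(B has_derivative B') (at y)"
  shows "((\<lambda>y. H (f y) (A y) (B y)) has_derivative
    (\<lambda>u. frechet_derivative (\<lambda>x. H x (A y) (B y)) (at (f y)) (f' u) + H (f y) (A' u) (B y) + H (f y) (A y) (B' u))) (at y)"
proof -
  let ?D = "\<lambda>i j. frechet_derivative (\<lambda>x. H x i j) (at (f y))"
  have D: "((\<lambda>x. H x i j) has_derivative ?D i j) (at (f y))" for i j
    using H frechet_derivative_works by blast
  have Dexp: "?D a b = (\<lambda>v. \<Sum>i\<in>Basis. \<Sum>j\<in>Basis. (a \<bullet> i) * (b \<bullet> j) * ?D i j v)" for a b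
    by (rule ext) (rule frechet_derivative_bilinear_field[OF U bil H])
  have DH: "((\<lambda>y. H (f y) i j) has_derivative (\<lambda>u. ?D i j (f' u))) (at y)" for i j
    by (rule has_derivative_compose[OF f D])
  have "((\<lambda>y. \<Sum>i\<in>Basis. \<Sum>j\<in>Basis. (A y \<bullet> i) * (B y \<bullet> j) * H (f y) i j) has_derivative
     (\<lambda>u. \<Sum>i\<in>Basis. \<Sum>j\<in>Basis. (A y \<bullet> i) * (B y \<bullet> j) * ?D i j (f' u)
        + ((A y \<bullet> i) * (B' u \<bullet> j) + (A' u \<bullet> i) * (B y \<bullet> j)) * H (f y) i j)) (at y)"
    by (intro has_derivative_sum has_derivative_mult has_derivative_inner_left A B DH)
  moreover have "(\<Sum>i\<in>Basis. \<Sum>j\<in>Basis. (A y \<bullet> i) * (B y \<bullet> j) * ?D i j (f' u)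
        + ((A y \<bullet> i) * (B' u \<bullet> j) + (A' u \<bullet> i) * (B y \<bullet> j)) * H (f y) i j)
     = ?D (A y) (B y) (f' u) + H (f y) (A' u) (B y) + H (f y) (A y) (B' u)" for u
    unfolding Dexp[of "A y" "B y"] bilinear_expand[OF bil[OF U(2)], of "A' u" "B y"]
       bilinear_expand[OF bil[OF U(2)], of "A y" "B' u"]
    by (simp add: sum.distrib distrib_right)
  ultimately have 1: "((\<lambda>y. \<Sum>i\<in>Basis. \<Sum>j\<in>Basis. (A y \<bullet> i) * (B y \<bullet> j) * H (f y) i j) has_derivative
     (\<lambda>u. ?D (A y) (B y) (f' u) + H (f y) (A' u) (B y) + H (f y) (A y) (B' u))) (at y)" by simp
  have "isCont f y" using f by (rule has_derivative_continuous)
  then obtain V where V: "open V" "y \<in> V" "f ` V \<subseteq> U"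
    using U continuous_at_open[of y f] by (metis image_subset_iff)
  show ?thesis
    by (rule has_derivative_transform_within_open[OF 1 V(1,2)])
      (use V(3) bilinear_expand[OF bil] in auto)
qed

lemma orthonormal_set_independent:
  fixes h :: "'a::euclidean_space \<Rightarrow> 'a \<Rightarrow> real"
  assumes bil: "bilinear h" and J: "finite J"
    and on: "\<And>i j. i \<in> J \<Longrightarrow> j \<in> J \<Longrightarrow> h (E i) (E j) = (if i = j then 1 else 0)"
  shows "inj_on E J" "independent (E ` J)"
proof -
  show inj: "inj_on E J" using on by (intro inj_onI) (metis zero_neq_one)
  have "(\<forall>j\<in>J. c (E j) = 0)" if s: "(\<Sum>v\<in>E ` J. c v *\<^sub>R v) = 0" for c
  proof
    fix j assume j: "j \<in> J"
    have "0 = h (\<Sum>i\<in>J. c (E i) *\<^sub>R E i) (E j)"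
      using s inj by (simp add: sum.reindex bilinear_lzero[OF bil])
    also have "\<dots> = (\<Sum>i\<in>J. c (E i) * h (E i) (E j))"
    proof -
      have lin: "linear (\<lambda>x. h x (E j))" using bil unfolding bilinear_def by blast
      show ?thesis by (simp add: linear_sum[OF lin] linear_cmul[OF lin])
    qed
    also have "\<dots> = (\<Sum>i\<in>J. if i = j then c (E i) else 0)" using on j by (intro sum.cong) auto
    also have "\<dots> = c (E j)" using j J by simp
    finally show "c (E j) = 0" by simp
  qed
  then show "independent (E ` J)"
    unfolding dependent_finite[OF finite_imageI[OF J]] by blast
qed

lemma orthonormal_frame_expand:
  fixes h :: "'a::euclidean_space \<Rightarrow> 'a \<Rightarrow> real"
  assumes bil: "bilinear h" and on: "orthonormal_frame h E"
  shows "w = (\<Sum>i\<in>Basis. h w (E i) *\<^sub>R E i)"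
proof -
  note ind = orthonormal_set_independent[OF bil finite_Basis on[unfolded orthonormal_frame_def, rule_format]]
  have "card (E ` Basis) = DIM('a)" using ind(1) by (rule card_image)
  then have "span (E ` Basis) = UNIV"
    using ind(2) card_ge_dim_independent[of "E ` Basis" UNIV] by auto
  then have "w \<in> span (E ` Basis)" by simp
  then obtain c where "w = (\<Sum>v\<in>E ` Basis. c v *\<^sub>R v)"
    using span_finite[of "E ` Basis"] by auto
  then have w: "w = (\<Sum>i\<in>Basis. c (E i) *\<^sub>R E i)" using ind(1) by (simp add: sum.reindex)
  have "h w (E j) = c (E j)" if j: "j \<in> Basis" for j
  proof -
    have lin: "linear (\<lambda>x. h x (E j))" using bil unfolding bilinear_def by blast
    have "h w (E j) = (\<Sum>i\<in>Basis. c (E i) * h (E i) (E j))"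
      by (subst w) (simp add: linear_sum[OF lin] linear_cmul[OF lin])
    also have "\<dots> = (\<Sum>i\<in>Basis. if i = j then c (E i) else 0)"
      using on j unfolding orthonormal_frame_def by (intro sum.cong) auto
    also have "\<dots> = c (E j)" using j by simp
    finally show ?thesis .
  qed
  then show ?thesis using w by simp
qed

text \<open>Gram-Schmidt: while fewer vectors than the dimension have been found, some vector lies outside
  their span, and its component orthogonal to them can be normalized. This ensures that the
  choice of a frame in \<open>metric_trace\<close> really returns an orthonormal one.\<close>

lemma orthonormal_frame_exists:
  fixes h :: "'a::euclidean_space \<Rightarrow> 'a \<Rightarrow> real"
  assumes bil: "bilinear h" and sym: "\<And>u w. h u w = h w u" and pos: "\<And>u. u \<noteq> 0 \<Longrightarrow> h u u > 0"
  shows "\<exists>E. orthonormal_frame h E"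
proof -
  have "\<exists>E. \<forall>i\<in>J. \<forall>j\<in>J. h (E i) (E j) = (if i = j then 1 else 0)" if "J \<subseteq> (Basis :: 'a set)" for J
    using finite_subset[OF that finite_Basis] that
  proof (induction J rule: finite_induct)
    case empty
    then show ?case by simp
  next
    case (insert b J)
    then obtain E where E: "\<And>i j. i \<in> J \<Longrightarrow> j \<in> J \<Longrightarrow> h (E i) (E j) = (if i = j then 1 else 0)" by auto
    have "card (insert b J) \<le> DIM('a)" using insert by (intro card_mono) auto
    then have "card (E ` J) < DIM('a)" using insert card_image_le[of J E] by simp
    then have "span (E ` J) \<noteq> UNIV"
      using insert.hyps dim_le_card'[of "E ` J"] by (metis dim_UNIV dim_span finite_imageI leD)
    then obtain v0 where v0: "v0 \<notin> span (E ` J)" by blast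
    define v where "v = v0 - (\<Sum>i\<in>J. h v0 (E i) *\<^sub>R E i)"
    have "(\<Sum>i\<in>J. h v0 (E i) *\<^sub>R E i) \<in> span (E ` J)"
      by (intro span_sum span_scale span_base) auto
    then have "v \<noteq> 0" using v0 unfolding v_def by auto
    then have hv: "h v v > 0" by (rule pos)
    have lin: "linear (\<lambda>x. h x z)" for z using bil unfolding bilinear_def by blast
    have orth: "h v (E j) = 0" if j: "j \<in> J" for j
    proof -
      have "h v (E j) = h v0 (E j) - (\<Sum>i\<in>J. h v0 (E i) * h (E i) (E j))"
        unfolding v_def by (simp add: linear_diff[OF lin] linear_sum[OF lin] linear_cmul[OF lin])
      also have "(\<Sum>i\<in>J. h v0 (E i) * h (E i) (E j)) = (\<Sum>i\<in>J. if i = j then h v0 (E i) else 0)"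
        using E j by (intro sum.cong) auto
      also have "h v0 (E j) - \<dots> = 0" using j insert.hyps(1) by simp
      finally show ?thesis .
    qed
    define e where "e = (1 / sqrt (h v v)) *\<^sub>R v"
    have "h e e = 1" using hv unfolding e_def by (simp add: bilinear_lmul[OF bil] bilinear_rmul[OF bil])
    moreover have "h e (E j) = 0" "h (E j) e = 0" if "j \<in> J" for j
      using orth[OF that] sym unfolding e_def by (simp_all add: bilinear_lmul[OF bil] bilinear_rmul[OF bil])
    ultimately show ?case
      using E insert.hyps(2) by (intro exI[of _ "E(b := e)"]) auto
  qed
  from this[OF subset_refl] show ?thesis unfolding orthonormal_frame_def .
qed

lemma continuous_bounded_above_near:
  fixes f :: "'a::topological_space \<Rightarrow> real"
  assumes "open U" "x \<in> U" "continuous_on U f"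
  obtains V where "open V" "x \<in> V" "V \<subseteq> U" "\<And>y. y \<in> V \<Longrightarrow> f y < f x + 1"
proof (rule that)
  show "open (U \<inter> f -` {..<f x + 1})" using assms by (intro continuous_open_preimage) auto
qed (use assms in auto)

lemma smooth_derivative_bounded_near:
  fixes f :: "'a::euclidean_space \<Rightarrow> real"
  assumes U: "open U" "x \<in> U" and f: "smooth_on f U"
  obtains V K where "open V" "x \<in> V" "V \<subseteq> U" "K \<ge> 0"
    "\<And>y v. y \<in> V \<Longrightarrow> \<bar>frechet_derivative f (at y) v\<bar> \<le> K * norm v"
proof -
  define \<kappa> where "\<kappa> y = (\<Sum>k\<in>Basis. \<bar>frechet_derivative f (at y) k\<bar>)" for y
  have "continuous_on U (\<lambda>y. frechet_derivative f (at y) k)" for k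
    using smooth_on_frechet[OF f] unfolding smooth_on_def by (metis Ck_on.simps(1))
  then have "continuous_on U \<kappa>" unfolding \<kappa>_def by (intro continuous_intros)
  then obtain V where V: "open V" "x \<in> V" "V \<subseteq> U" "\<And>y. y \<in> V \<Longrightarrow> \<kappa> y < \<kappa> x + 1"
    using continuous_bounded_above_near[OF U] by metis
  have bound: "\<bar>frechet_derivative f (at y) v\<bar> \<le> \<kappa> y * norm v" if y: "y \<in> U" for y v
  proof -
    have lin: "linear (frechet_derivative f (at y))"
      by (rule linear_frechet_derivative[OF smooth_on_differentiable[OF f y]])
    have "frechet_derivative f (at y) v = frechet_derivative f (at y) (\<Sum>k\<in>Basis. (v \<bullet> k) *\<^sub>R k)"
      by (simp add: euclidean_representation)
    also have "\<dots> = (\<Sum>k\<in>Basis. (v \<bullet> k) * frechet_derivative f (at y) k)"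
      by (simp only: linear_sum[OF lin] linear_cmul[OF lin] real_scaleR_def)
    also have "\<bar>\<dots>\<bar> \<le> (\<Sum>k\<in>Basis. \<bar>(v \<bullet> k) * frechet_derivative f (at y) k\<bar>)" by (rule sum_abs)
    also have "\<dots> \<le> (\<Sum>k\<in>Basis. norm v * \<bar>frechet_derivative f (at y) k\<bar>)"
      by (intro sum_mono) (simp add: abs_mult mult_right_mono Basis_le_norm)
    finally show ?thesis unfolding \<kappa>_def by (simp add: sum_distrib_left mult.commute)
  qed
  have "\<kappa> x \<ge> 0" unfolding \<kappa>_def by (intro sum_nonneg) auto
  moreover have "\<bar>frechet_derivative f (at y) v\<bar> \<le> (\<kappa> x + 1) * norm v" if "y \<in> V" for y v
  proof -
    have "\<bar>frechet_derivative f (at y) v\<bar> \<le> \<kappa> y * norm v" using bound V(3) that by blast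
    also have "\<dots> \<le> (\<kappa> x + 1) * norm v" using V(4)[OF that] by (intro mult_right_mono) auto
    finally show ?thesis .
  qed
  ultimately show ?thesis using that[OF V(1-3), of "\<kappa> x + 1"] by simp
qed

lemma bilinear_field_derivative_bounded_near:
  fixes H :: "'d::euclidean_space \<Rightarrow> 'a::euclidean_space \<Rightarrow> 'a \<Rightarrow> real"
  assumes U: "open U" "x \<in> U" and bil: "\<And>x. x \<in> U \<Longrightarrow> bilinear (H x)"
    and H: "\<And>a b. smooth_on (\<lambda>x. H x a b) U"
  obtains V K where "open V" "x \<in> V" "V \<subseteq> U" "K \<ge> 0"
    "\<And>y a b v. y \<in> V \<Longrightarrow> \<bar>frechet_derivative (\<lambda>x. H x a b) (at y) v\<bar> \<le> K * norm a * norm b * norm v"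
proof -
  let ?D = "\<lambda>y a b. frechet_derivative (\<lambda>x. H x a b) (at y)"
  have "\<exists>V K. open V \<and> x \<in> V \<and> V \<subseteq> U \<and> K \<ge> 0 \<and> (\<forall>y\<in>V. \<forall>v. \<bar>?D y i j v\<bar> \<le> K * norm v)" for i j
    using smooth_derivative_bounded_near[OF U H[of i j]] by metis
  then obtain V K where VK: "\<And>i j. open (V i j)" "\<And>i j. x \<in> V i j" "\<And>i j. V i j \<subseteq> U" "\<And>i j. (K i j :: real) \<ge> 0"
    "\<And>i j y v. y \<in> V i j \<Longrightarrow> \<bar>?D y i j v\<bar> \<le> K i j * norm v" by metis
  define W where "W = U \<inter> (\<Inter>i\<in>Basis. \<Inter>j\<in>Basis. V i j)"
  define L where "L = (\<Sum>i\<in>Basis. \<Sum>j\<in>Basis. K i j)"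
  show ?thesis
  proof (rule that[of W L])
    show "open W" unfolding W_def using U VK(1) by (intro open_Int open_INT ballI) auto
    show "x \<in> W" "W \<subseteq> U" unfolding W_def using U VK(2) by auto
    show "L \<ge> 0" unfolding L_def using VK(4) by (intro sum_nonneg)
    fix y a b v assume y: "y \<in> W"
    have yU: "y \<in> U" using y unfolding W_def by blast
    have "\<bar>?D y a b v\<bar> = \<bar>\<Sum>i\<in>Basis. \<Sum>j\<in>Basis. (a \<bullet> i) * (b \<bullet> j) * ?D y i j v\<bar>"
      using frechet_derivative_bilinear_field[OF U(1) yU bil] smooth_on_differentiable[OF H yU] by simp
    also have "\<dots> \<le> (\<Sum>i\<in>Basis. \<Sum>j\<in>Basis. \<bar>(a \<bullet> i) * (b \<bullet> j) * ?D y i j v\<bar>)"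
      by (rule order_trans[OF sum_abs sum_mono[OF sum_abs]])
    also have "\<dots> \<le> (\<Sum>i\<in>Basis. \<Sum>j\<in>Basis. norm a * norm b * (K i j * norm v))"
    proof (intro sum_mono)
      fix i j :: 'a assume ij: "i \<in> Basis" "j \<in> Basis"
      then have "y \<in> V i j" using y unfolding W_def by blast
      from VK(5)[OF this] show "\<bar>(a \<bullet> i) * (b \<bullet> j) * ?D y i j v\<bar> \<le> norm a * norm b * (K i j * norm v)"
        unfolding abs_mult using ij by (intro mult_mono) (auto simp: Basis_le_norm)
    qed
    also have "\<dots> = L * norm a * norm b * norm v"
      unfolding L_def by (simp add: sum_distrib_left sum_distrib_right mult_ac)
    finally show "\<bar>?D y a b v\<bar> \<le> L * norm a * norm b * norm v" .
  qed
qed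

text \<open>At \<open>x\<close> the bound holds by compactness of the unit sphere. At \<open>y\<close> the form differs from that at \<open>x\<close>
  by at most \<open>\<delta> y |a|\<^sup>2\<close>, where \<open>\<delta>\<close> is continuous and vanishes at \<open>x\<close>.\<close>

lemma positive_definite_bounded_below_near:
  fixes H :: "'d::topological_space \<Rightarrow> 'a::euclidean_space \<Rightarrow> 'a \<Rightarrow> real"
  assumes U: "open U" "x \<in> U" and bil: "\<And>x. x \<in> U \<Longrightarrow> bilinear (H x)"
    and H: "\<And>a b. continuous_on U (\<lambda>x. H x a b)" and pos: "\<And>a. a \<noteq> 0 \<Longrightarrow> H x a a > 0"
  obtains V k where "open V" "x \<in> V" "V \<subseteq> U" "k > 0" "\<And>y a. y \<in> V \<Longrightarrow> k * (norm a)\<^sup>2 \<le> H y a a"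
proof -
  have bx: "bilinear (H x)" using bil U by blast
  have "continuous_on (sphere 0 1) (\<lambda>a. H x a a)"
    by (subst bilinear_expand[OF bx]) (intro continuous_intros)
  moreover have "sphere (0::'a) 1 \<noteq> {}" by simp
  ultimately obtain a0 where a0: "a0 \<in> sphere 0 1" "\<And>a. a \<in> sphere 0 1 \<Longrightarrow> H x a0 a0 \<le> H x a a"
    using continuous_attains_inf[OF compact_sphere, of 0 1 "\<lambda>a. H x a a"] by blast
  define m where "m = H x a0 a0"
  have m: "m > 0" unfolding m_def by (rule pos) (use a0(1) in auto)
  have low: "m * (norm a)\<^sup>2 \<le> H x a a" for a
  proof (cases "a = 0")
    case True
    then show ?thesis using bilinear_lzero[OF bx] by simp
  next
    case False
    have "m \<le> H x (a /\<^sub>R norm a) (a /\<^sub>R norm a)"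
      unfolding m_def by (rule a0(2)) (use False in simp)
    then show ?thesis using False
      by (simp add: bilinear_lmul[OF bx] bilinear_rmul[OF bx] field_simps power2_eq_square)
  qed
  define \<delta> where "\<delta> y = (\<Sum>i\<in>Basis. \<Sum>j\<in>Basis. \<bar>H y i j - H x i j\<bar>)" for y
  have c\<delta>: "continuous_on U \<delta>" unfolding \<delta>_def by (intro continuous_intros H)
  let ?V = "U \<inter> \<delta> -` {..<m / 2}"
  show ?thesis
  proof (rule that[of ?V "m / 2"])
    show "open ?V" using U c\<delta> by (intro continuous_open_preimage) auto
    show "x \<in> ?V" using U m by (simp add: \<delta>_def)
    show "?V \<subseteq> U" "m / 2 > 0" using m by auto
    fix y a assume y: "y \<in> ?V"
    have "\<bar>H y a a - H x a a\<bar> = \<bar>\<Sum>i\<in>Basis. \<Sum>j\<in>Basis. (a \<bullet> i) * (a \<bullet> j) * (H y i j - H x i j)\<bar>"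
      using y bilinear_expand[OF bil, of y a a] bilinear_expand[OF bx, of a a]
      by (simp add: sum_subtractf right_diff_distrib)
    also have "\<dots> \<le> (\<Sum>i\<in>Basis. \<Sum>j\<in>Basis. \<bar>(a \<bullet> i) * (a \<bullet> j) * (H y i j - H x i j)\<bar>)"
      by (rule order_trans[OF sum_abs sum_mono[OF sum_abs]])
    also have "\<dots> \<le> (\<Sum>i\<in>Basis. \<Sum>j\<in>Basis. norm a * norm a * \<bar>H y i j - H x i j\<bar>)"
      unfolding abs_mult by (intro sum_mono mult_mono) (auto simp: Basis_le_norm)
    also have "\<dots> = \<delta> y * (norm a)\<^sup>2"
      unfolding \<delta>_def by (simp add: sum_distrib_left power2_eq_square mult_ac)
    also have "\<dots> \<le> m / 2 * (norm a)\<^sup>2" using y by (intro mult_right_mono) auto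
    finally show "m / 2 * (norm a)\<^sup>2 \<le> H y a a" using low[of a] by linarith
  qed
qed

section \<open>Riemannian immersions in a chart\<close>

definition metric_in_chart ::
  "('p, 'e::euclidean_space) manifold \<Rightarrow> ('p, 'e) chart \<Rightarrow> ('p, 'e) tensor2 \<Rightarrow> 'e \<Rightarrow> 'e \<Rightarrow> 'e \<Rightarrow> real" where
  "metric_in_chart M c h x a b =
     h (param c x) (coord_field M c a (param c x)) (coord_field M c b (param c x))"

text \<open>The target metric is Lorentzian in the application, whence definiteness is demanded of the induced
  metric.\<close>

locale riemannian_immersion =
  fixes S :: "('s, 'e::euclidean_space) manifold" and M :: "('p, 'd::euclidean_space) manifold"
    and h :: "('p, 'd) tensor2" and nabla and \<iota> :: "'s \<Rightarrow> 'p"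
  assumes S: "smooth_manifold S" and M: "smooth_manifold M" and \<iota>: "smooth_map S M \<iota>"
    and h: "smooth_tensor2 M h" and h_sym: "\<And>p u w. p \<in> points M \<Longrightarrow> h p u w = h p w u"
    and nabla: "levi_civita_connection M h nabla"
    and induced: "riemannian_metric S (induced_metric S M h \<iota>)"
begin

definition local_rep :: "('p, 'd) chart \<Rightarrow> ('s, 'e) chart \<Rightarrow> 'e \<Rightarrow> 'd" where
  "local_rep c s = coords c \<circ> \<iota> \<circ> param s"

text \<open>Minus its normal part is the second fundamental form on the vectors with components \<open>u\<close> and \<open>w\<close> in
  the chart \<open>s\<close> (lemma \<open>second_fundamental_form_eq_at\<close>).\<close>

definition cov_coord :: "('s, 'e) chart \<Rightarrow> 's \<Rightarrow> 'e \<Rightarrow> 'e \<Rightarrow> 'd" where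
  "cov_coord s q u w = cov_deriv_along S M nabla \<iota> q (coord_field S s u q) (\<lambda>r. tmap S M \<iota> r (coord_field S s w r))"

definition local_rep_dom :: "('p, 'd) chart \<Rightarrow> ('s, 'e) chart \<Rightarrow> 'e set" where
  "local_rep_dom c s = coords s ` {r \<in> cdom s. \<iota> r \<in> cdom c}"

lemma \<iota>_points: "q \<in> points S \<Longrightarrow> \<iota> q \<in> points M"
  using \<iota> unfolding smooth_map_def continuous_map_def by auto

lemma open_local_rep_dom:
  assumes s: "s \<in> atlas S" and c: "c \<in> atlas M"
  shows "open (local_rep_dom c s)"
proof -
  have "openin (mtop S) {r \<in> points S. \<iota> r \<in> cdom c}"
    using \<iota> chart_of_atlas[OF M c] unfolding smooth_map_def is_chart_def
    by (intro openin_continuous_map_preimage[of _ "mtop M"]) auto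
  from chart_overlap_open[OF S s this] show ?thesis
    using cdom_subset_points[OF S s] unfolding local_rep_dom_def by (simp add: Int_def subset_iff cong: conj_cong)
qed

lemma smooth_local_rep: "s \<in> atlas S \<Longrightarrow> c \<in> atlas M \<Longrightarrow> smooth_on (local_rep c s) (local_rep_dom c s)"
  using \<iota> unfolding smooth_map_def local_rep_def local_rep_dom_def by blast

lemma param_local_rep:
  assumes "s \<in> atlas S" "c \<in> atlas M" "y \<in> local_rep_dom c s"
  shows "param s y \<in> cdom s" "\<iota> (param s y) \<in> cdom c" "coords s (param s y) = y"
    "param c (local_rep c s y) = \<iota> (param s y)"
  using assms chart_of_atlas[OF S assms(1)] chart_of_atlas[OF M assms(2)]
  unfolding local_rep_dom_def local_rep_def by (auto simp: param_coords)

lemma tmap_coord_field: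
  assumes s: "s \<in> atlas S" and c: "c \<in> atlas M" and r: "r \<in> cdom s" "\<iota> r \<in> cdom c"
  shows "tmap S M \<iota> r (coord_field S s w r) = coord_field M c (frechet_derivative (local_rep c s) (at (coords s r)) w) (\<iota> r)"
proof -
  have "r \<in> points S" using cdom_subset_points[OF S s] r by blast
  then have "chart_components M c (\<iota> r) (tmap S M \<iota> r (coord_field S s w r)) = frechet_derivative (local_rep c s) (at (coords s r)) w"
    using components_tmap[OF S M \<iota> s c r] components_coord_field[OF S s _ r(1)] unfolding local_rep_def by simp
  then show ?thesis using coord_field_components[OF M c r(2)] by metis
qed

text \<open>Compatibility with the metric and absence of torsion, for coordinate fields of the preferred
  chart at \<open>p\<close>: these commute, and at \<open>p\<close> they coincide with their components.\<close>

lemma vector_field_compat: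
  assumes p: "p \<in> points M" and c: "c = chart_at M p"
  shows "frechet_derivative (\<lambda>x. metric_in_chart M c h x a b) (at (coords c p)) v =
     h p (nabla (coord_field M c v) (coord_field M c a) p) b + h p a (nabla (coord_field M c v) (coord_field M c b) p)"
    and "nabla (coord_field M c a) (coord_field M c b) p = nabla (coord_field M c b) (coord_field M c a) p"
proof -
  note ch = manifold_chartD[OF M p, folded c]
  have o: "openin (mtop M) (cdom c)" using ch unfolding is_chart_def by blast
  have cf: "coord_field M c a p = a" for a unfolding c by (rule components_self[OF M p])
  note smooth = smooth_coord_field[OF M ch(1)]
  have "vderiv M (\<lambda>q. h q (coord_field M c a q) (coord_field M c b q)) p (coord_field M c v p) =
    h p (nabla (coord_field M c v) (coord_field M c a) p) (coord_field M c b p) +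
    h p (coord_field M c a p) (nabla (coord_field M c v) (coord_field M c b) p)"
    using nabla o smooth ch(3) unfolding levi_civita_connection_def by blast
  then show "frechet_derivative (\<lambda>x. metric_in_chart M c h x a b) (at (coords c p)) v =
     h p (nabla (coord_field M c v) (coord_field M c a) p) b + h p a (nabla (coord_field M c v) (coord_field M c b) p)"
    unfolding vderiv_def c[symmetric] cf metric_in_chart_def o_def .
  have "nabla (coord_field M c a) (coord_field M c b) p - nabla (coord_field M c b) (coord_field M c a) p
     = lie_bracket M (coord_field M c a) (coord_field M c b) p"
    using nabla o smooth ch(3) unfolding levi_civita_connection_def by blast
  also have "\<dots> = 0" unfolding c by (rule lie_bracket_coord_fields[OF M p])
  finally show "nabla (coord_field M c a) (coord_field M c b) p = nabla (coord_field M c b) (coord_field M c a) p"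
    by simp
qed

text \<open>Koszul's formula for coordinate fields, where the terms with brackets vanish.\<close>

lemma koszul:
  assumes p: "p \<in> points M" and c: "c = chart_at M p"
  shows "h p b (nabla (coord_field M c a) (coord_field M c a) p) =
    frechet_derivative (\<lambda>x. metric_in_chart M c h x a b) (at (coords c p)) a
    - frechet_derivative (\<lambda>x. metric_in_chart M c h x a a) (at (coords c p)) b / 2"
  unfolding vector_field_compat[OF p c] vector_field_compat(2)[OF p c, of b a]
  using h_sym[OF p] by simp

context
  fixes s q c
  assumes s: "s \<in> atlas S" and q: "q \<in> cdom s" and c: "c = chart_at M (\<iota> q)"
begin

lemma base_point: "q \<in> points S" using cdom_subset_points[OF S s] q by blast

lemma image_point: "\<iota> q \<in> points M" by (rule \<iota>_points[OF base_point])

lemmas image_chart = manifold_chartD[OF M image_point, folded c]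

lemma coords_in_local_rep_dom: "coords s q \<in> local_rep_dom c s"
  using q image_chart unfolding local_rep_dom_def by blast

text \<open>With \<open>c\<close> the preferred chart at \<open>\<iota> q\<close>, tangent vectors at \<open>\<iota> q\<close> are their own components in \<open>c\<close>.
  The chart \<open>s\<close>, in contrast, is arbitrary.\<close>

lemma tmap_coord_field_at: "tmap S M \<iota> q (coord_field S s w q) = frechet_derivative (local_rep c s) (at (coords s q)) w"
  unfolding tmap_coord_field[OF s image_chart(1) q image_chart(3)] unfolding c by (rule components_self[OF M image_point])

lemma cov_coord_eq:
  "cov_coord s q u w = frechet_derivative (\<lambda>y. frechet_derivative (local_rep c s) (at y) w) (at (coords s q)) u +
     nabla (coord_field M c (frechet_derivative (local_rep c s) (at (coords s q)) u))
       (coord_field M c (frechet_derivative (local_rep c s) (at (coords s q)) w)) (\<iota> q)"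
proof -
  let ?F = "\<lambda>r. chart_components M c (\<iota> r) (tmap S M \<iota> r (coord_field S s w r))"
  have F: "(?F \<circ> param s) y = frechet_derivative (local_rep c s) (at y) w" if y: "y \<in> local_rep_dom c s" for y
  proof -
    note y' = param_local_rep[OF s image_chart(1) y]
    have "\<iota> (param s y) \<in> points M" using y'(2) cdom_subset_points[OF M image_chart(1)] by blast
    then show ?thesis
      using tmap_coord_field[OF s image_chart(1) y'(1,2)] components_coord_field[OF M image_chart(1) _ y'(2)] y'(3) by simp
  qed
  have "((\<lambda>y. frechet_derivative (local_rep c s) (at y) w) has_derivative
      frechet_derivative (\<lambda>y. frechet_derivative (local_rep c s) (at y) w) (at (coords s q))) (at (coords s q))"
    using smooth_on_differentiable[OF smooth_on_frechet[OF smooth_local_rep[OF s image_chart(1)]] coords_in_local_rep_dom]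
    by (simp add: frechet_derivative_works)
  then have D: "((?F \<circ> param s) has_derivative
      frechet_derivative (\<lambda>y. frechet_derivative (local_rep c s) (at y) w) (at (coords s q))) (at (coords s q))"
    by (rule has_derivative_transform_within_open[OF _ open_local_rep_dom[OF s image_chart(1)] coords_in_local_rep_dom]) (simp only: F)
  have "vderiv S ?F q (coord_field S s u q) =
     frechet_derivative (\<lambda>y. frechet_derivative (local_rep c s) (at y) w) (at (coords s q)) u"
    unfolding vderiv_coord_field[OF S s q differentiableI[OF D]]
    unfolding frechet_derivative_at[OF D, symmetric] ..
  then show ?thesis
    unfolding cov_coord_def cov_deriv_along_def Let_def c[symmetric] tmap_coord_field_at by simp
qed

text \<open>The second derivatives of the immersion are symmetric, and the connection has no torsion.\<close>

lemma cov_coord_sym: "cov_coord s q u w = cov_coord s q w u"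
  unfolding cov_coord_eq
  using symmetric_second_derivative[OF open_local_rep_dom[OF s image_chart(1)] coords_in_local_rep_dom smooth_local_rep[OF s image_chart(1)], of w u]
    vector_field_compat(2)[OF image_point c] by simp

text \<open>Compatibility of the pulled back connection with the metric. By the product rule, the derivative
  of the induced coefficients consists of a derivative of the target coefficients, to which
  \<open>vector_field_compat\<close> applies, and of second derivatives of the immersion; the two kinds of
  terms combine to covariant derivatives along \<open>\<iota>\<close>.\<close>

lemma metric_derivative_along:
  "frechet_derivative (\<lambda>y. metric_in_chart S s (induced_metric S M h \<iota>) y w v) (at (coords s q)) u =
     h (\<iota> q) (cov_coord s q u w) (frechet_derivative (local_rep c s) (at (coords s q)) v) +
     h (\<iota> q) (frechet_derivative (local_rep c s) (at (coords s q)) w) (cov_coord s q u v)"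
proof -
  let ?H = "metric_in_chart M c h" and ?f = "local_rep c s" and ?y = "coords s q"
  let ?U = "coords c ` cdom c"
  note V = open_local_rep_dom[OF s image_chart(1)] coords_in_local_rep_dom
  have fq: "?f ?y = coords c (\<iota> q)" "param c (coords c (\<iota> q)) = \<iota> q"
    using chart_of_atlas[OF S s] q image_chart by (simp_all add: local_rep_def param_coords)
  have U: "open ?U" "?f ?y \<in> ?U" using image_chart fq unfolding is_chart_def by auto
  have bil: "bilinear (?H x)" if "x \<in> ?U" for x
  proof -
    have "param c x \<in> cdom c" using that image_chart(2) by (auto simp: param_coords)
    note * = linear_coord_field[OF M image_chart(1) this] and m = cdom_subset_points[OF M image_chart(1), THEN subsetD, OF this]
    have "bilinear (h (param c x))" using h m unfolding smooth_tensor2_def by blast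
    then show ?thesis unfolding bilinear_def metric_in_chart_def
      using linear_compose[OF *, of "\<lambda>a. h (param c x) a _"] linear_compose[OF *, of "h (param c x) _"]
      by (auto simp: o_def)
  qed
  have H: "(\<lambda>x. ?H x a b) differentiable (at (?f ?y))" for a b
    using h image_chart(1) U(2) unfolding smooth_tensor2_def metric_in_chart_def by (blast intro: smooth_on_differentiable)
  have f: "(?f has_derivative frechet_derivative ?f (at ?y)) (at ?y)"
    using smooth_on_differentiable[OF smooth_local_rep[OF s image_chart(1)] V(2)] by (simp add: frechet_derivative_works)
  have A: "((\<lambda>y. frechet_derivative ?f (at y) w) has_derivative
      frechet_derivative (\<lambda>y. frechet_derivative ?f (at y) w) (at ?y)) (at ?y)" for w
    using smooth_on_differentiable[OF smooth_on_frechet[OF smooth_local_rep[OF s image_chart(1)]] V(2)]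
    by (simp add: frechet_derivative_works)
  have eq: "metric_in_chart S s (induced_metric S M h \<iota>) y w v =
      ?H (?f y) (frechet_derivative ?f (at y) w) (frechet_derivative ?f (at y) v)" if y: "y \<in> local_rep_dom c s" for y
    unfolding metric_in_chart_def induced_metric_def param_local_rep(4)[OF s image_chart(1) y]
      tmap_coord_field[OF s image_chart(1) param_local_rep(1,2)[OF s image_chart(1) y]] param_local_rep(3)[OF s image_chart(1) y] ..
  have at: "?H (coords c (\<iota> q)) a b = h (\<iota> q) a b" for a b
    unfolding metric_in_chart_def fq(2) unfolding c components_self(2)[OF M image_point] ..
  have "frechet_derivative (\<lambda>y. metric_in_chart S s (induced_metric S M h \<iota>) y w v) (at ?y) =
     frechet_derivative (\<lambda>y. ?H (?f y) (frechet_derivative ?f (at y) w) (frechet_derivative ?f (at y) v)) (at ?y)"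
    by (rule frechet_cong_open[OF V eq])
  also note frechet_derivative_at[OF has_derivative_bilinear_field[OF U bil H f A A], symmetric]
  finally show ?thesis
    unfolding cov_coord_eq fq(1) at vector_field_compat(1)[OF image_point c]
    using h image_point unfolding smooth_tensor2_def by (simp add: bilinear_ladd bilinear_radd)
qed

text \<open>Hence the tangential part of \<open>cov_coord s q u u\<close> depends only on the induced metric: the right-hand
  side consists of Christoffel symbols of the first kind.\<close>

lemma koszul_along:
  "h (\<iota> q) (cov_coord s q u u) (frechet_derivative (local_rep c s) (at (coords s q)) v) =
    frechet_derivative (\<lambda>y. metric_in_chart S s (induced_metric S M h \<iota>) y u v) (at (coords s q)) u
    - frechet_derivative (\<lambda>y. metric_in_chart S s (induced_metric S M h \<iota>) y u u) (at (coords s q)) v / 2"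
  unfolding metric_derivative_along cov_coord_sym[of v u] using h_sym[OF image_point] by simp

end

text \<open>Subtracting the components along an orthonormal tangent frame leaves a normal vector. The
  decomposition is unique since a vector that is both tangent and normal has vanishing square
  with respect to the induced metric, which is definite.\<close>

lemma normal_part_eq:
  assumes q: "q \<in> points S" and E: "orthonormal_frame (induced_metric S M h \<iota> q) E"
  shows "normal_part S M h \<iota> q z = z - (\<Sum>j\<in>Basis. h (\<iota> q) z (tmap S M \<iota> q (E j)) *\<^sub>R tmap S M \<iota> q (E j))"
proof -
  let ?d = "tmap S M \<iota> q" and ?h = "h (\<iota> q)"
  have bil: "bilinear ?h" using h \<iota>_points[OF q] unfolding smooth_tensor2_def by blast
  have ibil: "bilinear (induced_metric S M h \<iota> q)"
    using induced q unfolding riemannian_metric_def smooth_tensor2_def by blast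
  note s = manifold_chartD[OF S q]
  have lin: "linear ?d"
    unfolding tmap_def
    by (rule linear_frechet_derivative, rule smooth_on_differentiable[OF smooth_local_rep[OF s(1), unfolded local_rep_def]])
      (use s q \<iota>_points[OF q] manifold_chartD[OF M] in \<open>auto simp: local_rep_dom_def\<close>)
  note ll = bil[unfolded bilinear_def]
  define t where "t = (\<Sum>j\<in>Basis. ?h z (?d (E j)) *\<^sub>R E j)"
  have dt: "?d t = (\<Sum>j\<in>Basis. ?h z (?d (E j)) *\<^sub>R ?d (E j))"
    unfolding t_def by (simp add: linear_sum[OF lin] linear_cmul[OF lin])
  have E': "?h (?d (E i)) (?d (E j)) = (if i = j then 1 else 0)" if "i \<in> Basis" "j \<in> Basis" for i j
    using E that unfolding orthonormal_frame_def induced_metric_def by auto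
  have "?h (?d t) (?d (E i)) = ?h z (?d (E i))" if i: "i \<in> Basis" for i
  proof -
    have l: "linear (\<lambda>x. ?h x (?d (E i)))" using ll by blast
    have "?h (?d t) (?d (E i)) = (\<Sum>j\<in>Basis. ?h z (?d (E j)) * ?h (?d (E j)) (?d (E i)))"
      unfolding dt by (simp add: linear_sum[OF l] linear_cmul[OF l])
    also have "\<dots> = (\<Sum>j\<in>Basis. if j = i then ?h z (?d (E j)) else 0)"
      using i by (intro sum.cong) (auto simp: E')
    finally show ?thesis using i by simp
  qed
  then have orthE: "?h (z - ?d t) (?d (E i)) = 0" if "i \<in> Basis" for i
    using that by (simp add: bilinear_lsub[OF bil])
  have orth: "?h (z - ?d t) (?d u) = 0" for u
  proof -
    have l: "linear (?h (z - ?d t))" using ll by blast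
    have "?d u = ?d (\<Sum>j\<in>Basis. induced_metric S M h \<iota> q u (E j) *\<^sub>R E j)"
      using orthonormal_frame_expand[OF ibil E] by (rule arg_cong)
    then show ?thesis
      by (simp add: linear_sum[OF lin] linear_cmul[OF lin] linear_sum[OF l] linear_cmul[OF l] orthE)
  qed
  have "normal_part S M h \<iota> q z = z - ?d t"
    unfolding normal_part_def
  proof (rule the_equality)
    show "z - (z - ?d t) \<in> range ?d \<and> (\<forall>u. ?h (z - ?d t) (?d u) = 0)" using orth by simp
    fix w assume w: "z - w \<in> range ?d \<and> (\<forall>u. ?h w (?d u) = 0)"
    then obtain x where x: "z - w = ?d x" by blast
    have "(z - ?d t) - w = ?d (x - t)" using x by (simp add: linear_diff[OF lin] algebra_simps)
    then have "?h (?d (x - t)) (?d (x - t)) = ?h (z - ?d t) (?d (x - t)) - ?h w (?d (x - t))"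
      by (metis bilinear_lsub[OF bil])
    also have "\<dots> = 0" using orth w by simp
    finally have "induced_metric S M h \<iota> q (x - t) (x - t) = 0" unfolding induced_metric_def .
    then have "x - t = 0"
      using induced q unfolding riemannian_metric_def by (metis less_irrefl)
    then show "w = z - ?d t" using x by (simp add: algebra_simps)
  qed
  then show ?thesis unfolding dt .
qed

end

section \<open>The metric of an orthogonally splitted spacetime\<close>

abbreviation spatial_part :: "(real \<Rightarrow> ('x, 'f) tensor2) \<Rightarrow> (real \<times> 'x, real \<times> 'f) tensor2" where
  "spatial_part g \<equiv> \<lambda>p V W. g (fst p) (snd p) (snd V) (snd W)"

lemma smooth_on_real_combination:
  fixes f g :: "'a::real_normed_vector \<Rightarrow> real"
  assumes "open U" "smooth_on f U" "smooth_on g U"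
  shows "smooth_on (\<lambda>x. k * f x + g x) U"
  using assms Ck_on_add[OF assms(1) Ck_on_bounded_linear[OF bounded_linear_mult_right assms(1)]]
  unfolding smooth_on_def by blast

locale splitting =
  fixes I :: "real set" and F :: "('x, 'f::euclidean_space) manifold"
    and \<beta> :: "real \<times> 'x \<Rightarrow> real" and g :: "real \<Rightarrow> ('x, 'f) tensor2"
  assumes splitted: "orthogonally_splitted I F \<beta> g"
begin

abbreviation "M \<equiv> spacetime I F"

lemma openI: "open I" and F: "smooth_manifold F" and smooth_M: "smooth_manifold M"
  and \<beta>_pos: "p \<in> points M \<Longrightarrow> \<beta> p > 0"
  using splitted smooth_manifold_spacetime[OF splitted] unfolding orthogonally_splitted_def by auto

lemma points_M: "p \<in> points M \<longleftrightarrow> fst p \<in> I \<and> snd p \<in> points F"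
  by (auto simp: prod_manifold_def interval_manifold_def mem_Times_iff)

lemma atlas_M:
  assumes "c \<in> atlas M"
  obtains d where "d \<in> atlas F" "c = prod_chart (I, \<lambda>t. t) d"
  using assms by (auto simp: prod_manifold_def interval_manifold_def)

lemma chart_at_M: "chart_at M p = prod_chart (I, \<lambda>t. t) (chart_at F (snd p))"
  by (simp add: prod_manifold_def interval_manifold_def case_prod_unfold)

lemma fst_coords: "c \<in> atlas M \<Longrightarrow> fst (coords c p) = fst p"
  by (erule atlas_M) (simp add: prod_chart_def)

lemma coord_field_M:
  assumes "d \<in> atlas F" "r \<in> cdom (prod_chart (I, \<lambda>t. t) d)"
  shows "coord_field M (prod_chart (I, \<lambda>t. t) d) u r = (fst u, coord_field F d (snd u) (snd r))"
proof -
  have r: "fst r \<in> I" "snd r \<in> cdom d" using assms(2) by (auto simp: prod_chart_def)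
  have a: "(I, \<lambda>t. t) \<in> atlas (interval_manifold I)" by (simp add: interval_manifold_def)
  show ?thesis
    using coord_field_prod[OF smooth_manifold_interval[OF openI] a _ F assms(1) r(2), of "fst r" u] r(1)
      coord_field_interval[OF openI r(1)] by simp
qed

lemma fst_coord_field:
  assumes "c \<in> atlas M" "r \<in> cdom c"
  shows "fst (coord_field M c u r) = fst u"
proof -
  obtain d where "d \<in> atlas F" "c = prod_chart (I, \<lambda>t. t) d" using atlas_M[OF assms(1)] by blast
  then show ?thesis using coord_field_M[of d r u] assms(2) by simp
qed

lemma bilinear_g: "bilinear (g (fst p) (snd p))"
  and sym_g: "g (fst p) (snd p) u w = g (fst p) (snd p) w u"
  if "p \<in> points M"
proof -
  have "riemannian_metric F (g (fst p))" "snd p \<in> points F"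
    using splitted that unfolding orthogonally_splitted_def points_M by simp_all
  then show "bilinear (g (fst p) (snd p))" "g (fst p) (snd p) u w = g (fst p) (snd p) w u"
    unfolding riemannian_metric_def smooth_tensor2_def by simp_all
qed

lemma bilinear_split_metric:
  assumes "p \<in> points M"
  shows "bilinear (split_metric \<beta> g p)"
proof -
  note b = bilinear_g[OF assms]
  show ?thesis
    unfolding bilinear_def split_metric_def
  proof (intro conjI allI linearI)
  qed (simp_all add: algebra_simps bilinear_ladd[OF b] bilinear_radd[OF b] bilinear_lmul[OF b] bilinear_rmul[OF b])
qed

lemma sym_split_metric: "p \<in> points M \<Longrightarrow> split_metric \<beta> g p u w = split_metric \<beta> g p w u"
  using sym_g unfolding split_metric_def by (simp add: mult.commute)

lemma metric_in_chart_split: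
  assumes c: "c \<in> atlas M" and x: "x \<in> coords c ` cdom c"
  shows "metric_in_chart M c (split_metric \<beta> g) x a b =
    - (fst a * fst b) * (\<beta> \<circ> param c) x + metric_in_chart M c (spatial_part g) x a b"
proof -
  have "param c x \<in> cdom c" using x chart_of_atlas[OF smooth_M c] by (auto simp: param_coords)
  from fst_coord_field[OF c this] show ?thesis
    unfolding metric_in_chart_def split_metric_def by simp
qed

lemma smooth_beta:
  assumes c: "c \<in> atlas M"
  shows "smooth_on (\<beta> \<circ> param c) (coords c ` cdom c)"
proof -
  have "smooth_fun_on M (points M) \<beta>" using splitted unfolding orthogonally_splitted_def by simp
  then have "smooth_on (\<beta> \<circ> param c) (coords c ` (cdom c \<inter> points M))"
    using c unfolding smooth_fun_on_def by (rule bspec)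
  then show ?thesis using cdom_subset_points[OF smooth_M c] by (simp add: Int_absorb2)
qed

lemma smooth_spatial_part:
  assumes c: "c \<in> atlas M"
  shows "smooth_on (\<lambda>x. metric_in_chart M c (spatial_part g) x a b) (coords c ` cdom c)"
proof -
  have "smooth_tensor2 M (spatial_part g)" using splitted unfolding orthogonally_splitted_def by simp
  from conjunct2[OF this[unfolded smooth_tensor2_def]] c show ?thesis
    unfolding metric_in_chart_def by (elim ballE allE) auto
qed

lemma smooth_split_metric: "smooth_tensor2 M (split_metric \<beta> g)"
  unfolding smooth_tensor2_def
proof (intro conjI ballI allI bilinear_split_metric)
  fix c u w assume c: "c \<in> atlas M"
  have o: "open (coords c ` cdom c)" using chart_of_atlas[OF smooth_M c] unfolding is_chart_def by blast
  have "smooth_on (\<lambda>x. metric_in_chart M c (split_metric \<beta> g) x u w) (coords c ` cdom c) \<longleftrightarrow>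
    smooth_on (\<lambda>x. - (fst u * fst w) * (\<beta> \<circ> param c) x + metric_in_chart M c (spatial_part g) x u w) (coords c ` cdom c)"
    by (rule smooth_on_cong[OF o metric_in_chart_split[OF c]])
  then show "smooth_on (\<lambda>y. split_metric \<beta> g (param c y) (coord_field M c u (param c y)) (coord_field M c w (param c y))) (coords c ` cdom c)"
    using smooth_on_real_combination[OF o smooth_beta[OF c] smooth_spatial_part[OF c]]
    unfolding metric_in_chart_def by blast
qed

context
  fixes p c
  assumes p: "p \<in> points M" and c: "c = chart_at M p"
begin

lemma cp: "c \<in> atlas M" "is_chart (mtop M) c" "p \<in> cdom c"
  using manifold_chartD[OF smooth_M p] unfolding c by auto

lemma beta_differentiable: "(\<beta> \<circ> param c) differentiable (at (coords c p))"
  by (rule smooth_on_differentiable[OF smooth_beta[OF cp(1)]]) (use cp in auto)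

lemma spatial_differentiable: "(\<lambda>x. metric_in_chart M c (spatial_part g) x a b) differentiable (at (coords c p))"
  by (rule smooth_on_differentiable[OF smooth_spatial_part[OF cp(1)]]) (use cp in auto)

lemma open_chart: "open (coords c ` cdom c)" "coords c p \<in> coords c ` cdom c"
  using cp unfolding is_chart_def by auto

lemma split_metric_derivative:
  "frechet_derivative (\<lambda>x. metric_in_chart M c (split_metric \<beta> g) x a b) (at (coords c p)) v =
    - (fst a * fst b) * frechet_derivative (\<beta> \<circ> param c) (at (coords c p)) v
    + frechet_derivative (\<lambda>x. metric_in_chart M c (spatial_part g) x a b) (at (coords c p)) v"
proof -
  have "frechet_derivative (\<lambda>x. metric_in_chart M c (split_metric \<beta> g) x a b) (at (coords c p)) =
     frechet_derivative (\<lambda>x. - (fst a * fst b) * (\<beta> \<circ> param c) x + metric_in_chart M c (spatial_part g) x a b) (at (coords c p))"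
    by (rule frechet_cong_open[OF open_chart metric_in_chart_split[OF cp(1)]])
  also have "\<dots> = (\<lambda>v. - (fst a * fst b) * frechet_derivative (\<beta> \<circ> param c) (at (coords c p)) v
    + frechet_derivative (\<lambda>x. metric_in_chart M c (spatial_part g) x a b) (at (coords c p)) v)"
    by (rule frechet_derivative_at[symmetric], intro has_derivative_add has_derivative_mult_right
        beta_differentiable[unfolded frechet_derivative_works] spatial_differentiable[unfolded frechet_derivative_works])
  finally show ?thesis by simp
qed

text \<open>A derivative in the direction \<open>(1, 0)\<close> of the coordinates of the product is a derivative in \<open>t\<close> at a
  fixed point of \<open>F\<close>.\<close>

lemma time_derivative:
  assumes \<Phi>: "\<Phi> differentiable (at (coords c p))"
    and eq: "\<And>t. t \<in> I \<Longrightarrow> \<Phi> (t, coords (chart_at F (snd p)) (snd p)) = \<phi> t"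
  shows "frechet_derivative \<Phi> (at (coords c p)) (1, 0) = deriv \<phi> (fst p)"
proof -
  let ?y = "coords (chart_at F (snd p)) (snd p)"
  have cp: "coords c p = (fst p, ?y)"
    unfolding c chart_at_M by (cases p) (simp add: prod_chart_def)
  have "((\<lambda>t. (t, ?y)) has_derivative (\<lambda>h. (h, 0))) (at (fst p))"
    by (intro has_derivative_Pair has_derivative_ident has_derivative_const)
  from has_derivative_compose[OF this \<Phi>[unfolded frechet_derivative_works cp]]
  have "((\<lambda>t. \<Phi> (t, ?y)) has_derivative (\<lambda>h. frechet_derivative \<Phi> (at (fst p, ?y)) (h, 0))) (at (fst p))" .
  moreover have "(\<lambda>h. frechet_derivative \<Phi> (at (fst p, ?y)) (h, 0)) = (*) (frechet_derivative \<Phi> (at (fst p, ?y)) (1, 0))"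
  proof
    fix h show "frechet_derivative \<Phi> (at (fst p, ?y)) (h, 0) = frechet_derivative \<Phi> (at (fst p, ?y)) (1, 0) * h"
      using linear_cmul[OF linear_frechet_derivative[OF \<Phi>], of h "(1, 0)"] cp by simp
  qed
  ultimately have "((\<lambda>t. \<Phi> (t, ?y)) has_real_derivative frechet_derivative \<Phi> (at (fst p, ?y)) (1, 0)) (at (fst p))"
    unfolding has_field_derivative_def by (simp only:)
  then have "(\<phi> has_real_derivative frechet_derivative \<Phi> (at (fst p, ?y)) (1, 0)) (at (fst p))"
    by (rule has_field_derivative_transform_within_open[OF _ openI]) (use p eq points_M in auto)
  then show ?thesis unfolding cp by (rule DERIV_imp_deriv[symmetric])
qed

lemma param_time:
  assumes "t \<in> I"
  shows "param c (t, coords (chart_at F (snd p)) (snd p)) = (t, snd p)"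
proof -
  have "snd p \<in> points F" using p points_M by blast
  note d = manifold_chartD[OF F this]
  have "param c (coords c (t, snd p)) = (t, snd p)"
    by (rule param_coords[OF cp(2)]) (use assms d in \<open>simp add: c chart_at_M prod_chart_def\<close>)
  then show ?thesis unfolding c chart_at_M by (simp add: prod_chart_def)
qed

lemma beta_time_derivative:
  "frechet_derivative (\<beta> \<circ> param c) (at (coords c p)) (1, 0) = dt_beta \<beta> p"
  unfolding dt_beta_def by (rule time_derivative[OF beta_differentiable]) (simp add: param_time)

lemma spatial_time_derivative:
  "frechet_derivative (\<lambda>x. metric_in_chart M c (spatial_part g) x a b) (at (coords c p)) (1, 0) = lie_dt g p (snd a) (snd b)"
  unfolding lie_dt_def
proof (rule time_derivative[OF spatial_differentiable])
  fix t assume t: "t \<in> I"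
  have pF: "snd p \<in> points F" using p points_M by blast
  note d = manifold_chartD[OF F pF]
  have "(t, snd p) \<in> cdom (prod_chart (I, \<lambda>t. t) (chart_at F (snd p)))" using t d by (simp add: prod_chart_def)
  from coord_field_M[OF d(1) this]
  show "metric_in_chart M c (spatial_part g) (t, coords (chart_at F (snd p)) (snd p)) a b = g t (snd p) (snd a) (snd b)"
    unfolding metric_in_chart_def param_time[OF t] unfolding c chart_at_M
    by (simp add: components_self(2)[OF F pF])
qed

text \<open>The spatial part of the metric vanishes identically when one argument is \<open>\<partial>\<^sub>t\<close>.\<close>

lemma spatial_dt_derivative:
  "frechet_derivative (\<lambda>x. metric_in_chart M c (spatial_part g) x a dt_field) (at (coords c p)) v = 0"
proof -
  have "metric_in_chart M c (spatial_part g) x a dt_field = 0" if x: "x \<in> coords c ` cdom c" for x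
  proof -
    obtain d where d: "d \<in> atlas F" "c = prod_chart (I, \<lambda>t. t) d" using atlas_M[OF cp(1)] by blast
    have px: "param c x \<in> cdom c" using x cp(2) by (auto simp: param_coords)
    then have "snd (param c x) \<in> cdom d" using d(2) by (auto simp: prod_chart_def)
    from linear_0[OF linear_coord_field[OF F d(1) this]]
    have "snd (coord_field M c dt_field (param c x)) = 0"
      using coord_field_M[OF d(1)] px d(2) by (simp add: dt_field_def)
    moreover have "param c x \<in> points M" using cdom_subset_points[OF smooth_M cp(1)] px by blast
    ultimately show ?thesis
      using bilinear_rzero[OF bilinear_g, of "param c x"] unfolding metric_in_chart_def by simp
  qed
  then have "frechet_derivative (\<lambda>x. metric_in_chart M c (spatial_part g) x a dt_field) (at (coords c p)) =
    frechet_derivative (\<lambda>x. 0) (at (coords c p))"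
    by (rule frechet_cong_open[OF open_chart])
  then show ?thesis by simp
qed

end

end

section \<open>The Laplacian of the height function\<close>

locale spacelike_splitting = splitting I F \<beta> g
  for I :: "real set" and F :: "('x, 'f::euclidean_space) manifold"
    and \<beta> :: "real \<times> 'x \<Rightarrow> real" and g :: "real \<Rightarrow> ('x, 'f) tensor2" +
  fixes S :: "('s, 'e::euclidean_space) manifold" and \<iota> :: "'s \<Rightarrow> real \<times> 'x"
    and nabla :: "(real \<times> 'x \<Rightarrow> real \<times> 'f) \<Rightarrow> (real \<times> 'x \<Rightarrow> real \<times> 'f) \<Rightarrow> real \<times> 'x \<Rightarrow> real \<times> 'f"
  assumes levi_civita: "levi_civita_connection (spacetime I F) (split_metric \<beta> g) nabla"
    and spacelike: "spacelike_submanifold S (spacetime I F) (split_metric \<beta> g) \<iota>"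

sublocale spacelike_splitting \<subseteq> riemannian_immersion S "spacetime I F" "split_metric \<beta> g" nabla \<iota>
  using spacelike levi_civita smooth_M smooth_split_metric sym_split_metric
  unfolding spacelike_submanifold_def immersed_submanifold_def
  by unfold_locales auto

context spacelike_splitting
begin

abbreviation "gbar \<equiv> split_metric \<beta> g"

definition height :: "('s, 'e) chart \<Rightarrow> 'e \<Rightarrow> real" where
  "height s y = fst (\<iota> (param s y))"

definition local_beta :: "('s, 'e) chart \<Rightarrow> 'e \<Rightarrow> real" where
  "local_beta s y = \<beta> (\<iota> (param s y))"

definition gram :: "('s, 'e) chart \<Rightarrow> 'e \<Rightarrow> 'e \<Rightarrow> 'e \<Rightarrow> real" where
  "gram s y u w = metric_in_chart S s (induced_metric S M gbar \<iota>) y u w"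

text \<open>The charts of the spacetime have \<open>t\<close> itself as first coordinate, whence the height is the first
  component of the immersion in coordinates.\<close>

lemma height_derivatives:
  assumes s: "s \<in> atlas S" and c: "c \<in> atlas M" and y: "y \<in> local_rep_dom c s"
  shows "(height s has_derivative (\<lambda>u. fst (frechet_derivative (local_rep c s) (at y) u))) (at y)"
    and "((\<lambda>z. frechet_derivative (height s) (at z) w) has_derivative
       (\<lambda>u. fst (frechet_derivative (\<lambda>z. frechet_derivative (local_rep c s) (at z) w) (at y) u))) (at y)"
proof -
  note o = open_local_rep_dom[OF s c] and sm = smooth_local_rep[OF s c]
  have eq: "height s z = fst (local_rep c s z)" if "z \<in> local_rep_dom c s" for z
    using fst_coords[OF c] unfolding height_def local_rep_def by simp
  have 1: "(height s has_derivative (\<lambda>u. fst (frechet_derivative (local_rep c s) (at z) u))) (at z)"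
    if z: "z \<in> local_rep_dom c s" for z
    by (rule has_derivative_transform_within_open[OF has_derivative_fst o z])
      (use smooth_on_differentiable[OF sm z] eq in \<open>auto simp: frechet_derivative_works\<close>)
  then show "(height s has_derivative (\<lambda>u. fst (frechet_derivative (local_rep c s) (at y) u))) (at y)" using y by blast
  have "((\<lambda>z. fst (frechet_derivative (local_rep c s) (at z) w)) has_derivative
     (\<lambda>u. fst (frechet_derivative (\<lambda>z. frechet_derivative (local_rep c s) (at z) w) (at y) u))) (at y)"
    by (rule has_derivative_fst)
      (use smooth_on_differentiable[OF smooth_on_frechet[OF sm] y] in \<open>auto simp: frechet_derivative_works\<close>)
  then show "((\<lambda>z. frechet_derivative (height s) (at z) w) has_derivative
       (\<lambda>u. fst (frechet_derivative (\<lambda>z. frechet_derivative (local_rep c s) (at z) w) (at y) u))) (at y)"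
    by (rule has_derivative_transform_within_open[OF _ o y]) (metis frechet_derivative_at[OF 1])
qed

lemma local_beta_derivative:
  assumes s: "s \<in> atlas S" and q: "q \<in> cdom s" and c: "c = chart_at M (\<iota> q)"
  shows "frechet_derivative (local_beta s) (at (coords s q)) u =
    frechet_derivative (\<beta> \<circ> param c) (at (coords c (\<iota> q))) (frechet_derivative (local_rep c s) (at (coords s q)) u)"
proof -
  note image_chart = image_chart[OF s q c] and y = coords_in_local_rep_dom[OF s q c]
  note o = open_local_rep_dom[OF s image_chart(1)]
  have fq: "local_rep c s (coords s q) = coords c (\<iota> q)"
    using chart_of_atlas[OF S s] q by (simp add: local_rep_def param_coords)
  define b where "b = \<beta> \<circ> param c"
  have "frechet_derivative (local_beta s) (at (coords s q)) = frechet_derivative (b \<circ> local_rep c s) (at (coords s q))"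
    by (rule frechet_cong_open[OF o y]) (simp add: b_def local_beta_def param_local_rep(4)[OF s image_chart(1)])
  also have "\<dots> = frechet_derivative b (at (local_rep c s (coords s q))) \<circ> frechet_derivative (local_rep c s) (at (coords s q))"
  proof (rule frechet_derivative_compose)
    show "local_rep c s differentiable at (coords s q)"
      by (rule smooth_on_differentiable[OF smooth_local_rep[OF s image_chart(1)] y])
    show "b differentiable at (local_rep c s (coords s q))"
      unfolding b_def fq by (rule beta_differentiable[OF image_point[OF s q refl] c])
  qed
  finally show ?thesis unfolding fq b_def by (simp only: comp_def[of "frechet_derivative _ _"])
qed

text \<open>Orthogonality of the splitting. For tangent vectors of the submanifold the right-hand side is
  \<open>-\<beta> d\<tau>\<close>, which is how the height enters.\<close>

lemma dt_component: "gbar p dt_field V = - \<beta> p * fst V" if "p \<in> points M"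
  using bilinear_lzero[OF bilinear_g[OF that]] by (simp add: split_metric_def dt_field_def)

text \<open>In coordinates \<open>cov_coord s q u u\<close> is a second derivative of the immersion plus \<open>\<nabla>\<^bsub>V\<^esub> V\<close>, with \<open>V\<close> the
  coordinate field that equals \<open>d\<iota> u\<close> at the point. The first contributes the Hessian of the height.
  For the second, Koszul's formula gives
  \<open>g(\<partial>\<^sub>t, \<nabla>\<^bsub>V\<^esub> V) = V g(\<partial>\<^sub>t, V) - \<partial>\<^sub>t g(V, V) / 2\<close>, where \<open>g(\<partial>\<^sub>t, V) = -\<beta> dt(V)\<close> with \<open>dt(V)\<close>
  constant, and \<open>\<partial>\<^sub>t g(V, V) = -(\<partial>\<^sub>t \<beta>) dt(V)\<^sup>2 + \<xi>(u, u)\<close>.\<close>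

lemma dt_component_cov_coord:
  assumes s: "s \<in> atlas S" and q: "q \<in> cdom s"
  shows "gbar (\<iota> q) dt_field (cov_coord s q u u) =
    - \<beta> (\<iota> q) * frechet_derivative (\<lambda>z. frechet_derivative (height s) (at z) u) (at (coords s q)) u
    - frechet_derivative (local_beta s) (at (coords s q)) u * frechet_derivative (height s) (at (coords s q)) u
    + dt_beta \<beta> (\<iota> q) * (frechet_derivative (height s) (at (coords s q)) u)\<^sup>2 / 2
    - xi S I F g \<iota> q (coord_field S s u q) (coord_field S s u q) / 2"
proof -
  define c where "c = chart_at M (\<iota> q)"
  note image_chart = image_chart[OF s q c_def] and y = coords_in_local_rep_dom[OF s q c_def] and image_point = image_point[OF s q refl]
  define V where "V = frechet_derivative (local_rep c s) (at (coords s q)) u"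
  note hd = height_derivatives[OF s image_chart(1) y]
  have dT: "frechet_derivative (height s) (at (coords s q)) u = fst V"
    unfolding V_def frechet_derivative_at[OF hd(1), symmetric] ..
  have d2T: "frechet_derivative (\<lambda>z. frechet_derivative (height s) (at z) u) (at (coords s q)) u =
    fst (frechet_derivative (\<lambda>z. frechet_derivative (local_rep c s) (at z) u) (at (coords s q)) u)"
    unfolding frechet_derivative_at[OF hd(2), symmetric] ..
  have xi: "xi S I F g \<iota> q (coord_field S s u q) (coord_field S s u q) = lie_dt g (\<iota> q) (snd V) (snd V)"
    unfolding xi_def tmap_coord_field_at[OF s q c_def] V_def ..
  have "gbar (\<iota> q) dt_field (nabla (coord_field M c V) (coord_field M c V) (\<iota> q)) =
    - fst V * frechet_derivative (local_beta s) (at (coords s q)) u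
    + dt_beta \<beta> (\<iota> q) * (fst V)\<^sup>2 / 2 - lie_dt g (\<iota> q) (snd V) (snd V) / 2"
    unfolding koszul[OF image_point c_def] split_metric_derivative[OF image_point c_def] spatial_dt_derivative[OF image_point c_def]
      local_beta_derivative[OF s q c_def] V_def[symmetric]
    using beta_time_derivative[OF image_point c_def] spatial_time_derivative[OF image_point c_def, where a = V and b = V]
    by (simp add: dt_field_def power2_eq_square field_simps)
  then show ?thesis
    unfolding dT d2T xi cov_coord_eq[OF s q c_def] V_def[symmetric] bilinear_radd[OF bilinear_split_metric[OF image_point]]
    by (simp add: dt_component[OF image_point] algebra_simps)
qed

text \<open>The right-hand side is \<open>div (\<beta> grad \<tau>)\<close> in the chart \<open>s\<close>; its innermost sum is the inner
  product of \<open>e j\<close> with the vector by which the trace of \<open>D\<^sup>2\<tau>\<close> differs from the Laplacian. The proof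
  pairs the trace of the second fundamental form with \<open>\<partial>\<^sub>t\<close>: the normal part of a vector \<open>z\<close> is \<open>z\<close>
  without its components along the frame, and these components pair with \<open>\<partial>\<^sub>t\<close> to multiples
  of \<open>d\<tau>(e j)\<close>.\<close>

lemma laplacian_of_height:
  assumes s: "s \<in> atlas S" and q: "q \<in> cdom s"
  defines "y \<equiv> coords s q"
  obtains e where "orthonormal_frame (gram s y) e"
    and "gbar (\<iota> q) dt_field (mean_curvature_vector S M gbar nabla \<iota> q)
      - metric_trace (induced_metric S M gbar \<iota> q) (xi S I F g \<iota> q) / 2
      + dt_beta \<beta> (\<iota> q) * (\<Sum>i\<in>Basis. (frechet_derivative (height s) (at y) (e i))\<^sup>2) / 2
      = \<beta> (\<iota> q) * (\<Sum>i\<in>Basis. frechet_derivative (\<lambda>z. frechet_derivative (height s) (at z) (e i)) (at y) (e i))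
      + (\<Sum>j\<in>Basis. frechet_derivative (height s) (at y) (e j) *
          (frechet_derivative (local_beta s) (at y) (e j) - \<beta> (\<iota> q) * (\<Sum>i\<in>Basis.
             frechet_derivative (\<lambda>z. gram s z (e i) (e j)) (at y) (e i)
             - frechet_derivative (\<lambda>z. gram s z (e i) (e i)) (at y) (e j) / 2)))"
proof -
  define c where "c = chart_at M (\<iota> q)"
  note image_chart = image_chart[OF s q c_def] and yl = coords_in_local_rep_dom[OF s q c_def, folded y_def] and image_point = image_point[OF s q refl] and base_point = base_point[OF s q refl]
  note bil = bilinear_split_metric[OF image_point]
  let ?G = "induced_metric S M gbar \<iota> q"
  have G: "bilinear ?G" "\<And>u w. ?G u w = ?G w u" "\<And>u. u \<noteq> 0 \<Longrightarrow> ?G u u > 0"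
    using induced base_point unfolding riemannian_metric_def smooth_tensor2_def by blast+
  \<comment> \<open>the very frame that defines both traces\<close>
  define E where "E = (SOME E. orthonormal_frame ?G E)"
  have E: "orthonormal_frame ?G E"
    unfolding E_def using orthonormal_frame_exists[OF G] by (rule someI_ex)
  define e where "e i = chart_components S s q (E i)" for i
  have Ee: "E i = coord_field S s (e i) q" for i
    unfolding e_def using coord_field_components[OF S s q] by simp
  have py: "param s y = q" unfolding y_def by (rule param_coords[OF chart_of_atlas[OF S s] q])
  have frame: "orthonormal_frame (gram s y) e"
    using E unfolding orthonormal_frame_def gram_def metric_in_chart_def py Ee .
  have dE: "tmap S M \<iota> q (E i) = frechet_derivative (local_rep c s) (at y) (e i)" for i
    unfolding Ee y_def by (rule tmap_coord_field_at[OF s q c_def])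
  let ?T = "\<lambda>i. frechet_derivative (height s) (at y) (e i)"
  let ?k = "\<lambda>i j. frechet_derivative (\<lambda>z. gram s z (e i) (e j)) (at y) (e i)
             - frechet_derivative (\<lambda>z. gram s z (e i) (e i)) (at y) (e j) / 2"
  have T: "gbar (\<iota> q) dt_field (tmap S M \<iota> q (E i)) = - \<beta> (\<iota> q) * ?T i" for i
    unfolding dt_component[OF image_point] dE
    using frechet_derivative_at[OF height_derivatives(1)[OF s image_chart(1) yl]] by metis
  have k: "gbar (\<iota> q) (cov_coord s q (e i) (e i)) (tmap S M \<iota> q (E j)) = ?k i j" for i j
    unfolding dE gram_def y_def by (rule koszul_along[OF s q c_def])
  have W: "openin (mtop S) (cdom s)" using chart_of_atlas[OF S s] unfolding is_chart_def by blast
  have II: "second_fundamental_form_at S M gbar nabla \<iota> q (E i) (E i) = - normal_part S M gbar \<iota> q (cov_coord s q (e i) (e i))" for i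
    using second_fundamental_form_eq_at[OF S M \<iota> W q smooth_coord_field[OF S s], of gbar nabla "coord_field S s (e i)" "e i"]
    unfolding Ee second_fundamental_form_def cov_coord_def by simp
  have lin: "linear (gbar (\<iota> q) dt_field)" using bil unfolding bilinear_def by blast
  have IIdt: "gbar (\<iota> q) dt_field (second_fundamental_form_at S M gbar nabla \<iota> q (E i) (E i)) =
     - gbar (\<iota> q) dt_field (cov_coord s q (e i) (e i)) - \<beta> (\<iota> q) * (\<Sum>j\<in>Basis. ?k i j * ?T j)" for i
    unfolding II normal_part_eq[OF base_point E] k
    by (simp add: linear_neg[OF lin] linear_diff[OF lin] linear_sum[OF lin] linear_cmul[OF lin] T sum_distrib_left sum_negf mult_ac)
  have H: "gbar (\<iota> q) dt_field (mean_curvature_vector S M gbar nabla \<iota> q) =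
    (\<Sum>i\<in>Basis. - gbar (\<iota> q) dt_field (cov_coord s q (e i) (e i)) - \<beta> (\<iota> q) * (\<Sum>j\<in>Basis. ?k i j * ?T j))"
    unfolding mean_curvature_vector_def metric_trace_def Let_def E_def[symmetric] linear_sum[OF lin] IIdt ..
  have tr: "metric_trace ?G (xi S I F g \<iota> q) = (\<Sum>i\<in>Basis. xi S I F g \<iota> q (E i) (E i))"
    unfolding metric_trace_def Let_def E_def[symmetric] ..
  have "(\<Sum>i\<in>Basis. \<Sum>j\<in>Basis. ?k i j * ?T j) = (\<Sum>j\<in>Basis. ?T j * (\<Sum>i\<in>Basis. ?k i j))"
    by (subst sum.swap) (simp add: sum_distrib_left mult.commute)
  then have swap: "\<beta> (\<iota> q) * (\<Sum>i\<in>Basis. \<Sum>j\<in>Basis. ?k i j * ?T j) = (\<Sum>j\<in>Basis. ?T j * (\<beta> (\<iota> q) * (\<Sum>i\<in>Basis. ?k i j)))"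
    by (simp add: sum_distrib_left mult_ac)
  show ?thesis
  proof (rule that[OF frame])
    show "gbar (\<iota> q) dt_field (mean_curvature_vector S M gbar nabla \<iota> q)
      - metric_trace ?G (xi S I F g \<iota> q) / 2
      + dt_beta \<beta> (\<iota> q) * (\<Sum>i\<in>Basis. (?T i)\<^sup>2) / 2
      = \<beta> (\<iota> q) * (\<Sum>i\<in>Basis. frechet_derivative (\<lambda>z. frechet_derivative (height s) (at z) (e i)) (at y) (e i))
      + (\<Sum>j\<in>Basis. ?T j * (frechet_derivative (local_beta s) (at y) (e j) - \<beta> (\<iota> q) * (\<Sum>i\<in>Basis. ?k i j)))"
      unfolding H tr Ee dt_component_cov_coord[OF s q, folded y_def] right_diff_distrib sum_subtractf
      using swap
      by (simp add: sum.distrib sum_subtractf sum_negf sum_distrib_left sum_divide_distrib algebra_simps)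
  qed
qed

end

context spacelike_splitting
begin

lemma gram_metric:
  assumes s: "s \<in> atlas S" and y: "y \<in> coords s ` cdom s"
  shows "bilinear (gram s y)" "gram s y u w = gram s y w u" "u \<noteq> 0 \<Longrightarrow> gram s y u u > 0"
proof -
  have r: "param s y \<in> cdom s" using y chart_of_atlas[OF S s] by (auto simp: param_coords)
  then have rS: "param s y \<in> points S" using cdom_subset_points[OF S s] by blast
  let ?G = "induced_metric S M gbar \<iota> (param s y)"
  have G: "bilinear ?G" "\<And>u w. ?G u w = ?G w u" "\<And>u. u \<noteq> 0 \<Longrightarrow> ?G u u > 0"
    using induced rS unfolding riemannian_metric_def smooth_tensor2_def by blast+
  note l = linear_coord_field[OF S s r]
  show "bilinear (gram s y)"
    unfolding bilinear_def gram_def metric_in_chart_def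
    using linear_compose[OF l, of "\<lambda>a. ?G a _"] linear_compose[OF l, of "?G _"] G(1)[unfolded bilinear_def]
    by (auto simp: o_def)
  show "gram s y u w = gram s y w u" unfolding gram_def metric_in_chart_def by (rule G(2))
  assume u: "u \<noteq> 0"
  have "coord_field S s u (param s y) \<noteq> 0"
  proof
    assume 0: "coord_field S s u (param s y) = 0"
    have "u = chart_components S s (param s y) (coord_field S s u (param s y))"
      by (rule components_coord_field[OF S s rS r, symmetric])
    also have "\<dots> = chart_components S s (param s y) (coord_field S s 0 (param s y))"
      using 0 linear_0[OF l] by simp
    also have "\<dots> = 0" by (rule components_coord_field[OF S s rS r])
    finally show False using u by simp
  qed
  then show "gram s y u u > 0" unfolding gram_def metric_in_chart_def by (rule G(3))
qed

lemma smooth_gram: "s \<in> atlas S \<Longrightarrow> smooth_on (\<lambda>y. gram s y u w) (coords s ` cdom s)"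
  using induced unfolding riemannian_metric_def smooth_tensor2_def gram_def metric_in_chart_def by blast

lemma smooth_local_beta:
  assumes s: "s \<in> atlas S" and c: "c \<in> atlas M"
  shows "smooth_on (local_beta s) (local_rep_dom c s)"
proof -
  have o: "open (coords c ` cdom c)" using chart_of_atlas[OF smooth_M c] unfolding is_chart_def by blast
  have im: "local_rep c s ` local_rep_dom c s \<subseteq> coords c ` cdom c"
    using param_local_rep(2)[OF s c] unfolding local_rep_def by auto
  have "smooth_on ((\<beta> \<circ> param c) \<circ> local_rep c s) (local_rep_dom c s)"
    by (rule smooth_on_compose[OF open_local_rep_dom[OF s c] o im smooth_local_rep[OF s c] smooth_beta[OF c]])
  moreover have "local_beta s y = ((\<beta> \<circ> param c) \<circ> local_rep c s) y" if "y \<in> local_rep_dom c s" for y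
    using param_local_rep(4)[OF s c that] by (simp add: local_beta_def)
  ultimately show ?thesis using smooth_on_cong[OF open_local_rep_dom[OF s c]] by blast
qed

lemma local_beta_pos: "s \<in> atlas S \<Longrightarrow> y \<in> coords s ` cdom s \<Longrightarrow> local_beta s y > 0"
  unfolding local_beta_def using chart_of_atlas[OF S] cdom_subset_points[OF S] \<iota>_points
  by (intro \<beta>_pos) (fastforce simp: param_coords)

text \<open>Where the induced metric is at least \<open>k\<close> times the Euclidean one, its orthonormal vectors have \<open>|e i|\<^sup>2 \<le> 1 / k\<close>. With bounds \<open>K\<close> and \<open>L\<close> for the derivatives of the metric coefficients and of
  \<open>\<beta>\<close>, and with \<open>b\<close> a positive lower bound for \<open>\<beta>\<close>, the constant \<open>L / b + \<Sum>\<^sub>i 3 K / (2 k)\<close> works.\<close>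

lemma laplacian_first_order_bound:
  assumes s: "s \<in> atlas S" and p: "p \<in> cdom s"
  obtains V C where "open V" "coords s p \<in> V" "V \<subseteq> coords s ` cdom s"
    "\<And>y e j. y \<in> V \<Longrightarrow> orthonormal_frame (gram s y) e \<Longrightarrow> j \<in> Basis \<Longrightarrow>
      \<bar>frechet_derivative (local_beta s) (at y) (e j) - local_beta s y * (\<Sum>i\<in>Basis.
             frechet_derivative (\<lambda>z. gram s z (e i) (e j)) (at y) (e i)
             - frechet_derivative (\<lambda>z. gram s z (e i) (e i)) (at y) (e j) / 2)\<bar> \<le> local_beta s y * (C * norm (e j))"
proof -
  define c where "c = chart_at M (\<iota> p)"
  note image_chart = image_chart[OF s p c_def]
  let ?U = "local_rep_dom c s" and ?x = "coords s p"
  have x: "?x \<in> ?U" by (rule coords_in_local_rep_dom[OF s p c_def])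
  note o = open_local_rep_dom[OF s image_chart(1)]
  have sub: "?U \<subseteq> coords s ` cdom s" unfolding local_rep_dom_def by blast
  have bil: "\<And>y. y \<in> ?U \<Longrightarrow> bilinear (gram s y)" using gram_metric(1)[OF s] sub by blast
  have sm: "\<And>a b. smooth_on (\<lambda>y. gram s y a b) ?U" using smooth_on_subset[OF smooth_gram[OF s] sub] .
  then have co: "\<And>a b. continuous_on ?U (\<lambda>y. gram s y a b)" unfolding smooth_on_def by (metis Ck_on.simps(1))
  have pos: "\<And>a. a \<noteq> 0 \<Longrightarrow> gram s ?x a a > 0" using gram_metric(3)[OF s] x sub by blast
  obtain V1 k where V1: "open V1" "?x \<in> V1" "V1 \<subseteq> ?U" "k > 0" "\<And>y a. y \<in> V1 \<Longrightarrow> k * (norm a)\<^sup>2 \<le> gram s y a a"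
    using positive_definite_bounded_below_near[where H = "gram s", OF o x bil co pos] by blast
  obtain V2 K where V2: "open V2" "?x \<in> V2" "V2 \<subseteq> ?U" "K \<ge> 0"
    "\<And>y a b v. y \<in> V2 \<Longrightarrow> \<bar>frechet_derivative (\<lambda>x. gram s x a b) (at y) v\<bar> \<le> K * norm a * norm b * norm v"
    using bilinear_field_derivative_bounded_near[where H = "gram s", OF o x bil sm] by blast
  obtain V3 L where V3: "open V3" "?x \<in> V3" "V3 \<subseteq> ?U" "L \<ge> 0"
    "\<And>y v. y \<in> V3 \<Longrightarrow> \<bar>frechet_derivative (local_beta s) (at y) v\<bar> \<le> L * norm v"
    using smooth_derivative_bounded_near[OF o x smooth_local_beta[OF s image_chart(1)]] by blast
  \<comment> \<open>by continuity \<open>\<beta>\<close> stays above half of its value at the centre\<close>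
  define b where "b = local_beta s ?x / 2"
  have b: "b > 0" "b < local_beta s ?x" using local_beta_pos[OF s] x sub unfolding b_def by (auto simp: subset_iff)
  have "continuous_on ?U (local_beta s)" using smooth_local_beta[OF s image_chart(1)] unfolding smooth_on_def by (metis Ck_on.simps(1))
  then have V4: "open (?U \<inter> local_beta s -` {b<..})" using o by (intro continuous_open_preimage) auto
  let ?V = "V1 \<inter> V2 \<inter> V3 \<inter> (?U \<inter> local_beta s -` {b<..})"
  let ?C = "L / b + (\<Sum>i\<in>(Basis::'e set). 3 / 2 * K / k)"
  show ?thesis
  proof (rule that[of ?V ?C])
    show "open ?V" by (rule open_Int[OF open_Int[OF open_Int[OF V1(1) V2(1)] V3(1)] V4])
    show "?x \<in> ?V" using V1 V2 V3 x b by auto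
    show "?V \<subseteq> coords s ` cdom s" using sub by blast
    fix y e j assume y: "y \<in> ?V" and e: "orthonormal_frame (gram s y) e" and j: "j \<in> (Basis :: 'e set)"
    have ly: "local_beta s y > b" using y by simp
    have ne: "(norm (e i))\<^sup>2 \<le> 1 / k" if "i \<in> Basis" for i
    proof -
      have "k * (norm (e i))\<^sup>2 \<le> 1"
        using V1(5)[of y "e i"] y e that unfolding orthonormal_frame_def by auto
      then show ?thesis using V1(4) by (simp add: field_simps)
    qed
    let ?D = "\<lambda>i. frechet_derivative (\<lambda>z. gram s z (e i) (e j)) (at y) (e i)
             - frechet_derivative (\<lambda>z. gram s z (e i) (e i)) (at y) (e j) / 2"
    have D: "\<bar>?D i\<bar> \<le> 3 / 2 * K / k * norm (e j)" if i: "i \<in> Basis" for i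
    proof -
      have "\<bar>?D i\<bar> \<le> K * norm (e i) * norm (e j) * norm (e i) + K * norm (e i) * norm (e i) * norm (e j) / 2"
      proof -
        have "y \<in> V2" using y by blast
        from V2(5)[OF this, of "e i" "e j" "e i"] V2(5)[OF this, of "e i" "e i" "e j"] show ?thesis by linarith
      qed
      also have "\<dots> = (norm (e i))\<^sup>2 * (3 / 2 * K * norm (e j))"
        by (simp add: power2_eq_square field_simps)
      also have "\<dots> \<le> 1 / k * (3 / 2 * K * norm (e j))"
        using V2(4) by (intro mult_right_mono ne i) auto
      finally show ?thesis by simp
    qed
    have "\<bar>\<Sum>i\<in>Basis. ?D i\<bar> \<le> (\<Sum>i\<in>(Basis::'e set). 3 / 2 * K / k * norm (e j))"
      by (rule order_trans[OF sum_abs sum_mono[OF D]])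
    also have "\<dots> = (\<Sum>i\<in>(Basis::'e set). 3 / 2 * K / k) * norm (e j)" by (simp add: sum_distrib_right)
    finally have sumD: "\<bar>\<Sum>i\<in>Basis. ?D i\<bar> \<le> (\<Sum>i\<in>(Basis::'e set). 3 / 2 * K / k) * norm (e j)" .
    have "L * norm (e j) = b * (L / b * norm (e j))" using b(1) by simp
    also have "\<dots> \<le> local_beta s y * (L / b * norm (e j))"
      using ly V3(4) b(1) by (intro mult_right_mono) auto
    finally have "\<bar>frechet_derivative (local_beta s) (at y) (e j)\<bar> \<le> local_beta s y * (L / b * norm (e j))"
      using V3(5)[of y "e j"] y by auto
    moreover have "\<bar>local_beta s y * (\<Sum>i\<in>Basis. ?D i)\<bar> \<le> local_beta s y * ((\<Sum>i\<in>(Basis::'e set). 3 / 2 * K / k) * norm (e j))"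
      unfolding abs_mult using sumD ly b(1) by (intro mult_mono) auto
    ultimately show "\<bar>frechet_derivative (local_beta s) (at y) (e j) - local_beta s y * (\<Sum>i\<in>Basis. ?D i)\<bar>
        \<le> local_beta s y * (?C * norm (e j))"
      unfolding distrib_right distrib_left by linarith
  qed
qed

section \<open>Absence of strict local extrema\<close>

text \<open>The factor \<open>\<sigma>\<close> treats both cases at once: \<open>\<sigma> = 1\<close> is the case of minima of the height and \<open>\<sigma> = -1\<close>
  that of maxima.\<close>

lemma no_strict_local_extremum:
  assumes cond: "\<And>q. q \<in> points S \<Longrightarrow> \<sigma> * metric_trace (induced_metric S M gbar \<iota> q) (xi S I F g \<iota> q) \<ge> 0"
      "\<And>q. q \<in> points S \<Longrightarrow> \<sigma> * dt_beta \<beta> (\<iota> q) \<le> 0"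
      "\<And>q. q \<in> points S \<Longrightarrow> \<sigma> * gbar (\<iota> q) dt_field (mean_curvature_vector S M gbar nabla \<iota> q) \<le> 0"
    and W: "openin (mtop S) W" "p \<in> W" and min: "\<And>q. q \<in> W \<Longrightarrow> q \<noteq> p \<Longrightarrow> \<sigma> * fst (\<iota> p) < \<sigma> * fst (\<iota> q)"
  shows False
proof -
  have pS: "p \<in> points S" using W openin_subset by blast
  define s where "s = chart_at S p"
  note sD = manifold_chartD[OF S pS, folded s_def]
  obtain V C where V: "open V" "coords s p \<in> V" "V \<subseteq> coords s ` cdom s"
    and C: "\<And>y e j. y \<in> V \<Longrightarrow> orthonormal_frame (gram s y) e \<Longrightarrow> j \<in> Basis \<Longrightarrow>
      \<bar>frechet_derivative (local_beta s) (at y) (e j) - local_beta s y * (\<Sum>i\<in>Basis.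
             frechet_derivative (\<lambda>z. gram s z (e i) (e j)) (at y) (e i)
             - frechet_derivative (\<lambda>z. gram s z (e i) (e i)) (at y) (e j) / 2)\<bar> \<le> local_beta s y * (C * norm (e j))"
    using laplacian_first_order_bound[OF sD(1,3)] by blast
  define U where "U = V \<inter> coords s ` (cdom s \<inter> W)"
  have U: "open U" "coords s p \<in> U"
    unfolding U_def using V sD W chart_overlap_open[OF S sD(1) W(1)] by auto
  have inU: "\<exists>q. q \<in> cdom s \<and> q \<in> W \<and> y = coords s q \<and> param s y = q" if "y \<in> U" for y
    using that param_coords[OF sD(2)] unfolding U_def by auto
  define T where "T y = \<sigma> * height s y" for y
  have hT: "(height s has_derivative frechet_derivative (height s) (at y)) (at y)"
    and hT2: "\<And>v. ((\<lambda>z. frechet_derivative (height s) (at z) v) has_derivative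
        frechet_derivative (\<lambda>z. frechet_derivative (height s) (at z) v) (at y)) (at y)" if y: "y \<in> U" for y
  proof -
    obtain q where q: "q \<in> cdom s" "y = coords s q" using inU[OF y] by blast
    note c = image_chart(1)[OF sD(1) q(1) refl] coords_in_local_rep_dom[OF sD(1) q(1) refl, folded q(2)]
    show "(height s has_derivative frechet_derivative (height s) (at y)) (at y)"
      using height_derivatives(1)[OF sD(1) c] differentiableI frechet_derivative_works by blast
    show "((\<lambda>z. frechet_derivative (height s) (at z) v) has_derivative
        frechet_derivative (\<lambda>z. frechet_derivative (height s) (at z) v) (at y)) (at y)" for v
      using height_derivatives(2)[OF sD(1) c] differentiableI frechet_derivative_works by blast
  qed
  have T1: "(T has_derivative (\<lambda>v. \<sigma> * frechet_derivative (height s) (at y) v)) (at y)" if "y \<in> U" for y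
    unfolding T_def by (rule has_derivative_mult_right[OF hT[OF that]])
  have eT1: "frechet_derivative T (at y) v = \<sigma> * frechet_derivative (height s) (at y) v" if "y \<in> U" for y v
    using frechet_derivative_at[OF T1[OF that]] by metis
  have T2: "((\<lambda>z. frechet_derivative T (at z) v) has_derivative
     (\<lambda>w. \<sigma> * frechet_derivative (\<lambda>z. frechet_derivative (height s) (at z) v) (at y) w)) (at y)" if y: "y \<in> U" for y v
    by (rule has_derivative_transform_within_open[OF has_derivative_mult_right[OF hT2[OF y]] U(1) y]) (simp add: eT1)
  show False
  proof (rule no_strict_local_min_of_elliptic_inequality[OF U, where T = T and C = C and J = Basis])
    show "T (coords s p) < T y" if y: "y \<in> U" and ne: "y \<noteq> coords s p" for y
    proof -
      obtain q where q: "q \<in> cdom s" "q \<in> W" "y = coords s q" "param s y = q" using inU[OF y] by blast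
      then have "q \<noteq> p" using ne by auto
      then show ?thesis
        using min[OF q(2)] q(4) param_coords[OF sD(2,3)] unfolding T_def height_def by simp
    qed
    show "T differentiable (at y)" if "y \<in> U" for y using differentiableI[OF T1[OF that]] .
    show "(\<lambda>z. frechet_derivative T (at z) v) differentiable (at y)" if "y \<in> U" for y v
      using differentiableI[OF T2[OF that]] .
    show "finite (Basis :: 'e set)" by simp
    fix y assume y: "y \<in> U"
    obtain q where q: "q \<in> cdom s" "y = coords s q" "param s y = q" using inU[OF y] by blast
    have yV: "y \<in> V" using y unfolding U_def by blast
    have base_point: "q \<in> points S" using cdom_subset_points[OF S sD(1)] q(1) by blast
    have lq: "local_beta s y = \<beta> (\<iota> q)" unfolding local_beta_def q(3) ..
    have bpos: "\<beta> (\<iota> q) > 0" by (rule \<beta>_pos[OF \<iota>_points[OF base_point]])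
    let ?T = "\<lambda>v. frechet_derivative (height s) (at y) v"
    let ?T2 = "\<lambda>v. frechet_derivative (\<lambda>z. frechet_derivative (height s) (at z) v) (at y) v"
    obtain e where e: "orthonormal_frame (gram s y) e" and id: "gbar (\<iota> q) dt_field (mean_curvature_vector S M gbar nabla \<iota> q)
      - metric_trace (induced_metric S M gbar \<iota> q) (xi S I F g \<iota> q) / 2
      + dt_beta \<beta> (\<iota> q) * (\<Sum>i\<in>Basis. (?T (e i))\<^sup>2) / 2
      = \<beta> (\<iota> q) * (\<Sum>i\<in>Basis. ?T2 (e i))
      + (\<Sum>j\<in>Basis. ?T (e j) *
          (frechet_derivative (local_beta s) (at y) (e j) - \<beta> (\<iota> q) * (\<Sum>i\<in>Basis.
             frechet_derivative (\<lambda>z. gram s z (e i) (e j)) (at y) (e i)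
             - frechet_derivative (\<lambda>z. gram s z (e i) (e i)) (at y) (e j) / 2)))"
      using laplacian_of_height[OF sD(1) q(1)] unfolding q(2) by blast
    define B where "B j = frechet_derivative (local_beta s) (at y) (e j) - \<beta> (\<iota> q) * (\<Sum>i\<in>Basis.
             frechet_derivative (\<lambda>z. gram s z (e i) (e j)) (at y) (e i)
             - frechet_derivative (\<lambda>z. gram s z (e i) (e i)) (at y) (e j) / 2)" for j
    have B: "\<bar>B j\<bar> \<le> \<beta> (\<iota> q) * (C * norm (e j))" if "j \<in> Basis" for j
      using C[OF yV e that] unfolding B_def lq .
    have "(\<Sum>i\<in>Basis. (?T (e i))\<^sup>2) \<ge> 0" by (intro sum_nonneg) simp
    then have "\<sigma> * dt_beta \<beta> (\<iota> q) * (\<Sum>i\<in>Basis. (?T (e i))\<^sup>2) \<le> 0"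
      using cond(2)[OF base_point] by (rule mult_nonpos_nonneg[rotated])
    then have "\<sigma> * (gbar (\<iota> q) dt_field (mean_curvature_vector S M gbar nabla \<iota> q)
      - metric_trace (induced_metric S M gbar \<iota> q) (xi S I F g \<iota> q) / 2
      + dt_beta \<beta> (\<iota> q) * (\<Sum>i\<in>Basis. (?T (e i))\<^sup>2) / 2) \<le> 0"
      using cond(1,3)[OF base_point] by (simp add: algebra_simps)
    then have "\<sigma> * (\<beta> (\<iota> q) * (\<Sum>i\<in>Basis. ?T2 (e i)) + (\<Sum>j\<in>Basis. ?T (e j) * B j)) \<le> 0"
      unfolding id B_def .
    then have "\<beta> (\<iota> q) * (\<Sum>i\<in>Basis. \<sigma> * ?T2 (e i)) \<le> (\<Sum>j\<in>Basis. - (\<sigma> * ?T (e j) * B j))"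
      by (simp add: sum_distrib_left distrib_left sum_negf mult_ac)
    also have "\<dots> \<le> (\<Sum>j\<in>Basis. \<bar>\<sigma> * ?T (e j)\<bar> * (\<beta> (\<iota> q) * (C * norm (e j))))"
    proof (rule sum_mono)
      fix j assume j: "j \<in> (Basis :: 'e set)"
      have "- (\<sigma> * ?T (e j) * B j) \<le> \<bar>\<sigma> * ?T (e j)\<bar> * \<bar>B j\<bar>"
        by (metis abs_ge_minus_self abs_mult)
      also have "\<dots> \<le> \<bar>\<sigma> * ?T (e j)\<bar> * (\<beta> (\<iota> q) * (C * norm (e j)))"
        using B[OF j] by (rule mult_left_mono) simp
      finally show "- (\<sigma> * ?T (e j) * B j) \<le> \<bar>\<sigma> * ?T (e j)\<bar> * (\<beta> (\<iota> q) * (C * norm (e j)))" .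
    qed
    also have "\<dots> = \<beta> (\<iota> q) * (C * (\<Sum>j\<in>Basis. \<bar>\<sigma> * ?T (e j)\<bar> * norm (e j)))"
      by (simp add: sum_distrib_left mult_ac)
    finally have "(\<Sum>i\<in>Basis. \<sigma> * ?T2 (e i)) \<le> C * (\<Sum>j\<in>Basis. \<bar>\<sigma> * ?T (e j)\<bar> * norm (e j))"
      using bpos by (simp only: mult_le_cancel_left_pos)
    moreover have "frechet_derivative (\<lambda>z. frechet_derivative T (at z) v) (at y) v = \<sigma> * ?T2 v" for v
      using frechet_derivative_at[OF T2[OF y]] by metis
    moreover have "\<exists>i\<in>Basis. e i \<noteq> 0"
    proof -
      obtain i where i: "i \<in> (Basis :: 'e set)" using nonempty_Basis by blast
      have "y \<in> coords s ` cdom s" using yV V(3) by blast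
      from bilinear_lzero[OF gram_metric(1)[OF sD(1) this]] have "e i \<noteq> 0"
        using e i unfolding orthonormal_frame_def by force
      then show ?thesis using i by blast
    qed
    ultimately show "\<exists>e. (\<exists>i\<in>(Basis :: 'e set). e i \<noteq> 0) \<and>
       (\<Sum>i\<in>Basis. frechet_derivative (\<lambda>z. frechet_derivative T (at z) (e i)) (at y) (e i)) \<le>
       C * (\<Sum>i\<in>Basis. \<bar>frechet_derivative T (at y) (e i)\<bar> * norm (e i))"
      unfolding eT1[OF y] by (intro exI[of _ e]) simp
  qed
qed

end

theorem theorem5p2:
  fixes n m :: nat
    and I :: "real set"
    and F :: "('x, 'f::euclidean_space) manifold"
    and \<beta> :: "real \<times> 'x \<Rightarrow> real"
    and g :: "real \<Rightarrow> ('x, 'f) tensor2"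
    and S :: "('s, 'e::euclidean_space) manifold"
    and \<iota> :: "'s \<Rightarrow> real \<times> 'x"
    and nabla :: "(real \<times> 'x \<Rightarrow> real \<times> 'f) \<Rightarrow> (real \<times> 'x \<Rightarrow> real \<times> 'f) \<Rightarrow> real \<times> 'x \<Rightarrow> real \<times> 'f"
  defines "M \<equiv> spacetime I F"
    and "gbar \<equiv> split_metric \<beta> g"
  defines "H \<equiv> mean_curvature_vector S M gbar nabla \<iota>"
    and "tr_xi \<equiv> \<lambda>p. metric_trace (induced_metric S M gbar \<iota> p) (xi S I F g \<iota> p)"
    and "\<tau> \<equiv> \<lambda>p. fst (\<iota> p)"
  assumes "n \<ge> 2" and "DIM('e) = n" and "DIM('f) = n + m"
    and "orthogonally_splitted I F \<beta> g"
    and "levi_civita_connection M gbar nabla"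
    and "spacelike_submanifold S M gbar \<iota>"
  shows "((\<forall>p\<in>points S. tr_xi p \<ge> 0 \<and> dt_beta \<beta> (\<iota> p) \<le> 0) \<and>
          (\<forall>p\<in>points S. gbar (\<iota> p) dt_field (H p) \<le> 0)
            \<longrightarrow> \<not> (\<exists>p\<in>points S. strict_local_min (mtop S) \<tau> p)) \<and>
         ((\<forall>p\<in>points S. tr_xi p \<le> 0 \<and> dt_beta \<beta> (\<iota> p) \<ge> 0) \<and>
          (\<forall>p\<in>points S. gbar (\<iota> p) dt_field (H p) \<ge> 0)
            \<longrightarrow> \<not> (\<exists>p\<in>points S. strict_local_max (mtop S) \<tau> p))"
proof -
  interpret spacelike_splitting I F \<beta> g S \<iota> nabla
    using assms unfolding M_def gbar_def by unfold_locales auto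
  note defs = tr_xi_def H_def M_def gbar_def \<tau>_def
  show ?thesis
  proof (intro conjI impI notI; elim conjE bexE)
    fix p assume 1: "\<forall>p\<in>points S. tr_xi p \<ge> 0 \<and> dt_beta \<beta> (\<iota> p) \<le> 0"
      and 2: "\<forall>p\<in>points S. gbar (\<iota> p) dt_field (H p) \<le> 0" and "strict_local_min (mtop S) \<tau> p"
    then obtain W where W: "openin (mtop S) W" "p \<in> W" "\<forall>q\<in>W. q \<noteq> p \<longrightarrow> \<tau> p < \<tau> q"
      unfolding strict_local_min_def by blast
    show False
      by (rule no_strict_local_extremum[of 1, OF _ _ _ W(1,2)]) (use 1 2 W(3) in \<open>auto simp: defs\<close>)
  next
    fix p assume 1: "\<forall>p\<in>points S. tr_xi p \<le> 0 \<and> dt_beta \<beta> (\<iota> p) \<ge> 0"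
      and 2: "\<forall>p\<in>points S. gbar (\<iota> p) dt_field (H p) \<ge> 0" and "strict_local_max (mtop S) \<tau> p"
    then obtain W where W: "openin (mtop S) W" "p \<in> W" "\<forall>q\<in>W. q \<noteq> p \<longrightarrow> \<tau> q < \<tau> p"
      unfolding strict_local_max_def by blast
    show False
      by (rule no_strict_local_extremum[of "-1", OF _ _ _ W(1,2)]) (use 1 2 W(3) in \<open>auto simp: defs\<close>)
  qed
qed

end
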